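(* Let $M$ be a (connected) Riemann surface and let $f_1,f_2:M\to S^3$ be two non-congruent conformal immersions inducing the same Hopf differentials (i.e. $\kappa_1=\kappa_2$ in every local holomorphic coordinate of $M$). Then $f_1$ and $f_2$ are isothermic surfaces in the same associated family.
   Context: Let $\mathbb R^{4,1}$ carry the Lorentzian form $\langle v,v\rangle=-v_0^2+\sum_{k=1}^{4}v_k^2$ (extended complex bilinearly), with forward light cone $\mathcal L_+$. Identify $S^3$ with the projectivized light cone via $x\leftrightarrow[1:x]$; Möbius transformations are the conformal diffeomorphisms of $S^3$, induced by Lorentz transformations. Two immersions $f_1,f_2$ are congruent if $f_2=T\circ f_1$ for some Möbius transformation $T$. For a conformal immersion $f:M\to S^3$ and a local holomorphic coordinate $z$ there is a unique normalized lift $\psi$ with values in $\mathcal L_+$ such that $\psi(p)$ spans the null line $f(p)$ and $|d\psi|^2=|dz|^2$. Let $V=\mathrm{span}\{\psi,d\psi,\psi_{z\bar z}\}$, a rank $4$ subbundle of $M\times\mathbb R^{4,1}$ of signature $(3,1)$; $V^\perp$ is a real line bundle, trivialized by a unit section using the orientations of $M$ and $S^3$. The equation $\psi_{zz}+\frac c2\psi=\kappa$ defines the Schwarzian derivative $c=S_z(f)$ and the Hopf differential $\kappa\in\Gamma(V^\perp\otimes\mathbb C)$, regarded as a complex valued function; $\kappa\frac{dz^2}{|dz|}$ is independent of the coordinate $z$. Umbilic points are the zeros of $\kappa$. The surface $f$ is isothermic if around each non-umbilic point there is a holomorphic coordinate $z$ in which $\kappa$ is real valued. In such a coordinate the associated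 family of the isothermic surface consists of the surfaces with invariants $(\kappa,\,c_r=c+r)$, $r\in\mathbb R$ (these again satisfy the integrability conditions). Working locally away from umbilic points, two isothermic surfaces $f_1,f_2$ are in the same associated family if around each non-umbilic point there is a holomorphic coordinate $z$ in which $\kappa_1=\kappa_2$ is real valued and $c_1-c_2$ is a real constant. *)

theory Defs
  imports "HOL-Complex_Analysis.Complex_Analysis"
begin

primrec Ck_on :: "nat \<Rightarrow> 'a::real_normed_vector set \<Rightarrow> ('a \<Rightarrow> 'b::real_normed_vector) \<Rightarrow> bool" where
  "Ck_on 0 S f \<longleftrightarrow> continuous_on S f"
| "Ck_on (Suc k) S f \<longleftrightarrow>
     (\<forall>x\<in>S. f differentiable (at x)) \<and> (\<forall>v. Ck_on k S (\<lambda>x. frechet_derivative f (at x) v))"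

text \<open>To be used for open \<open>S\<close> only.\<close>

definition smooth_on :: "'a::real_normed_vector set \<Rightarrow> ('a \<Rightarrow> 'b::real_normed_vector) \<Rightarrow> bool" where
  "smooth_on S f \<longleftrightarrow> (\<forall>k. Ck_on k S f)"

definition d_x :: "(complex \<Rightarrow> 'b::real_normed_vector) \<Rightarrow> complex \<Rightarrow> 'b" where
  "d_x F w = frechet_derivative F (at w) 1"

definition d_y :: "(complex \<Rightarrow> 'b::real_normed_vector) \<Rightarrow> complex \<Rightarrow> 'b" where
  "d_y F w = frechet_derivative F (at w) \<i>"

definition d_z :: "(complex \<Rightarrow> complex ^ 'n) \<Rightarrow> complex \<Rightarrow> complex ^ 'n" where
  "d_z F w = (1/2) *s (d_x F w - \<i> *s d_y F w)"

text \<open>The mixed derivative \<open>F_{z zbar} = (F_xx + F_yy) / 4\<close>, which is real for real \<open>F\<close>.\<close>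

definition d_zzbar :: "(complex \<Rightarrow> 'b::real_normed_vector) \<Rightarrow> complex \<Rightarrow> 'b" where
  "d_zzbar F w = (1/4) *\<^sub>R (d_x (d_x F) w + d_y (d_y F) w)"

text \<open>The underlying space is a Hausdorff type \<open>'m\<close>. A chart is a pair of its domain and a
  function that is relevant on this domain only. Second countability is not required; it is
  automatic on connected surfaces.\<close>

type_synonym 'm chart = "'m set \<times> ('m \<Rightarrow> complex)"

definition is_chart :: "'m::topological_space chart \<Rightarrow> bool" where
  "is_chart = (\<lambda>(U, z). open U \<and> open (z ` U) \<and> homeomorphism U (z ` U) z (inv_into U z))"

definition holomorphic_transition :: "'m chart \<Rightarrow> 'm chart \<Rightarrow> bool" where
  "holomorphic_transition = (\<lambda>(U, z) (U', z').
     (z' \<circ> inv_into U z) holomorphic_on z ` (U \<inter> U'))"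

definition riemann_surface :: "'m::t2_space chart set \<Rightarrow> bool" where
  "riemann_surface \<A> \<longleftrightarrow>
     \<Union> (fst ` \<A>) = UNIV \<and> (\<forall>C\<in>\<A>. is_chart C) \<and>
     (\<forall>C\<in>\<A>. \<forall>C'\<in>\<A>. holomorphic_transition C C')"

text \<open>Local holomorphic coordinates are the charts of the maximal atlas.\<close>

definition holomorphic_coordinate :: "'m::t2_space chart set \<Rightarrow> 'm chart \<Rightarrow> bool" where
  "holomorphic_coordinate \<A> C \<longleftrightarrow> is_chart C \<and>
     (\<forall>C'\<in>\<A>. holomorphic_transition C C' \<and> holomorphic_transition C' C)"

definition in_coordinate :: "'m chart \<Rightarrow> ('m \<Rightarrow> 'b) \<Rightarrow> complex \<Rightarrow> 'b" where
  "in_coordinate = (\<lambda>(U, z) f. f \<circ> inv_into U z)"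

definition coordinate_range :: "'m chart \<Rightarrow> complex set" where
  "coordinate_range = (\<lambda>(U, z). z ` U)"

text \<open>The index \<open>None\<close> is the time coordinate. For \<open>'a = complex\<close> the form below is the
  complex bilinear extension of the Lorentzian form.\<close>

definition lorentz :: "'a::comm_ring_1 ^ 4 option \<Rightarrow> 'a ^ 4 option \<Rightarrow> 'a" where
  "lorentz v w = - (v $ None * w $ None) + (\<Sum>k\<in>UNIV. v $ Some k * w $ Some k)"

definition forward_light_cone :: "(real ^ 4 option) set" where
  "forward_light_cone = {v. lorentz v v = 0 \<and> v $ None > 0}"

definition complexify :: "real ^ 'n \<Rightarrow> complex ^ 'n" where
  "complexify v = (\<chi> i. complex_of_real (v $ i))"

abbreviation S3 :: "(real ^ 4) set" where
  "S3 \<equiv> sphere 0 1"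

definition light_vector :: "real ^ 4 \<Rightarrow> real ^ 4 option" where
  "light_vector x = (\<chi> i. case i of None \<Rightarrow> 1 | Some k \<Rightarrow> x $ k)"

definition lorentz_transformation :: "(real ^ 4 option \<Rightarrow> real ^ 4 option) \<Rightarrow> bool" where
  "lorentz_transformation A \<longleftrightarrow> linear A \<and> (\<forall>v w. lorentz (A v) (A w) = lorentz v w)"

text \<open>The action on the null lines \<open>[1 : x]\<close>. Orientation reversing transformations are
  included.\<close>

definition moebius_transformation :: "(real ^ 4 \<Rightarrow> real ^ 4) \<Rightarrow> bool" where
  "moebius_transformation T \<longleftrightarrow> (\<exists>A. lorentz_transformation A \<and>
     (\<forall>x\<in>S3. T x \<in> S3 \<and> span {A (light_vector x)} = span {light_vector (T x)}))"

definition moebius_congruent :: "('m \<Rightarrow> real ^ 4) \<Rightarrow> ('m \<Rightarrow> real ^ 4) \<Rightarrow> bool" where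
  "moebius_congruent f\<^sub>1 f\<^sub>2 \<longleftrightarrow> (\<exists>T. moebius_transformation T \<and> f\<^sub>2 = T \<circ> f\<^sub>1)"

definition conformal_immersion :: "'m::t2_space chart set \<Rightarrow> ('m \<Rightarrow> real ^ 4) \<Rightarrow> bool" where
  "conformal_immersion \<A> f \<longleftrightarrow> range f \<subseteq> S3 \<and>
     (\<forall>C. holomorphic_coordinate \<A> C \<longrightarrow>
        smooth_on (coordinate_range C) (in_coordinate C f) \<and>
        (\<forall>w\<in>coordinate_range C. \<exists>\<rho>>0. \<forall>u v.
           frechet_derivative (in_coordinate C f) (at w) u \<bullet>
           frechet_derivative (in_coordinate C f) (at w) v = \<rho> * (u \<bullet> v)))"

text \<open>In the following definitions \<open>g\<close> is the coordinate expression of \<open>f\<close> on the open set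
  \<open>\<Omega>\<close>.\<close>

definition is_normalized_lift ::
  "complex set \<Rightarrow> (complex \<Rightarrow> real ^ 4) \<Rightarrow> (complex \<Rightarrow> real ^ 4 option) \<Rightarrow> bool" where
  "is_normalized_lift \<Omega> g \<psi> \<longleftrightarrow> smooth_on \<Omega> \<psi> \<and>
     (\<forall>w\<in>\<Omega>. \<psi> w \<in> forward_light_cone \<and> span {\<psi> w} = span {light_vector (g w)} \<and>
        (\<forall>v. lorentz (frechet_derivative \<psi> (at w) v) (frechet_derivative \<psi> (at w) v) = (norm v)\<^sup>2))"

text \<open>The normalized lift is unique on \<open>\<Omega>\<close>; its values elsewhere are irrelevant.\<close>

definition normalized_lift ::
  "complex set \<Rightarrow> (complex \<Rightarrow> real ^ 4) \<Rightarrow> complex \<Rightarrow> real ^ 4 option" where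
  "normalized_lift \<Omega> g = (SOME \<psi>. is_normalized_lift \<Omega> g \<psi>)"

definition V_fibre :: "(complex \<Rightarrow> real ^ 4 option) \<Rightarrow> complex \<Rightarrow> (real ^ 4 option) set" where
  "V_fibre \<psi> w = span ({\<psi> w} \<union> range (frechet_derivative \<psi> (at w)) \<union> {d_zzbar \<psi> w})"

definition V_perp :: "(complex \<Rightarrow> real ^ 4 option) \<Rightarrow> complex \<Rightarrow> (real ^ 4 option) set" where
  "V_perp \<psi> w = {n. \<forall>v\<in>V_fibre \<psi> w. lorentz n v = 0}"

text \<open>The orientation condition on \<open>n\<close> corresponds to the normal \<open>\<nu>\<close> of the surface in \<open>S3\<close>
  for which \<open>(f, f_x, f_y, \<nu>)\<close> is a positive basis of \<open>\<real>\<^sup>4\<close>, that is, to the complex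
  orientation of the surface and the orientation of \<open>S3\<close> by the outer normal: in the model case
  \<open>f = e1\<close>, \<open>f_x = e2\<close>, \<open>f_y = e3\<close>, \<open>\<nu> = e4\<close>, the rows are \<open>(e0 - e1)/4\<close>, \<open>e0 + e1\<close>,
  \<open>e2\<close>, \<open>e3\<close>, \<open>e4\<close> up to terms that do not change the determinant.\<close>

definition is_unit_normal ::
  "(complex \<Rightarrow> real ^ 4 option) \<Rightarrow> complex \<Rightarrow> real ^ 4 option \<Rightarrow> bool" where
  "is_unit_normal \<psi> w n \<longleftrightarrow> n \<in> V_perp \<psi> w \<and> lorentz n n = 1 \<and>
     det ((\<chi> i. case i of
                  None \<Rightarrow> d_zzbar \<psi> w
                | Some k \<Rightarrow> vector [\<psi> w, d_x \<psi> w, d_y \<psi> w, n] $ (k::4))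
          :: real ^ 4 option ^ 4 option) > 0"

definition unit_normal :: "(complex \<Rightarrow> real ^ 4 option) \<Rightarrow> complex \<Rightarrow> real ^ 4 option" where
  "unit_normal \<psi> w = (THE n. is_unit_normal \<psi> w n)"

definition schwarzian_hopf_eq ::
  "(complex \<Rightarrow> real ^ 4 option) \<Rightarrow> complex \<Rightarrow> complex \<Rightarrow> complex \<Rightarrow> bool" where
  "schwarzian_hopf_eq \<psi> w c \<kappa> \<longleftrightarrow>
     d_z (d_z (complexify \<circ> \<psi>)) w + (c / 2) *s complexify (\<psi> w) =
     \<kappa> *s complexify (unit_normal \<psi> w)"

definition schwarzian :: "('m \<Rightarrow> real ^ 4) \<Rightarrow> 'm chart \<Rightarrow> 'm \<Rightarrow> complex" where
  "schwarzian f C p =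
     (let \<psi> = normalized_lift (coordinate_range C) (in_coordinate C f)
      in THE c. \<exists>\<kappa>. schwarzian_hopf_eq \<psi> (snd C p) c \<kappa>)"

definition hopf :: "('m \<Rightarrow> real ^ 4) \<Rightarrow> 'm chart \<Rightarrow> 'm \<Rightarrow> complex" where
  "hopf f C p =
     (let \<psi> = normalized_lift (coordinate_range C) (in_coordinate C f)
      in THE \<kappa>. \<exists>c. schwarzian_hopf_eq \<psi> (snd C p) c \<kappa>)"

text \<open>The vanishing of the Hopf differential does not depend on the coordinate.\<close>

definition umbilic :: "'m::t2_space chart set \<Rightarrow> ('m \<Rightarrow> real ^ 4) \<Rightarrow> 'm \<Rightarrow> bool" where
  "umbilic \<A> f p \<longleftrightarrow> (\<exists>C. holomorphic_coordinate \<A> C \<and> p \<in> fst C \<and> hopf f C p = 0)"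

definition isothermic :: "'m::t2_space chart set \<Rightarrow> ('m \<Rightarrow> real ^ 4) \<Rightarrow> bool" where
  "isothermic \<A> f \<longleftrightarrow> (\<forall>p. \<not> umbilic \<A> f p \<longrightarrow>
     (\<exists>C. holomorphic_coordinate \<A> C \<and> p \<in> fst C \<and> (\<forall>q\<in>fst C. hopf f C q \<in> \<real>)))"

definition same_associated_family ::
  "'m::t2_space chart set \<Rightarrow> ('m \<Rightarrow> real ^ 4) \<Rightarrow> ('m \<Rightarrow> real ^ 4) \<Rightarrow> bool" where
  "same_associated_family \<A> f\<^sub>1 f\<^sub>2 \<longleftrightarrow>
     (\<forall>p. \<not> umbilic \<A> f\<^sub>1 p \<or> \<not> umbilic \<A> f\<^sub>2 p \<longrightarrow>
       (\<exists>C. holomorphic_coordinate \<A> C \<and> p \<in> fst C \<and>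
          (\<forall>q\<in>fst C. hopf f\<^sub>1 C q = hopf f\<^sub>2 C q \<and> hopf f\<^sub>1 C q \<in> \<real>) \<and>
          (\<exists>r::real. \<forall>q\<in>fst C. schwarzian f\<^sub>1 C q - schwarzian f\<^sub>2 C q = complex_of_real r)))"

end

theory Submission
  imports Defs
begin

text \<open>Fix a local coordinate and complexify the normalized lift \<open>\<psi>\<close> of a surface. Its Gram matrix with
  \<open>\<psi>_z\<close>, \<open>\<psi>_{zbar}\<close>, \<open>X = \<psi>_{z zbar}\<close> and the unit normal \<open>N\<close> involves only the Hopf differential
  \<open>\<kappa>\<close>. This frame satisfies linear structure equations, whose compatibility consists of the equations of
  Gauss and Codazzi: the \<open>zbar\<close>-derivative of the Schwarzian \<open>c\<close> is a function of \<open>\<kappa>\<close> and its first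
  derivatives, and \<open>2 \<kappa>_{zbar zbar} + \<kappa> cnj c\<close> is real.

  For two surfaces with the same \<open>\<kappa>\<close> these equations say that \<open>D = c\<^sub>1 - c\<^sub>2\<close> is holomorphic and that
  \<open>\<kappa> cnj D\<close> is real (\<open>holomorphic_D\<close>, \<open>hopf_D_real\<close>). Under a change of coordinate the Schwarzian
  transforms like the classical one, with an inhomogeneous term that is the same for both surfaces, so
  \<open>D dz\<^sup>2\<close> is a holomorphic quadratic differential on the whole surface
  (\<open>schwarzian_difference_coordinate_change\<close>). By the identity theorem and connectedness it either
  vanishes identically or has no interior points in its zero set.

  If it vanishes identically, both frames solve the same linear system. Then the linear map that carries
  one frame to the other has derivative zero, and it is a Lorentz transformation because the Gram
  matrices agree (\<open>local_congruence\<close>). Such a transformation is determined by its effect on a small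
  piece of the surface once its determinant is required to be positive (\<open>rigidity\<close>), so that the local
  transformations coincide and the surfaces are congruent (\<open>flat_imp_congruent\<close>).

  Otherwise, let \<open>\<kappa>\<close> be nonzero at a point. There \<open>D\<close> is nonzero as well: around an isolated zero the
  phase of \<open>D\<close> turns, while it agrees up to sign with the continuous phase of \<open>\<kappa>\<close>
  (\<open>nonzero_if_real_against_nonvanishing\<close>). Hence the integral of the square root of \<open>D\<close> is a
  coordinate, in which the quadratic differential becomes \<open>dz\<^sup>2\<close>: the Schwarzians differ by the
  constant 1, and \<open>\<kappa> cnj D\<close> real means that \<open>\<kappa>\<close> is real (\<open>isothermic_coordinate\<close>).\<close>

section \<open>Smooth maps on open sets\<close>

text \<open>On an open set, any formula for the derivative that holds on the set may replace the Frechet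
  derivative of the recursive definition, since a change off the set does not affect derivatives
  at its points. The closure properties below are inductions on the order of smoothness, each with
  the usual differentiation rule as its step.\<close>

lemma Ck_on_SucI:
  assumes "open S" "\<And>x. x \<in> S \<Longrightarrow> (f has_derivative f' x) (at x)"
    and "\<And>v. Ck_on k S (\<lambda>x. f' x v)"
  shows "Ck_on (Suc k) S f"
proof -
  have *: "frechet_derivative f (at x) = f' x" if "x \<in> S" for x
    using assms(2)[OF that] frechet_derivative_at by metis
  have cong: "Ck_on k S g" if "Ck_on k S h" "\<And>x. x \<in> S \<Longrightarrow> g x = h x" for g h :: "'a \<Rightarrow> 'b"
    using that
  proof (induction k arbitrary: g h)
    case 0
    then show ?case by (metis Ck_on.simps(1) continuous_on_cong)
  next
    case (Suc k)
    have d: "(g has_derivative frechet_derivative h (at x)) (at x)" if x: "x \<in> S" for x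
    proof -
      have "(h has_derivative frechet_derivative h (at x)) (at x)"
        using Suc.prems(1) x frechet_derivative_works by auto
      then show ?thesis
        by (rule has_derivative_transform_within_open[OF _ assms(1) x]) (metis Suc.prems(2))
    qed
    have gh: "frechet_derivative g (at x) = frechet_derivative h (at x)" if x: "x \<in> S" for x
      using frechet_derivative_at[OF d[OF x]] by simp
    have "Ck_on k S (\<lambda>x. frechet_derivative g (at x) v)" for v
      by (rule Suc.IH[where h = "\<lambda>x. frechet_derivative h (at x) v"])
         (use Suc.prems(1) gh in simp_all)
    moreover have "g differentiable at x" if "x \<in> S" for x
      using d[OF that] by (rule differentiableI)
    ultimately show ?case by simp
  qed
  have "Ck_on k S (\<lambda>x. frechet_derivative f (at x) v)" for v
    by (rule cong[OF assms(3)[of v]]) (simp add: *)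
  moreover have "f differentiable at x" if "x \<in> S" for x
    using assms(2)[OF that] by (rule differentiableI)
  ultimately show ?thesis by simp
qed

lemma Ck_on_Suc_has_derivative:
  "Ck_on (Suc k) S f \<Longrightarrow> x \<in> S \<Longrightarrow> (f has_derivative frechet_derivative f (at x)) (at x)"
  using frechet_derivative_works by auto

lemma Ck_on_cong:
  assumes "open S" "Ck_on k S f" "\<And>x. x \<in> S \<Longrightarrow> g x = f x"
  shows "Ck_on k S g"
proof (cases k)
  case 0
  then show ?thesis using assms by (metis Ck_on.simps(1) continuous_on_cong)
next
  case (Suc n)
  have "(g has_derivative frechet_derivative f (at x)) (at x)" if x: "x \<in> S" for x
    by (rule has_derivative_transform_within_open[OF Ck_on_Suc_has_derivative assms(1) x])
       (use assms Suc x in auto)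
  then show ?thesis
    using assms unfolding Suc by (intro Ck_on_SucI) auto
qed

lemma Ck_on_Suc_imp: "Ck_on (Suc k) S f \<Longrightarrow> Ck_on k S f"
proof (induction k arbitrary: f)
  case 0
  then show ?case
    by (simp add: differentiable_imp_continuous_on differentiable_at_imp_differentiable_on)
next
  case (Suc k)
  then show ?case by auto
qed

lemma Ck_on_subset: "Ck_on k S f \<Longrightarrow> T \<subseteq> S \<Longrightarrow> Ck_on k T f"
proof (induction k arbitrary: f)
  case 0
  then show ?case by (auto intro: continuous_on_subset)
next
  case (Suc k)
  then show ?case by auto
qed

lemma Ck_on_const: "Ck_on k S (\<lambda>x. c)"
  by (induction k arbitrary: c) auto

lemma Ck_on_bounded_linear:
  assumes "open S" "bounded_linear T" "Ck_on k S f"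
  shows "Ck_on k S (\<lambda>x. T (f x))"
  using assms(3)
proof (induction k arbitrary: f)
  case 0
  then show ?case
    using assms(2) by (simp add: bounded_linear.continuous_on)
next
  case (Suc k)
  show ?case
  proof (rule Ck_on_SucI[OF assms(1)])
    show "((\<lambda>x. T (f x)) has_derivative (\<lambda>v. T (frechet_derivative f (at x) v))) (at x)" if "x \<in> S" for x
      using bounded_linear.has_derivative[OF assms(2) Ck_on_Suc_has_derivative[OF Suc.prems that]] .
  qed (use Suc in auto)
qed

lemma Ck_on_add:
  assumes "open S" "Ck_on k S f" "Ck_on k S g"
  shows "Ck_on k S (\<lambda>x. f x + g x)"
  using assms(2,3)
proof (induction k arbitrary: f g)
  case 0
  then show ?case by (simp add: continuous_on_add)
next
  case (Suc k)
  show ?case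
  proof (rule Ck_on_SucI[OF assms(1)])
    show "((\<lambda>x. f x + g x) has_derivative
      (\<lambda>v. frechet_derivative f (at x) v + frechet_derivative g (at x) v)) (at x)" if "x \<in> S" for x
      by (intro has_derivative_add Ck_on_Suc_has_derivative[OF Suc.prems(1) that]
          Ck_on_Suc_has_derivative[OF Suc.prems(2) that])
  qed (use Suc in auto)
qed

lemma Ck_on_bilinear:
  assumes "open S" "bounded_bilinear pr" "Ck_on k S f" "Ck_on k S g"
  shows "Ck_on k S (\<lambda>x. pr (f x) (g x))"
  using assms(3,4)
proof (induction k arbitrary: f g)
  case 0
  then show ?case by (simp add: bounded_bilinear.continuous_on[OF assms(2)])
next
  case (Suc k)
  show ?case
  proof (rule Ck_on_SucI[OF assms(1)])
    show "((\<lambda>x. pr (f x) (g x)) has_derivative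
      (\<lambda>v. pr (f x) (frechet_derivative g (at x) v) + pr (frechet_derivative f (at x) v) (g x))) (at x)"
      if "x \<in> S" for x
      by (intro bounded_bilinear.FDERIV[OF assms(2)] Ck_on_Suc_has_derivative[OF Suc.prems(1) that]
          Ck_on_Suc_has_derivative[OF Suc.prems(2) that])
  qed (use Suc Ck_on_Suc_imp[OF Suc.prems(1)] Ck_on_Suc_imp[OF Suc.prems(2)] in
      \<open>auto intro!: Ck_on_add[OF assms(1)] Suc.IH\<close>)
qed

text \<open>For an inner map with values in the plane the chain rule expresses the derivative of the
  composition by the two partial derivatives of the outer map, so that the induction needs products
  with real functions only.\<close>

lemma Ck_on_compose:
  fixes h :: "'a::real_normed_vector \<Rightarrow> complex"
  assumes "open S" "h ` S \<subseteq> T" "Ck_on k S h" "Ck_on k T F"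
  shows "Ck_on k S (\<lambda>x. F (h x))"
  using assms(3,4)
proof (induction k arbitrary: F)
  case 0
  then show ?case using assms(2) by (auto intro: continuous_on_compose2)
next
  case (Suc k)
  have lin: "frechet_derivative F (at y) u =
      Re u *\<^sub>R frechet_derivative F (at y) 1 + Im u *\<^sub>R frechet_derivative F (at y) \<i>"
    if "y \<in> T" for y u
  proof -
    have "linear (frechet_derivative F (at y))"
      using Suc.prems(2) that linear_frechet_derivative by auto
    then have "frechet_derivative F (at y) (Re u *\<^sub>R 1 + Im u *\<^sub>R \<i>) =
      Re u *\<^sub>R frechet_derivative F (at y) 1 + Im u *\<^sub>R frechet_derivative F (at y) \<i>"
      by (simp only: linear_add linear_scale)
    moreover have "Re u *\<^sub>R 1 + Im u *\<^sub>R \<i> = u"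
      by (simp add: complex_eq_iff)
    ultimately show ?thesis
      by simp
  qed
  show ?case
  proof (rule Ck_on_SucI[OF assms(1)])
    fix x assume x: "x \<in> S"
    have "((\<lambda>x. F (h x)) has_derivative
      (\<lambda>v. frechet_derivative F (at (h x)) (frechet_derivative h (at x) v))) (at x)"
      using diff_chain_at[OF Ck_on_Suc_has_derivative[OF Suc.prems(1) x]
          Ck_on_Suc_has_derivative[OF Suc.prems(2)]] assms(2) x by (auto simp: o_def)
    also have "(\<lambda>v. frechet_derivative F (at (h x)) (frechet_derivative h (at x) v)) =
      (\<lambda>v. Re (frechet_derivative h (at x) v) *\<^sub>R frechet_derivative F (at (h x)) 1 +
           Im (frechet_derivative h (at x) v) *\<^sub>R frechet_derivative F (at (h x)) \<i>)"
      using lin assms(2) x by blast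
    finally show "((\<lambda>x. F (h x)) has_derivative
      (\<lambda>v. Re (frechet_derivative h (at x) v) *\<^sub>R frechet_derivative F (at (h x)) 1 +
           Im (frechet_derivative h (at x) v) *\<^sub>R frechet_derivative F (at (h x)) \<i>)) (at x)" .
  next
    fix v
    have h: "Ck_on k S h" "Ck_on k S (\<lambda>x. frechet_derivative h (at x) v)"
      using Ck_on_Suc_imp[OF Suc.prems(1)] Suc.prems(1) by auto
    have F: "Ck_on k S (\<lambda>x. frechet_derivative F (at (h x)) e)" for e
      using Suc.IH[OF h(1), of "\<lambda>y. frechet_derivative F (at y) e"] Suc.prems(2) by auto
    show "Ck_on k S (\<lambda>x. Re (frechet_derivative h (at x) v) *\<^sub>R frechet_derivative F (at (h x)) 1 +
           Im (frechet_derivative h (at x) v) *\<^sub>R frechet_derivative F (at (h x)) \<i>)"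
      by (intro Ck_on_add Ck_on_bilinear[OF _ bounded_bilinear_scaleR] F assms(1)
          Ck_on_bounded_linear[OF _ bounded_linear_Re h(2)]
          Ck_on_bounded_linear[OF _ bounded_linear_Im h(2)])
  qed
qed

text \<open>The exponent is arbitrary because differentiation changes it; the cases -1/2 normalize the
  lift and the unit normal.\<close>

lemma Ck_on_powr:
  fixes u :: "'a::real_normed_vector \<Rightarrow> real"
  assumes "open S" "\<And>x. x \<in> S \<Longrightarrow> u x > 0" "Ck_on k S u"
  shows "Ck_on k S (\<lambda>x. u x powr a)"
  using assms(3)
proof (induction k arbitrary: a)
  case 0
  then show ?case using assms(2) by (auto intro!: continuous_on_powr) (metis less_irrefl)
next
  case (Suc k)
  show ?case
  proof (rule Ck_on_SucI[OF assms(1)])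
    fix x assume x: "x \<in> S"
    have "((\<lambda>y. y powr a) has_derivative (*) (a * u x powr (a - 1))) (at (u x))"
      using has_real_derivative_powr[OF assms(2)[OF x], of a]
      by (simp add: has_field_derivative_def)
    from diff_chain_at[OF Ck_on_Suc_has_derivative[OF Suc.prems x] this]
    show "((\<lambda>x. u x powr a) has_derivative
       (\<lambda>v. (a * u x powr (a - 1)) * frechet_derivative u (at x) v)) (at x)"
      by (simp add: o_def)
  next
    fix v
    have "Ck_on k S (\<lambda>x. u x powr (a - 1))"
      by (rule Suc.IH[OF Ck_on_Suc_imp[OF Suc.prems]])
    moreover have "Ck_on k S (\<lambda>x. frechet_derivative u (at x) v)"
      using Suc.prems by simp
    ultimately show "Ck_on k S (\<lambda>x. (a * u x powr (a - 1)) * frechet_derivative u (at x) v)"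
      by (intro Ck_on_bilinear[OF assms(1) bounded_bilinear_mult]
            Ck_on_bounded_linear[OF assms(1) bounded_linear_mult_right])
  qed
qed

lemma Ck_on_holomorphic:
  assumes "open S" "h holomorphic_on S"
  shows "Ck_on k S h"
  using assms(2)
proof (induction k arbitrary: h)
  case 0
  then show ?case by (simp add: holomorphic_on_imp_continuous_on)
next
  case (Suc k)
  show ?case
  proof (rule Ck_on_SucI[OF assms(1)])
    show "(h has_derivative (\<lambda>v. deriv h x * v)) (at x)" if "x \<in> S" for x
      using holomorphic_derivI[OF Suc.prems assms(1) that, of UNIV]
      by (simp add: has_field_derivative_def)
    show "Ck_on k S (\<lambda>x. deriv h x * v)" for v
      by (intro Ck_on_bounded_linear[OF _ bounded_linear_mult_left] Suc.IH
          holomorphic_deriv Suc.prems assms(1))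
  qed
qed

lemma smooth_on_cong:
  "open S \<Longrightarrow> smooth_on S f \<Longrightarrow> (\<And>x. x \<in> S \<Longrightarrow> g x = f x) \<Longrightarrow> smooth_on S g"
  unfolding smooth_on_def using Ck_on_cong by blast

lemma smooth_on_has_derivative:
  "smooth_on S f \<Longrightarrow> x \<in> S \<Longrightarrow> (f has_derivative frechet_derivative f (at x)) (at x)"
  unfolding smooth_on_def using Ck_on_Suc_has_derivative by blast

lemma smooth_on_differentiable: "smooth_on S f \<Longrightarrow> x \<in> S \<Longrightarrow> f differentiable (at x)"
  using smooth_on_has_derivative differentiableI by blast

lemma smooth_on_continuous: "smooth_on S f \<Longrightarrow> continuous_on S f"
  unfolding smooth_on_def using Ck_on.simps(1) by blast

lemma smooth_on_frechet_derivative: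
  "smooth_on S f \<Longrightarrow> smooth_on S (\<lambda>x. frechet_derivative f (at x) v)"
  unfolding smooth_on_def using Ck_on.simps(2) by blast

lemma smooth_on_subset: "smooth_on S f \<Longrightarrow> T \<subseteq> S \<Longrightarrow> smooth_on T f"
  unfolding smooth_on_def using Ck_on_subset by blast

lemma smooth_on_const: "smooth_on S (\<lambda>x. c)"
  by (simp add: smooth_on_def Ck_on_const)

lemma smooth_on_bounded_linear:
  "open S \<Longrightarrow> bounded_linear T \<Longrightarrow> smooth_on S f \<Longrightarrow> smooth_on S (\<lambda>x. T (f x))"
  by (simp add: smooth_on_def Ck_on_bounded_linear)

lemma smooth_on_add:
  "open S \<Longrightarrow> smooth_on S f \<Longrightarrow> smooth_on S g \<Longrightarrow> smooth_on S (\<lambda>x. f x + g x)"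
  by (simp add: smooth_on_def Ck_on_add)

lemma smooth_on_bilinear:
  "open S \<Longrightarrow> bounded_bilinear pr \<Longrightarrow> smooth_on S f \<Longrightarrow> smooth_on S g \<Longrightarrow>
    smooth_on S (\<lambda>x. pr (f x) (g x))"
  by (simp add: smooth_on_def Ck_on_bilinear)

lemma smooth_on_compose:
  fixes h :: "'a::real_normed_vector \<Rightarrow> complex"
  shows "open S \<Longrightarrow> h ` S \<subseteq> T \<Longrightarrow> smooth_on S h \<Longrightarrow> smooth_on T F \<Longrightarrow> smooth_on S (\<lambda>x. F (h x))"
  unfolding smooth_on_def using Ck_on_compose by blast

lemma smooth_on_powr:
  fixes u :: "'a::real_normed_vector \<Rightarrow> real"
  shows "open S \<Longrightarrow> (\<And>x. x \<in> S \<Longrightarrow> u x > 0) \<Longrightarrow> smooth_on S u \<Longrightarrow> smooth_on S (\<lambda>x. u x powr a)"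
  by (simp add: smooth_on_def Ck_on_powr)

lemma smooth_on_holomorphic: "open S \<Longrightarrow> h holomorphic_on S \<Longrightarrow> smooth_on S h"
  by (simp add: smooth_on_def Ck_on_holomorphic)

lemma smooth_on_sum:
  assumes "open S" "\<And>i. i \<in> I \<Longrightarrow> smooth_on S (f i)"
  shows "smooth_on S (\<lambda>x. \<Sum>i\<in>I. f i x)"
  using assms(2)
  by (induction I rule: infinite_finite_induct) (auto intro!: smooth_on_const smooth_on_add assms(1))

lemma smooth_on_prod:
  fixes f :: "'i \<Rightarrow> 'a::real_normed_vector \<Rightarrow> real"
  assumes "open S" "\<And>i. i \<in> I \<Longrightarrow> smooth_on S (f i)"
  shows "smooth_on S (\<lambda>x. \<Prod>i\<in>I. f i x)"
  using assms(2)
  by (induction I rule: infinite_finite_induct)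
     (auto intro!: smooth_on_const smooth_on_bilinear[OF _ bounded_bilinear_mult] assms(1))

lemma smooth_on_vec_nth:
  "open S \<Longrightarrow> smooth_on S f \<Longrightarrow> smooth_on S (\<lambda>x. f x $ i)"
  by (rule smooth_on_bounded_linear[OF _ bounded_linear_vec_nth])

lemma smooth_on_vec_lambda:
  fixes f :: "'i::finite \<Rightarrow> 'a::real_normed_vector \<Rightarrow> real"
  assumes "open S" "\<And>i. smooth_on S (f i)"
  shows "smooth_on S (\<lambda>x. \<chi> i. f i x)"
proof -
  have "smooth_on S (\<lambda>x. \<Sum>i\<in>UNIV. f i x *\<^sub>R axis i (1::real))"
    by (intro smooth_on_sum assms smooth_on_bilinear[OF _ bounded_bilinear_scaleR] smooth_on_const)
  moreover have "(\<Sum>i\<in>UNIV. f i x *\<^sub>R axis i (1::real)) = (\<chi> i. f i x)" for x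
    by (simp add: vec_eq_iff axis_def if_distrib cong: if_cong)
  ultimately show ?thesis by simp
qed

section \<open>Symmetry of second derivatives\<close>

text \<open>The second difference on the left is symmetric in the two directions, whereas the mean value
  theorem, applied once in each direction, produces a mixed second derivative in a definite order.\<close>

lemma second_difference_mean_value:
  fixes F :: "'a::real_normed_vector \<Rightarrow> real"
  assumes S: "smooth_on S F" "t > 0"
    and sub: "\<And>a b. 0 \<le> a \<Longrightarrow> a \<le> t \<Longrightarrow> 0 \<le> b \<Longrightarrow> b \<le> t \<Longrightarrow> w + a *\<^sub>R u + b *\<^sub>R v \<in> S"
  shows "\<exists>a b. 0 < a \<and> a < t \<and> 0 < b \<and> b < t \<and>
    F (w + t *\<^sub>R u + t *\<^sub>R v) - F (w + t *\<^sub>R u) - F (w + t *\<^sub>R v) + F w =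
    t\<^sup>2 * frechet_derivative (\<lambda>x. frechet_derivative F (at x) u) (at (w + a *\<^sub>R u + b *\<^sub>R v)) v"
proof -
  have dF: "((\<lambda>s. G (p + s *\<^sub>R e)) has_real_derivative frechet_derivative G (at (p + s *\<^sub>R e)) e) (at s)"
    if "smooth_on S G" "p + s *\<^sub>R e \<in> S" for G :: "'a \<Rightarrow> real" and p e s
  proof -
    have lin: "linear (frechet_derivative G (at (p + s *\<^sub>R e)))"
      using that smooth_on_differentiable linear_frechet_derivative by blast
    have "((\<lambda>s. p + s *\<^sub>R e) has_derivative (\<lambda>r. r *\<^sub>R e)) (at s)"
      by (auto intro!: derivative_eq_intros)
    from diff_chain_at[OF this smooth_on_has_derivative[OF that]]
    show ?thesis
      by (simp add: o_def has_field_derivative_def linear_scale[OF lin] mult.commute[of _ "frechet_derivative _ _ _"])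
  qed
  define \<phi> where "\<phi> s = F ((w + t *\<^sub>R v) + s *\<^sub>R u) - F (w + s *\<^sub>R u)" for s
  have "\<exists>a. 0 < a \<and> a < t \<and> \<phi> t - \<phi> 0 = (t - 0) *
     (frechet_derivative F (at ((w + t *\<^sub>R v) + a *\<^sub>R u)) u - frechet_derivative F (at (w + a *\<^sub>R u)) u)"
  proof (rule MVT2[OF \<open>t > 0\<close>])
    fix s assume s: "0 \<le> s" "s \<le> t"
    have 1: "w + t *\<^sub>R v + s *\<^sub>R u \<in> S"
      using sub[of s t] s by (simp add: algebra_simps)
    have 2: "w + s *\<^sub>R u \<in> S" using sub[of s 0] s assms(2) by simp
    show "(\<phi> has_real_derivative frechet_derivative F (at ((w + t *\<^sub>R v) + s *\<^sub>R u)) u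
       - frechet_derivative F (at (w + s *\<^sub>R u)) u) (at s)"
      unfolding \<phi>_def by (intro DERIV_diff dF[OF S(1)] 1 2)
  qed
  then obtain a where a: "0 < a" "a < t" and 1: "\<phi> t - \<phi> 0 = t *
     (frechet_derivative F (at ((w + t *\<^sub>R v) + a *\<^sub>R u)) u - frechet_derivative F (at (w + a *\<^sub>R u)) u)"
    by auto
  define \<theta> where "\<theta> s = frechet_derivative F (at ((w + a *\<^sub>R u) + s *\<^sub>R v)) u" for s
  have "\<exists>b. 0 < b \<and> b < t \<and> \<theta> t - \<theta> 0 = (t - 0) *
     frechet_derivative (\<lambda>x. frechet_derivative F (at x) u) (at ((w + a *\<^sub>R u) + b *\<^sub>R v)) v"
    unfolding \<theta>_def
    by (rule MVT2[OF \<open>t > 0\<close>], rule dF[OF smooth_on_frechet_derivative[OF S(1)]])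
       (use a sub in auto)
  then obtain b where b: "0 < b" "b < t" "\<theta> t - \<theta> 0 = t *
     frechet_derivative (\<lambda>x. frechet_derivative F (at x) u) (at ((w + a *\<^sub>R u) + b *\<^sub>R v)) v"
    by auto
  have "F (w + t *\<^sub>R u + t *\<^sub>R v) - F (w + t *\<^sub>R u) - F (w + t *\<^sub>R v) + F w = \<phi> t - \<phi> 0"
    by (simp add: \<phi>_def algebra_simps)
  also have "\<dots> = t * (\<theta> t - \<theta> 0)"
    unfolding 1 \<theta>_def by (simp add: algebra_simps)
  also have "\<dots> = t\<^sup>2 * frechet_derivative (\<lambda>x. frechet_derivative F (at x) u) (at (w + a *\<^sub>R u + b *\<^sub>R v)) v"
    unfolding b by (simp add: power2_eq_square)
  finally show ?thesis using a b by blast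
qed

lemma second_difference_quotient_tendsto:
  fixes F :: "'a::real_normed_vector \<Rightarrow> real"
  assumes "open S" "smooth_on S F" "w \<in> S"
  shows "((\<lambda>t. (F (w + t *\<^sub>R u + t *\<^sub>R v) - F (w + t *\<^sub>R u) - F (w + t *\<^sub>R v) + F w) / t\<^sup>2) \<longlongrightarrow>
    frechet_derivative (\<lambda>x. frechet_derivative F (at x) u) (at w) v) (at_right 0)"
proof (rule tendstoI)
  define G where "G x = frechet_derivative (\<lambda>x. frechet_derivative F (at x) u) (at x) v" for x
  fix e :: real assume "e > 0"
  have "continuous_on S G"
    unfolding G_def
    by (intro smooth_on_continuous smooth_on_frechet_derivative assms)
  then have "isCont G w"
    using assms continuous_on_eq_continuous_at by blast
  then obtain d1 where d1: "d1 > 0" "\<And>x. dist x w < d1 \<Longrightarrow> dist (G x) (G w) < e"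
    using \<open>e > 0\<close> unfolding continuous_at_eps_delta by blast
  obtain d2 where d2: "d2 > 0" "ball w d2 \<subseteq> S"
    using assms open_contains_ball by blast
  define d where "d = min d1 d2"
  have d: "d > 0" using d1 d2 by (simp add: d_def)
  define \<delta> where "\<delta> = d / (norm u + norm v + 1)"
  have np: "norm u + norm v + 1 > 0"
    by (metis add_nonneg_nonneg add_pos_nonneg add.commute norm_ge_zero zero_less_one)
  have \<delta>: "\<delta> > 0" using d np by (simp add: \<delta>_def)
  have near: "dist (w + a *\<^sub>R u + b *\<^sub>R v) w < d" if "0 \<le> a" "a \<le> t" "0 \<le> b" "b \<le> t" "t < \<delta>" for a b t
  proof -
    have "dist (w + a *\<^sub>R u + b *\<^sub>R v) w = norm (a *\<^sub>R u + b *\<^sub>R v)"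
      by (simp add: dist_norm)
    also have "\<dots> \<le> a * norm u + b * norm v"
      using norm_triangle_ineq[of "a *\<^sub>R u" "b *\<^sub>R v"] that by simp
    also have "\<dots> \<le> t * norm u + t * norm v"
      using that by (intro add_mono mult_right_mono) auto
    also have "\<dots> \<le> t * (norm u + norm v + 1)"
      using that by (simp add: algebra_simps)
    also have "\<dots> < \<delta> * (norm u + norm v + 1)"
      using that np by (intro mult_strict_right_mono) auto
    also have "\<dots> = d" using np by (simp add: \<delta>_def)
    finally show ?thesis .
  qed
  have "dist ((F (w + t *\<^sub>R u + t *\<^sub>R v) - F (w + t *\<^sub>R u) - F (w + t *\<^sub>R v) + F w) / t\<^sup>2) (G w) < e"
    if t: "0 < t" "t < \<delta>" for t
  proof -
    have "w + a *\<^sub>R u + b *\<^sub>R v \<in> S" if "0 \<le> a" "a \<le> t" "0 \<le> b" "b \<le> t" for a b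
      using near[OF that t(2)] d2 by (auto simp: d_def dist_commute)
    from second_difference_mean_value[OF assms(2) t(1) this]
    obtain a b where ab: "0 < a" "a < t" "0 < b" "b < t"
      and eq: "F (w + t *\<^sub>R u + t *\<^sub>R v) - F (w + t *\<^sub>R u) - F (w + t *\<^sub>R v) + F w =
        t\<^sup>2 * G (w + a *\<^sub>R u + b *\<^sub>R v)"
      unfolding G_def by blast
    have "dist (w + a *\<^sub>R u + b *\<^sub>R v) w < d1"
      using near[of a t b] ab t by (simp add: d_def)
    then show ?thesis
      using d1(2) t unfolding eq by simp
  qed
  then show "\<forall>\<^sub>F t in at_right 0. dist ((F (w + t *\<^sub>R u + t *\<^sub>R v) - F (w + t *\<^sub>R u) - F (w + t *\<^sub>R v) + F w) / t\<^sup>2)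
      (frechet_derivative (\<lambda>x. frechet_derivative F (at x) u) (at w) v) < e"
    using \<delta> unfolding G_def[symmetric] by (auto simp: eventually_at_right)
qed

lemma frechet_derivative_bounded_linear:
  assumes "f differentiable (at x)" "bounded_linear T"
  shows "frechet_derivative (\<lambda>x. T (f x)) (at x) v = T (frechet_derivative f (at x) v)"
proof -
  have "((\<lambda>x. T (f x)) has_derivative (\<lambda>v. T (frechet_derivative f (at x) v))) (at x)"
    using bounded_linear.has_derivative[OF assms(2)] assms(1) frechet_derivative_works by blast
  from frechet_derivative_at[OF this] show ?thesis by metis
qed

text \<open>Both orders of differentiation are limits of the same second difference quotient.\<close>

lemma frechet_derivative_commute:
  fixes F :: "'a::real_normed_vector \<Rightarrow> 'b::euclidean_space"
  assumes "open S" "smooth_on S F" "w \<in> S"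
  shows "frechet_derivative (\<lambda>x. frechet_derivative F (at x) u) (at w) v =
    frechet_derivative (\<lambda>x. frechet_derivative F (at x) v) (at w) u"
proof (rule euclidean_eqI)
  fix b :: 'b assume "b \<in> Basis"
  define f where "f x = F x \<bullet> b" for x
  have sf: "smooth_on S f"
    unfolding f_def by (rule smooth_on_bounded_linear[OF assms(1) bounded_linear_inner_left assms(2)])
  have df: "frechet_derivative f (at x) e = frechet_derivative F (at x) e \<bullet> b" if "x \<in> S" for x e
    unfolding f_def
    by (rule frechet_derivative_bounded_linear[OF smooth_on_differentiable[OF assms(2) that] bounded_linear_inner_left])
  have ddf: "frechet_derivative (\<lambda>x. frechet_derivative F (at x) e) (at w) e' \<bullet> b =
     frechet_derivative (\<lambda>x. frechet_derivative f (at x) e) (at w) e'" for e e'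
  proof -
    have sd: "(\<lambda>x. frechet_derivative F (at x) e) differentiable (at w)"
      using assms smooth_on_differentiable smooth_on_frechet_derivative by blast
    have "frechet_derivative (\<lambda>x. frechet_derivative F (at x) e) (at w) e' \<bullet> b =
      frechet_derivative (\<lambda>x. frechet_derivative F (at x) e \<bullet> b) (at w) e'"
      by (rule frechet_derivative_bounded_linear[OF sd bounded_linear_inner_left, symmetric])
    also have "frechet_derivative (\<lambda>x. frechet_derivative F (at x) e \<bullet> b) (at w) =
        frechet_derivative (\<lambda>x. frechet_derivative f (at x) e) (at w)"
      by (rule frechet_derivative_transform_within_open[OF _ assms(1,3)])
         (use df sd in auto)
    finally show ?thesis .
  qed
  have "((\<lambda>t. (f (w + t *\<^sub>R u + t *\<^sub>R v) - f (w + t *\<^sub>R u) - f (w + t *\<^sub>R v) + f w) / t\<^sup>2) \<longlongrightarrow>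
    frechet_derivative (\<lambda>x. frechet_derivative f (at x) v) (at w) u) (at_right 0)"
    using second_difference_quotient_tendsto[OF assms(1) sf assms(3), of v u]
    by (simp add: algebra_simps)
  with second_difference_quotient_tendsto[OF assms(1) sf assms(3), of u v]
  have "frechet_derivative (\<lambda>x. frechet_derivative f (at x) u) (at w) v =
        frechet_derivative (\<lambda>x. frechet_derivative f (at x) v) (at w) u"
    by (intro tendsto_unique) auto
  then show "frechet_derivative (\<lambda>x. frechet_derivative F (at x) u) (at w) v \<bullet> b =
    frechet_derivative (\<lambda>x. frechet_derivative F (at x) v) (at w) u \<bullet> b"
    by (simp add: ddf)
qed

section \<open>The Lorentzian form\<close>

lemma lorentz_commute: "lorentz v w = lorentz w v"
  by (simp add: lorentz_def mult.commute)

lemma lorentz_add_left: "lorentz (u + v) w = lorentz u w + lorentz v w"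
  by (simp add: lorentz_def algebra_simps sum.distrib)

lemma lorentz_add_right: "lorentz w (u + v) = lorentz w u + lorentz w v"
  by (simp add: lorentz_def algebra_simps sum.distrib)

lemma lorentz_diff_left: "lorentz (u - v) w = lorentz u w - lorentz v w"
  by (simp add: lorentz_def algebra_simps sum_subtractf)

lemma lorentz_diff_right: "lorentz w (u - v) = lorentz w u - lorentz w v"
  by (simp add: lorentz_def algebra_simps sum_subtractf)

lemma lorentz_minus_left: "lorentz (- v) w = - lorentz v w"
  by (simp add: lorentz_def sum_negf)

lemma lorentz_minus_right: "lorentz w (- v) = - lorentz w v"
  by (simp add: lorentz_def sum_negf)

lemma lorentz_scale_left: "lorentz (a *s v) w = a * lorentz v w"
  by (simp add: lorentz_def algebra_simps sum_distrib_left)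

lemma lorentz_scale_right: "lorentz w (a *s v) = a * lorentz w v"
  by (simp add: lorentz_def algebra_simps sum_distrib_left)

lemma lorentz_zero: "lorentz 0 w = 0" "lorentz w 0 = 0"
  by (simp_all add: lorentz_def)

lemma lorentz_scaleR_left: "lorentz (a *\<^sub>R v) w = a *\<^sub>R lorentz v w"
  for v w :: "'a::{real_algebra_1,comm_ring_1} ^ 4 option"
  by (simp add: lorentz_def algebra_simps scaleR_sum_right)

lemma lorentz_scaleR_right: "lorentz w (a *\<^sub>R v) = a *\<^sub>R lorentz w v"
  for v w :: "'a::{real_algebra_1,comm_ring_1} ^ 4 option"
  by (simp add: lorentz_def algebra_simps scaleR_sum_right)

lemmas lorentz_linear = lorentz_add_left lorentz_add_right lorentz_diff_left lorentz_diff_right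
  lorentz_minus_left lorentz_minus_right lorentz_scale_left lorentz_scale_right lorentz_zero
  lorentz_scaleR_left lorentz_scaleR_right

lemma bounded_bilinear_lorentz:
  "bounded_bilinear (lorentz :: 'a::{real_algebra_1,comm_ring_1,euclidean_space} ^ 4 option \<Rightarrow> _)"
  unfolding bilinear_conv_bounded_bilinear[symmetric] bilinear_def
  by (auto intro!: linearI simp: lorentz_linear)

lemma bounded_bilinear_vector_scalar_mult:
  "bounded_bilinear ((*s) :: complex \<Rightarrow> complex ^ 'n \<Rightarrow> _)"
  unfolding bilinear_conv_bounded_bilinear[symmetric] bilinear_def
  by (auto intro!: linearI simp: vec_eq_iff algebra_simps)

definition vcnj :: "complex ^ 'n \<Rightarrow> complex ^ 'n" where
  "vcnj v = (\<chi> i. cnj (v $ i))"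

lemma bounded_linear_complexify: "bounded_linear (complexify :: real ^ 'n \<Rightarrow> _)"
  unfolding linear_conv_bounded_linear[symmetric]
  by (auto intro!: linearI simp: complexify_def vec_eq_iff scaleR_conv_of_real[where 'a = complex])

lemma bounded_linear_vcnj: "bounded_linear (vcnj :: complex ^ 'n \<Rightarrow> _)"
  unfolding linear_conv_bounded_linear[symmetric]
  by (auto intro!: linearI simp: vcnj_def vec_eq_iff)

lemma lorentz_complexify: "lorentz (complexify u) (complexify v) = complex_of_real (lorentz u v)"
  by (simp add: lorentz_def complexify_def)

lemma lorentz_vcnj: "lorentz (vcnj u) (vcnj v) = cnj (lorentz u v)"
  by (simp add: lorentz_def vcnj_def)

lemma vcnj_simps:
  "vcnj (u + v) = vcnj u + vcnj v" "vcnj (u - v) = vcnj u - vcnj v" "vcnj (- u) = - vcnj u"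
  "vcnj (a *s u) = cnj a *s vcnj u" "vcnj (complexify x) = complexify x" "vcnj (vcnj u) = u"
  by (simp_all add: vcnj_def complexify_def vec_eq_iff)

lemma complexify_linear:
  "complexify (u + v) = complexify u + complexify v"
  "complexify (r *\<^sub>R v) = complex_of_real r *s complexify v"
  by (simp_all add: complexify_def vec_eq_iff)

section \<open>Wirtinger derivatives\<close>

text \<open>The Wirtinger derivatives of scalar functions, and the conjugate of \<^const>\<open>d_z\<close> for
  vector valued functions.\<close>

definition dz :: "(complex \<Rightarrow> complex) \<Rightarrow> complex \<Rightarrow> complex" where
  "dz f w = (d_x f w - \<i> * d_y f w) / 2"

definition dzb :: "(complex \<Rightarrow> complex) \<Rightarrow> complex \<Rightarrow> complex" where
  "dzb f w = (d_x f w + \<i> * d_y f w) / 2"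

definition d_zb :: "(complex \<Rightarrow> complex ^ 'n) \<Rightarrow> complex \<Rightarrow> complex ^ 'n" where
  "d_zb F w = (1/2) *s (d_x F w + \<i> *s d_y F w)"

lemma smooth_on_d_x: "smooth_on S F \<Longrightarrow> smooth_on S (d_x F)"
  unfolding d_x_def[abs_def] by (rule smooth_on_frechet_derivative)

lemma smooth_on_d_y: "smooth_on S F \<Longrightarrow> smooth_on S (d_y F)"
  unfolding d_y_def[abs_def] by (rule smooth_on_frechet_derivative)

lemma bounded_linear_vector_scalar_mult_right: "bounded_linear (\<lambda>v. a *s (v :: complex ^ 'n))"
  by (rule bounded_bilinear.bounded_linear_right[OF bounded_bilinear_vector_scalar_mult])

lemma smooth_on_wirtinger:
  assumes "open S"
  shows "smooth_on S F \<Longrightarrow> smooth_on S (d_z F)" "smooth_on S F \<Longrightarrow> smooth_on S (d_zb F)"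
    "smooth_on S f \<Longrightarrow> smooth_on S (dz f)" "smooth_on S f \<Longrightarrow> smooth_on S (dzb f)"
proof -
  have bl: "bounded_linear (\<lambda>v. (-\<i>) *s (v :: complex ^ 'b))"
    "bounded_linear (\<lambda>v. \<i> *s (v :: complex ^ 'c))" "bounded_linear (\<lambda>v. (1/2) *s (v :: complex ^ 'b))"
    "bounded_linear (\<lambda>v. (1/2) *s (v :: complex ^ 'c))"
    by (rule bounded_linear_vector_scalar_mult_right)+
  have 1: "d_z F = (\<lambda>w. (1/2) *s (d_x F w + (-\<i>) *s d_y F w))" for F :: "complex \<Rightarrow> complex ^ 'b"
    by (auto simp: d_z_def vec_eq_iff)
  show "smooth_on S F \<Longrightarrow> smooth_on S (d_z F)"
    unfolding 1
    by (intro smooth_on_bounded_linear[OF assms bl(3)] smooth_on_bounded_linear[OF assms bl(1)]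
        smooth_on_add[OF assms] smooth_on_d_x smooth_on_d_y)
  show "smooth_on S F \<Longrightarrow> smooth_on S (d_zb F)"
    unfolding d_zb_def[abs_def]
    by (intro smooth_on_bounded_linear[OF assms bl(4)] smooth_on_bounded_linear[OF assms bl(2)]
        smooth_on_add[OF assms] smooth_on_d_x smooth_on_d_y)
  have 2: "dz f = (\<lambda>w. (1/2) * (d_x f w + (-\<i>) * d_y f w))" for f
    by (auto simp: dz_def)
  show "smooth_on S f \<Longrightarrow> smooth_on S (dz f)"
    unfolding 2
    by (intro smooth_on_bounded_linear[OF assms bounded_linear_mult_right]
        smooth_on_add[OF assms] smooth_on_d_x smooth_on_d_y)
  have 3: "dzb f = (\<lambda>w. (1/2) * (d_x f w + \<i> * d_y f w))" for f
    by (auto simp: dzb_def)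
  show "smooth_on S f \<Longrightarrow> smooth_on S (dzb f)"
    unfolding 3
    by (intro smooth_on_bounded_linear[OF assms bounded_linear_mult_right]
        smooth_on_add[OF assms] smooth_on_d_x smooth_on_d_y)
qed

lemma d_xy_bilinear:
  assumes "bounded_bilinear pr" "f differentiable (at w)" "g differentiable (at w)"
  shows "d_x (\<lambda>w. pr (f w) (g w)) w = pr (d_x f w) (g w) + pr (f w) (d_x g w)"
    and "d_y (\<lambda>w. pr (f w) (g w)) w = pr (d_y f w) (g w) + pr (f w) (d_y g w)"
proof -
  have "((\<lambda>w. pr (f w) (g w)) has_derivative
      (\<lambda>v. pr (f w) (frechet_derivative g (at w) v) + pr (frechet_derivative f (at w) v) (g w))) (at w)"
    by (intro bounded_bilinear.FDERIV[OF assms(1)]) (use assms frechet_derivative_works in auto)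
  from frechet_derivative_at[OF this, symmetric]
  show "d_x (\<lambda>w. pr (f w) (g w)) w = pr (d_x f w) (g w) + pr (f w) (d_x g w)"
    and "d_y (\<lambda>w. pr (f w) (g w)) w = pr (d_y f w) (g w) + pr (f w) (d_y g w)"
    by (simp_all add: d_x_def d_y_def)
qed

lemma d_xy_bounded_linear:
  assumes "bounded_linear T" "f differentiable (at w)"
  shows "d_x (\<lambda>w. T (f w)) w = T (d_x f w)" "d_y (\<lambda>w. T (f w)) w = T (d_y f w)"
  using assms by (simp_all add: d_x_def d_y_def frechet_derivative_bounded_linear)

lemma d_xy_add:
  assumes "f differentiable (at w)" "g differentiable (at w)"
  shows "d_x (\<lambda>w. f w + g w) w = d_x f w + d_x g w" "d_y (\<lambda>w. f w + g w) w = d_y f w + d_y g w"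
proof -
  have "((\<lambda>w. f w + g w) has_derivative
      (\<lambda>v. frechet_derivative f (at w) v + frechet_derivative g (at w) v)) (at w)"
    by (intro has_derivative_add) (use assms frechet_derivative_works in auto)
  from frechet_derivative_at[OF this, symmetric]
  show "d_x (\<lambda>w. f w + g w) w = d_x f w + d_x g w" "d_y (\<lambda>w. f w + g w) w = d_y f w + d_y g w"
    by (simp_all add: d_x_def d_y_def)
qed

lemma d_xy_const: "d_x (\<lambda>w. c) w = 0" "d_y (\<lambda>w. c) w = 0"
  by (simp_all add: d_x_def d_y_def)

lemma d_xy_cong:
  assumes "open S" "w \<in> S" "smooth_on S f" "\<And>x. x \<in> S \<Longrightarrow> g x = f x"
  shows "d_x g w = d_x f w" "d_y g w = d_y f w"
proof -
  have "frechet_derivative f (at w) = frechet_derivative g (at w)"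
    by (rule frechet_derivative_transform_within_open[OF _ assms(1,2)])
       (use assms smooth_on_differentiable in auto)
  then show "d_x g w = d_x f w" "d_y g w = d_y f w"
    by (simp_all add: d_x_def d_y_def)
qed

lemma wirtinger_cong:
  assumes "open S" "w \<in> S"
  shows "smooth_on S f \<Longrightarrow> (\<And>x. x \<in> S \<Longrightarrow> g x = f x) \<Longrightarrow> dz g w = dz f w"
    "smooth_on S f \<Longrightarrow> (\<And>x. x \<in> S \<Longrightarrow> g x = f x) \<Longrightarrow> dzb g w = dzb f w"
    "smooth_on S F \<Longrightarrow> (\<And>x. x \<in> S \<Longrightarrow> G x = F x) \<Longrightarrow> d_z G w = d_z F w"
    "smooth_on S F \<Longrightarrow> (\<And>x. x \<in> S \<Longrightarrow> G x = F x) \<Longrightarrow> d_zb G w = d_zb F w"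
  using d_xy_cong[OF assms, of f g] d_xy_cong[OF assms, of F G]
  by (simp_all add: dz_def dzb_def d_z_def d_zb_def)

lemma wirtinger_const: "dz (\<lambda>w. c) w = 0" "dzb (\<lambda>w. c) w = 0"
  by (simp_all add: dz_def dzb_def d_xy_const)

lemma wirtinger_lorentz:
  assumes "F differentiable (at w)" "G differentiable (at w)"
  shows "dz (\<lambda>w. lorentz (F w) (G w)) w = lorentz (d_z F w) (G w) + lorentz (F w) (d_z G w)"
    "dzb (\<lambda>w. lorentz (F w) (G w)) w = lorentz (d_zb F w) (G w) + lorentz (F w) (d_zb G w)"
  by (simp_all add: dz_def dzb_def d_z_def d_zb_def d_xy_bilinear[OF bounded_bilinear_lorentz assms]
      lorentz_linear field_simps)

lemma wirtinger_scale:
  assumes "f differentiable (at w)" "G differentiable (at w)"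
  shows "d_z (\<lambda>w. f w *s G w) w = dz f w *s G w + f w *s d_z G w"
    "d_zb (\<lambda>w. f w *s G w) w = dzb f w *s G w + f w *s d_zb G w"
  by (simp_all add: dz_def dzb_def d_z_def d_zb_def vec_eq_iff field_simps
      d_xy_bilinear[OF bounded_bilinear_vector_scalar_mult assms])

lemma wirtinger_mult:
  assumes "f differentiable (at w)" "g differentiable (at w)"
  shows "dz (\<lambda>w. f w * g w) w = dz f w * g w + f w * dz g w"
    "dzb (\<lambda>w. f w * g w) w = dzb f w * g w + f w * dzb g w"
  by (simp_all add: dz_def dzb_def field_simps
      d_xy_bilinear[OF bounded_bilinear_mult assms])

lemma wirtinger_add:
  assumes "F differentiable (at w)" "G differentiable (at w)"
  shows "d_z (\<lambda>w. F w + G w) w = d_z F w + d_z G w"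
    "d_zb (\<lambda>w. F w + G w) w = d_zb F w + d_zb G w"
  by (simp_all add: d_z_def d_zb_def d_xy_add[OF assms] vec_eq_iff field_simps)

lemma wirtinger_scalar_add:
  assumes "f differentiable (at w)" "g differentiable (at w)"
  shows "dz (\<lambda>w. f w + g w) w = dz f w + dz g w"
    "dzb (\<lambda>w. f w + g w) w = dzb f w + dzb g w"
  by (simp_all add: dz_def dzb_def d_xy_add[OF assms] field_simps)

lemma wirtinger_cnj:
  assumes "f differentiable (at w)"
  shows "dz (\<lambda>w. cnj (f w)) w = cnj (dzb f w)" "dzb (\<lambda>w. cnj (f w)) w = cnj (dz f w)"
  by (simp_all add: dz_def dzb_def d_xy_bounded_linear[OF bounded_linear_cnj assms])

lemma wirtinger_vcnj:
  assumes "F differentiable (at w)"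
  shows "d_z (\<lambda>w. vcnj (F w)) w = vcnj (d_zb F w)" "d_zb (\<lambda>w. vcnj (F w)) w = vcnj (d_z F w)"
  by (simp_all add: d_z_def d_zb_def d_xy_bounded_linear[OF bounded_linear_vcnj assms] vcnj_simps
     vec_eq_iff)

lemma wirtinger_commute:
  fixes F :: "complex \<Rightarrow> complex ^ 'n"
  assumes "open S" "smooth_on S F" "w \<in> S"
  shows "d_z (d_zb F) w = d_zb (d_z F) w"
    "d_z (d_zb F) w = (1/4) *s (d_x (d_x F) w + d_y (d_y F) w)"
proof -
  note sm = smooth_on_d_x[OF assms(2)] smooth_on_d_y[OF assms(2)]
  note dm = sm[THEN smooth_on_differentiable, OF assms(3)]
  have xy: "d_x (d_y F) w = d_y (d_x F) w"
    using frechet_derivative_commute[OF assms, of \<i> 1]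
    by (simp add: d_x_def[abs_def] d_y_def[abs_def])
  have d: "(\<lambda>v. \<i> *s d_y F v) differentiable (at w)"
    by (rule smooth_on_differentiable[OF smooth_on_bounded_linear[OF assms(1)
       bounded_linear_vector_scalar_mult_right sm(2)] assms(3)])
  have d': "(\<lambda>v. (- \<i>) *s d_y F v) differentiable (at w)"
    by (rule smooth_on_differentiable[OF smooth_on_bounded_linear[OF assms(1)
       bounded_linear_vector_scalar_mult_right sm(2)] assms(3)])
  have e: "(\<lambda>v. d_x F v + \<i> *s d_y F v) differentiable (at w)"
    using dm(1) d by (rule differentiable_add)
  have e': "(\<lambda>v. d_x F v + (-\<i>) *s d_y F v) differentiable (at w)"
    using dm(1) d' by (rule differentiable_add)
  have 1: "d_x (d_zb F) w = (1/2) *s (d_x (d_x F) w + \<i> *s d_x (d_y F) w)"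
     "d_y (d_zb F) w = (1/2) *s (d_y (d_x F) w + \<i> *s d_y (d_y F) w)"
    unfolding d_zb_def[abs_def]
    by (simp_all only: d_xy_bounded_linear[OF bounded_linear_vector_scalar_mult_right e]
       d_xy_add[OF dm(1) d] d_xy_bounded_linear[OF bounded_linear_vector_scalar_mult_right dm(2)])
  have z: "d_z F = (\<lambda>v. (1/2) *s (d_x F v + (-\<i>) *s d_y F v))"
    by (auto simp: d_z_def vec_eq_iff)
  have 2: "d_x (d_z F) w = (1/2) *s (d_x (d_x F) w + (-\<i>) *s d_x (d_y F) w)"
     "d_y (d_z F) w = (1/2) *s (d_y (d_x F) w + (-\<i>) *s d_y (d_y F) w)"
    unfolding z
    by (simp_all only: d_xy_bounded_linear[OF bounded_linear_vector_scalar_mult_right e']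
       d_xy_add[OF dm(1) d'] d_xy_bounded_linear[OF bounded_linear_vector_scalar_mult_right dm(2)])
  show "d_z (d_zb F) w = d_zb (d_z F) w"
    "d_z (d_zb F) w = (1/4) *s (d_x (d_x F) w + d_y (d_y F) w)"
    unfolding d_z_def[of "d_zb F"] d_zb_def[of "d_z F"] 1 2 xy
    by (simp_all add: vec_eq_iff field_simps)
qed

text \<open>The real differential of \<open>h\<close> is multiplication by \<open>h'\<close>, so \<open>\<partial>/\<partial>z\<close> and
  \<open>\<partial>/\<partial>zbar\<close> do not mix.\<close>

lemma wirtinger_holomorphic_compose:
  fixes F :: "complex \<Rightarrow> complex ^ 'n"
  assumes "(h has_field_derivative h') (at w)" "F differentiable (at (h w))"
  shows "d_z (\<lambda>w. F (h w)) w = h' *s d_z F (h w)"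
    "d_zb (\<lambda>w. F (h w)) w = cnj h' *s d_zb F (h w)"
proof -
  let ?F' = "frechet_derivative F (at (h w))"
  have lin: "linear ?F'"
    using assms(2) by (rule linear_frechet_derivative)
  have *: "?F' u = Re u *\<^sub>R d_x F (h w) + Im u *\<^sub>R d_y F (h w)" for u
  proof -
    have "?F' u = ?F' (Re u *\<^sub>R 1 + Im u *\<^sub>R \<i>)"
      by (rule arg_cong[where f = ?F']) (simp add: complex_eq_iff)
    then show ?thesis
      using lin by (simp only: linear_add linear_scale d_x_def d_y_def)
  qed
  have "(F has_derivative ?F') (at (h w))"
    using assms(2) frechet_derivative_works by blast
  from diff_chain_at[OF assms(1)[unfolded has_field_derivative_def] this]
  have "((\<lambda>w. F (h w)) has_derivative (\<lambda>v. ?F' (h' * v))) (at w)"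
    by (simp add: o_def)
  from frechet_derivative_at[OF this, symmetric]
  have "d_x (\<lambda>w. F (h w)) w = ?F' h'" "d_y (\<lambda>w. F (h w)) w = ?F' (h' * \<i>)"
    by (simp_all add: d_x_def d_y_def)
  then have dx: "d_x (\<lambda>w. F (h w)) w = Re h' *\<^sub>R d_x F (h w) + Im h' *\<^sub>R d_y F (h w)"
    and dy: "d_y (\<lambda>w. F (h w)) w = (- Im h') *\<^sub>R d_x F (h w) + Re h' *\<^sub>R d_y F (h w)"
    by (simp_all add: *)
  show "d_z (\<lambda>w. F (h w)) w = h' *s d_z F (h w)"
    "d_zb (\<lambda>w. F (h w)) w = cnj h' *s d_zb F (h w)"
    unfolding d_z_def d_zb_def dx dy
    by (simp_all add: vec_eq_iff complex_eq_iff field_simps)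
qed

lemma wirtinger_complexify:
  assumes "f differentiable (at w)"
  shows "d_z (\<lambda>w. complexify (f w)) w = (1/2) *s (complexify (d_x f w) - \<i> *s complexify (d_y f w))"
    "d_zb (\<lambda>w. complexify (f w)) w = (1/2) *s (complexify (d_x f w) + \<i> *s complexify (d_y f w))"
  by (simp_all add: d_z_def d_zb_def d_xy_bounded_linear[OF bounded_linear_complexify assms])

text \<open>The Laplacian of a real map is real; this identifies the mixed derivative of the complexified
  lift with the real vector that enters the definition of the bundle \<open>V\<close>.\<close>

lemma wirtinger_complexify_twice:
  fixes f :: "complex \<Rightarrow> real ^ 'n"
  assumes "open S" "smooth_on S f" "w \<in> S"
  shows "d_z (d_zb (\<lambda>w. complexify (f w))) w = complexify (d_zzbar f w)"
proof -
  have sc: "smooth_on S (\<lambda>w. complexify (f w))"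
    by (rule smooth_on_bounded_linear[OF assms(1) bounded_linear_complexify assms(2)])
  note sm = smooth_on_d_x[OF assms(2)] smooth_on_d_y[OF assms(2)]
  note smc = smooth_on_bounded_linear[OF assms(1) bounded_linear_complexify sm(1)]
    smooth_on_bounded_linear[OF assms(1) bounded_linear_complexify sm(2)]
  note d1 = d_xy_bounded_linear[OF bounded_linear_complexify smooth_on_differentiable[OF assms(2)]]
  have "d_x (d_x (\<lambda>w. complexify (f w))) w = complexify (d_x (d_x f) w)"
    using d_xy_cong(1)[OF assms(1,3) smc(1), of "d_x (\<lambda>w. complexify (f w))"] d1
      d_xy_bounded_linear(1)[OF bounded_linear_complexify smooth_on_differentiable[OF sm(1) assms(3)]]
    by simp
  moreover have "d_y (d_y (\<lambda>w. complexify (f w))) w = complexify (d_y (d_y f) w)"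
    using d_xy_cong(2)[OF assms(1,3) smc(2), of "d_y (\<lambda>w. complexify (f w))"] d1
      d_xy_bounded_linear(2)[OF bounded_linear_complexify smooth_on_differentiable[OF sm(2) assms(3)]]
    by simp
  ultimately show ?thesis
    unfolding wirtinger_commute(2)[OF assms(1) sc assms(3)] d_zzbar_def
    by (simp add: complexify_linear)
qed

lemma dzb_zero_imp_holomorphic:
  assumes "open S" "smooth_on S f" "\<And>w. w \<in> S \<Longrightarrow> dzb f w = 0"
  shows "f holomorphic_on S"
proof -
  have "(f has_field_derivative d_x f w) (at w)" if "w \<in> S" for w
  proof -
    let ?f' = "frechet_derivative f (at w)"
    have "linear ?f'"
      using assms(2) that smooth_on_differentiable linear_frechet_derivative by blast
    then have 1: "?f' (Re u *\<^sub>R 1 + Im u *\<^sub>R \<i>) = Re u *\<^sub>R d_x f w + Im u *\<^sub>R d_y f w" for u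
      by (simp only: linear_add linear_scale d_x_def d_y_def)
    have "d_x f w + \<i> * d_y f w = 0"
      using assms(3)[OF that] by (simp add: dzb_def)
    then have "\<i> * (d_x f w + \<i> * d_y f w) = 0" by simp
    then have 2: "d_y f w = \<i> * d_x f w" by (simp add: algebra_simps)
    have "?f' u = d_x f w * u" for u
    proof -
      have u: "Re u *\<^sub>R 1 + Im u *\<^sub>R \<i> = u" by (simp add: complex_eq_iff)
      have "?f' u = Re u *\<^sub>R d_x f w + Im u *\<^sub>R d_y f w"
        using 1[of u] unfolding u .
      also have "\<dots> = d_x f w * (Re u *\<^sub>R 1 + Im u *\<^sub>R \<i>)"
        unfolding 2 by (simp add: scaleR_conv_of_real algebra_simps)
      finally show ?thesis unfolding u .
    qed
    then have "?f' = (*) (d_x f w)" by auto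
    then show ?thesis
      using smooth_on_has_derivative[OF assms(2) that] by (simp add: has_field_derivative_def)
  qed
  then show ?thesis
    using assms(1) holomorphic_on_open by blast
qed

section \<open>Adapted frames in Lorentz space\<close>

text \<open>The order of the rows is that of the orientation condition on the unit normal.\<close>

definition frame_matrix ::
  "real ^ 4 option \<Rightarrow> real ^ 4 option \<Rightarrow> real ^ 4 option \<Rightarrow> real ^ 4 option \<Rightarrow> real ^ 4 option
    \<Rightarrow> real ^ 4 option ^ 4 option" where
  "frame_matrix x p a b n = (\<chi> i. case i of None \<Rightarrow> x | Some k \<Rightarrow> vector [p, a, b, n] $ k)"

lemma vector_4_nth:
  fixes p a b n :: "'a::zero"
  shows "(vector [p, a, b, n] :: 'a ^ 4) $ 1 = p" "(vector [p, a, b, n] :: 'a ^ 4) $ 2 = a"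
    "(vector [p, a, b, n] :: 'a ^ 4) $ 3 = b" "(vector [p, a, b, n] :: 'a ^ 4) $ 4 = n"
  unfolding vector_def by simp_all

lemma frame_matrix_nth:
  "frame_matrix x p a b n $ None = x" "frame_matrix x p a b n $ Some 1 = p"
  "frame_matrix x p a b n $ Some 2 = a" "frame_matrix x p a b n $ Some 3 = b"
  "frame_matrix x p a b n $ Some 4 = n"
  by (simp_all add: frame_matrix_def vector_4_nth)

lemma forall_option_4: "(\<forall>i::4 option. P i) \<longleftrightarrow> P None \<and> P (Some 1) \<and> P (Some 2) \<and> P (Some 3) \<and> P (Some 4)"
  by (simp add: split_option_all forall_4)

lemma sum_option: "(\<Sum>i\<in>UNIV. f i) = f None + (\<Sum>k\<in>UNIV. f (Some k))"
  for f :: "'n::finite option \<Rightarrow> 'a::comm_monoid_add"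
  by (simp add: UNIV_option_conv sum.reindex)

lemma frame_matrix_row_4:
  "frame_matrix x p a b v = (\<chi> i. if i = Some 4 then v else frame_matrix x p a b 0 $ i)"
proof -
  have "\<forall>i. frame_matrix x p a b v $ i = (if i = Some 4 then v else frame_matrix x p a b 0 $ i)"
    unfolding forall_option_4 by (simp add: frame_matrix_nth)
  then show ?thesis unfolding vec_eq_iff[of "frame_matrix x p a b v"] by simp
qed

lemma det_frame_sum:
  "det (frame_matrix x p a b v) = (\<Sum>j\<in>UNIV. v $ j * det (frame_matrix x p a b (axis j 1)))"
proof -
  have "v = (\<Sum>j\<in>UNIV. v $ j *s axis j 1)"
    by (simp add: vec_eq_iff axis_def if_distrib cong: if_cong)
  then have "det (frame_matrix x p a b v) =
     det (\<chi> i. if i = Some 4 then (\<Sum>j\<in>UNIV. v $ j *s axis j 1) else frame_matrix x p a b 0 $ i)"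
    using frame_matrix_row_4 by metis
  also have "\<dots> = (\<Sum>j\<in>UNIV. det (\<chi> i. if i = Some 4 then v $ j *s axis j 1 else frame_matrix x p a b 0 $ i))"
    by (rule det_linear_row_sum) simp
  also have "\<dots> = (\<Sum>j\<in>UNIV. v $ j * det (frame_matrix x p a b (axis j 1)))"
    unfolding det_row_mul frame_matrix_row_4[of x p a b "axis _ 1"] by simp
  finally show ?thesis .
qed

lemma det_frame_scale: "det (frame_matrix x p a b (r *\<^sub>R v)) = r * det (frame_matrix x p a b v)"
  unfolding det_frame_sum[of _ _ _ _ "r *\<^sub>R v"] det_frame_sum[of _ _ _ _ v]
  by (simp add: sum_distrib_left mult_ac)

text \<open>The Gram matrix of the form, which turns it into the Euclidean inner product.\<close>

definition time_reflection :: "real ^ 4 option \<Rightarrow> real ^ 4 option" where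
  "time_reflection v = (\<chi> i. case i of None \<Rightarrow> - v $ None | Some k \<Rightarrow> v $ Some k)"

lemma time_reflection_inner: "time_reflection u \<bullet> v = lorentz u v"
  by (simp add: inner_vec_def sum_option time_reflection_def lorentz_def)

lemma time_reflection_eq_0: "time_reflection v = 0 \<longleftrightarrow> v = 0"
  by (simp add: time_reflection_def vec_eq_iff split_option_all)

text \<open>If the rows form a basis, a vector that is orthogonal to all of them vanishes because the
  form is nondegenerate.\<close>

lemma frame_nondegenerate:
  assumes "det (frame_matrix x p a b n) \<noteq> 0"
    and "lorentz v x = 0" "lorentz v p = 0" "lorentz v a = 0" "lorentz v b = 0" "lorentz v n = 0"
  shows "v = 0"
proof -
  let ?F = "frame_matrix x p a b n"
  have "(?F *v time_reflection v) $ i = lorentz v (?F $ i)" for i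
    unfolding time_reflection_inner[symmetric]
    by (simp add: matrix_vector_mult_def inner_vec_def mult.commute)
  moreover have "\<forall>i. lorentz v (?F $ i) = 0"
    unfolding forall_option_4 frame_matrix_nth using assms by simp
  ultimately have "?F *v time_reflection v = 0"
    by (simp add: vec_eq_iff)
  then have "time_reflection v = 0"
    using assms(1) invertible_det_nz invertible_left_inverse matrix_left_invertible_ker by blast
  then show ?thesis by (simp add: time_reflection_eq_0)
qed

text \<open>The pairings of \<open>x = \<psi>_{z zbar}\<close>, \<open>p = \<psi>\<close>, \<open>a = \<psi>_x\<close>, \<open>b = \<psi>_y\<close> at a point of a
  normalized lift. The value of \<open>x\<close> paired with itself depends on the surface and is left open.\<close>

locale adapted_frame =
  fixes x p a b :: "real ^ 4 option"
  assumes pp: "lorentz p p = 0" and pa: "lorentz p a = 0" and pb: "lorentz p b = 0"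
    and px: "lorentz p x = - (1/2)" and aa: "lorentz a a = 1" and bb: "lorentz b b = 1"
    and ab: "lorentz a b = 0" and ax: "lorentz a x = 0" and bx: "lorentz b x = 0"
begin

definition is_normal :: "real ^ 4 option \<Rightarrow> bool" where
  "is_normal n \<longleftrightarrow> lorentz n x = 0 \<and> lorentz n p = 0 \<and> lorentz n a = 0 \<and> lorentz n b = 0"

lemma gram_simps:
  "lorentz p p = 0" "lorentz p a = 0" "lorentz a p = 0" "lorentz p b = 0" "lorentz b p = 0"
  "lorentz p x = - (1/2)" "lorentz x p = - (1/2)" "lorentz a a = 1" "lorentz b b = 1"
  "lorentz a b = 0" "lorentz b a = 0" "lorentz a x = 0" "lorentz x a = 0"
  "lorentz b x = 0" "lorentz x b = 0"
  using pp pa pb px aa bb ab ax bx lorentz_commute by metis+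

text \<open>In a vanishing linear combination of the rows, pairing with \<open>p\<close>, \<open>a\<close>, \<open>b\<close>, \<open>n\<close> and then with
  \<open>x\<close> kills the coefficients one after the other.\<close>

lemma det_nonzero:
  assumes "is_normal n" "lorentz n n \<noteq> 0"
  shows "det (frame_matrix x p a b n) \<noteq> 0"
proof -
  let ?F = "frame_matrix x p a b n"
  have n: "lorentz x n = 0" "lorentz p n = 0" "lorentz a n = 0" "lorentz b n = 0"
    using assms lorentz_commute unfolding is_normal_def by metis+
  have "\<forall>i. c i = 0" if "(\<Sum>i\<in>UNIV. c i *s row i ?F) = 0" for c
  proof -
    have row: "row i ?F = ?F $ i" for i by (simp add: row_def)
    have s: "c None *s x + (c (Some 1) *s p + c (Some 2) *s a + c (Some 3) *s b + c (Some 4) *s n) = 0"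
      (is "?s = 0")
      using that unfolding row sum_option sum_4 frame_matrix_nth .
    have 0: "lorentz ?s u = 0" for u unfolding s by (simp add: lorentz_zero)
    show ?thesis
      using 0[of p] 0[of a] 0[of b] 0[of n] 0[of x] n assms
      unfolding forall_option_4 by (simp add: lorentz_linear gram_simps is_normal_def)
  qed
  then show ?thesis
    using matrix_right_invertible_independent_rows[of ?F] invertible_right_inverse invertible_det_nz
    by blast
qed

text \<open>Subtracting from \<open>m\<close> the multiple of the null vector \<open>p\<close> with the same time component does
  not change the norm, and makes it a sum of squares. It vanishes only if \<open>m\<close> is a multiple of
  \<open>p\<close>, which the pairing with \<open>x\<close> excludes.\<close>

lemma normal_spacelike:
  assumes "is_normal m" "m \<noteq> 0"
  shows "lorentz m m > 0"
proof -
  have m: "lorentz m p = 0" "lorentz m x = 0" "lorentz p m = 0"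
    using assms unfolding is_normal_def by (auto simp: lorentz_commute)
  have p0: "p $ None \<noteq> 0"
  proof
    assume "p $ None = 0"
    then have "(\<Sum>k\<in>UNIV. p $ Some k * p $ Some k) = 0"
      using pp by (simp add: lorentz_def)
    then have "\<forall>k. p $ Some k = 0"
      by (simp add: sum_nonneg_eq_0_iff)
    then have "p = 0" using \<open>p $ None = 0\<close> by (simp add: vec_eq_iff split_option_all)
    then show False using px by (simp add: lorentz_zero)
  qed
  define r where "r = m $ None / p $ None"
  \<comment> \<open>The time component of this vector is zero.\<close>
  define u where "u = m - r *s p"
  have u0: "u $ None = 0" using p0 by (simp add: u_def r_def)
  have uu: "lorentz u u = lorentz m m"
    by (simp add: u_def lorentz_linear m gram_simps)
  have uu': "lorentz u u = (\<Sum>k\<in>UNIV. u $ Some k * u $ Some k)"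
    by (simp add: lorentz_def u0)
  have "lorentz u u \<noteq> 0"
  proof
    assume "lorentz u u = 0"
    then have "\<forall>k. u $ Some k = 0"
      unfolding uu' by (simp add: sum_nonneg_eq_0_iff)
    then have "u = 0" using u0 by (simp add: vec_eq_iff split_option_all)
    then have mr: "m = r *s p" by (simp add: u_def)
    then have "r = 0" using m(2) by (simp add: lorentz_linear gram_simps)
    then show False using mr assms(2) by simp
  qed
  moreover have "lorentz u u \<ge> 0" unfolding uu' by (intro sum_nonneg) simp
  ultimately show ?thesis by (simp add: uu)
qed

lemma normal_exists: "\<exists>m. is_normal m \<and> m \<noteq> 0"
proof -
  let ?B = "{time_reflection x, time_reflection p, time_reflection a, time_reflection b}"
  have "dim ?B \<le> card ?B"
    by (rule dim_le_card) (auto intro: span_base)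
  also have "\<dots> \<le> 4"
    using card_length[of "[time_reflection x, time_reflection p, time_reflection a, time_reflection b]"]
    by simp
  also have "4 < DIM(real ^ 4 option)" by simp
  finally obtain m where m: "m \<noteq> 0" "\<And>y. y \<in> span ?B \<Longrightarrow> orthogonal m y"
    by (rule orthogonal_to_subspace_exists) blast
  have "lorentz m u = 0" if "time_reflection u \<in> ?B" for u
    using m(2)[OF span_base[OF that]]
    by (simp add: orthogonal_def inner_commute[of m] time_reflection_inner lorentz_commute)
  then have "is_normal m" by (simp add: is_normal_def)
  then show ?thesis using m by blast
qed

lemma unit_normal_exists:
  "\<exists>n. is_normal n \<and> lorentz n n = 1 \<and> det (frame_matrix x p a b n) > 0"
proof -
  obtain m where m: "is_normal m" "m \<noteq> 0" using normal_exists by blast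
  have pos: "lorentz m m > 0" by (rule normal_spacelike[OF m])
  define D where "D = det (frame_matrix x p a b m)"
  have D: "D \<noteq> 0" using det_nonzero[OF m(1)] pos by (simp add: D_def)
  define r where "r = sgn D / sqrt (lorentz m m)"
  have "is_normal (r *\<^sub>R m)"
    using m by (simp add: is_normal_def lorentz_linear)
  moreover have "lorentz (r *\<^sub>R m) (r *\<^sub>R m) = 1"
    using D pos by (simp add: lorentz_linear r_def sgn_if)
  moreover have "det (frame_matrix x p a b (r *\<^sub>R m)) > 0"
    unfolding det_frame_scale using D pos by (simp add: D_def[symmetric] r_def sgn_if)
  ultimately show ?thesis by blast
qed

text \<open>The generalized cross product: the vector that represents the functional
  \<open>v \<mapsto> det (x, p, a, b, v)\<close> with respect to the form. Its entries are polynomials in those of the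
  frame.\<close>

definition cross :: "real ^ 4 option" where
  "cross = time_reflection (\<chi> i. det (frame_matrix x p a b (axis i 1)))"

lemma lorentz_cross: "lorentz cross v = det (frame_matrix x p a b v)"
  unfolding det_frame_sum[of _ _ _ _ v]
  by (simp add: cross_def time_reflection_def lorentz_def sum_option mult.commute)

text \<open>This formula shows at once that the unit normal is unique and that it depends smoothly on the
  frame. The cross product is normal to the frame because a determinant with two equal rows
  vanishes, hence it is the multiple of \<open>n\<close> by the determinant of the frame.\<close>

lemma unit_normal_eq_cross:
  assumes "is_normal n" "lorentz n n = 1" "det (frame_matrix x p a b n) > 0"
  shows "n = (lorentz cross cross powr (- (1/2))) *\<^sub>R cross" "lorentz cross cross > 0"
proof -
  let ?d = "det (frame_matrix x p a b n)"
  have eq: "lorentz cross v = 0" if "i \<noteq> Some 4" "frame_matrix x p a b v $ i = v" for i v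
    unfolding lorentz_cross
    by (rule det_identical_rows[OF that(1)]) (simp add: row_def that(2) frame_matrix_nth)
  have "lorentz cross x = 0" "lorentz cross p = 0" "lorentz cross a = 0" "lorentz cross b = 0"
    using eq[of None x] eq[of "Some 1" p] eq[of "Some 2" a] eq[of "Some 3" b]
    by (simp_all add: frame_matrix_nth)
  moreover have "lorentz cross n = ?d" by (rule lorentz_cross)
  ultimately have "cross - ?d *\<^sub>R n = 0"
    using assms by (intro frame_nondegenerate[of x p a b n]) (auto simp: lorentz_linear is_normal_def)
  then have c: "cross = ?d *\<^sub>R n" by simp
  have cc: "lorentz cross cross = ?d\<^sup>2"
    unfolding c by (simp add: lorentz_linear assms power2_eq_square)
  show "lorentz cross cross > 0" using assms(3) by (simp add: cc)
  have "?d\<^sup>2 powr (- (1/2)) = 1 / ?d"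
    using assms(3) by (simp add: powr_minus_divide powr_half_sqrt)
  then show "n = (lorentz cross cross powr (- (1/2))) *\<^sub>R cross"
    unfolding cc using assms(3) by (subst c) simp
qed

end

lemma smooth_on_det:
  fixes A :: "'a::real_normed_vector \<Rightarrow> real ^ 'n ^ 'n"
  assumes "open S" "\<And>i. smooth_on S (\<lambda>w. A w $ i)"
  shows "smooth_on S (\<lambda>w. det (A w))"
  unfolding det_def
  by (intro smooth_on_sum[OF assms(1)] smooth_on_bounded_linear[OF assms(1) bounded_linear_mult_right]
      smooth_on_prod[OF assms(1)] smooth_on_vec_nth[OF assms(1)] assms(2))

section \<open>Null lifts and their invariants\<close>

text \<open>What the local theory of a normalized lift uses; it is invariant under Lorentz transformations
  and under restriction to smaller open sets.\<close>

locale null_lift =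
  fixes \<Omega> :: "complex set" and \<psi> :: "complex \<Rightarrow> real ^ 4 option"
  assumes open_\<Omega>: "open \<Omega>" and smooth_\<psi>: "smooth_on \<Omega> \<psi>"
    and null: "w \<in> \<Omega> \<Longrightarrow> lorentz (\<psi> w) (\<psi> w) = 0"
    and isometric: "w \<in> \<Omega> \<Longrightarrow>
      lorentz (frechet_derivative \<psi> (at w) v) (frechet_derivative \<psi> (at w) v) = (norm v)\<^sup>2"
begin

text \<open>The complex frame consists of the lift \<open>P\<close>, its derivatives \<open>Pz\<close> and \<open>Pb\<close>, the mixed
  derivative \<open>X\<close> and the normal \<open>N\<close>. The formulas for \<open>\<kappa>\<close> and \<open>c\<close> result from pairing the equation
  \<open>\<psi>_{zz} + c/2 \<psi> = \<kappa> N\<close> with \<open>N\<close> and with \<open>X\<close>, where \<open>\<psi>\<close> and \<open>X\<close> pair to -1/2.\<close>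

definition "P w = complexify (\<psi> w)"
definition "Pz = d_z P"
definition "Pb = d_zb P"
definition "Pzz = d_z Pz"
definition "X = d_z Pb"
definition "N w = complexify (unit_normal \<psi> w)"
definition "\<kappa> w = lorentz (Pzz w) (N w)"
definition "c w = 4 * lorentz (Pzz w) (X w)"

lemma smooth_P: "smooth_on \<Omega> P"
  unfolding P_def[abs_def] by (rule smooth_on_bounded_linear[OF open_\<Omega> bounded_linear_complexify smooth_\<psi>])

lemma smooth_Pz: "smooth_on \<Omega> Pz" and smooth_Pb: "smooth_on \<Omega> Pb"
  unfolding Pz_def Pb_def by (intro smooth_on_wirtinger open_\<Omega> smooth_P)+

lemma smooth_Pzz: "smooth_on \<Omega> Pzz" and smooth_X: "smooth_on \<Omega> X"
  unfolding Pzz_def X_def by (intro smooth_on_wirtinger open_\<Omega> smooth_Pz smooth_Pb)+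

lemma X_eq: assumes "w \<in> \<Omega>" shows "X w = d_zb Pz w" "X w = complexify (d_zzbar \<psi> w)"
  using wirtinger_commute(1)[OF open_\<Omega> smooth_P assms]
    wirtinger_complexify_twice[OF open_\<Omega> smooth_\<psi> assms]
  unfolding X_def Pb_def Pz_def P_def[abs_def] by simp_all

lemma Pz_eq: "w \<in> \<Omega> \<Longrightarrow> Pz w = (1/2) *s (complexify (d_x \<psi> w) - \<i> *s complexify (d_y \<psi> w))"
  and Pb_eq: "w \<in> \<Omega> \<Longrightarrow> Pb w = (1/2) *s (complexify (d_x \<psi> w) + \<i> *s complexify (d_y \<psi> w))"
  using wirtinger_complexify[OF smooth_on_differentiable[OF smooth_\<psi>]]
  unfolding Pz_def Pb_def P_def[abs_def] by blast+

lemma dx_eq: assumes "w \<in> \<Omega>" shows "complexify (d_x \<psi> w) = Pz w + Pb w"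
    "complexify (d_y \<psi> w) = \<i> *s (Pz w - Pb w)"
  unfolding Pz_eq[OF assms] Pb_eq[OF assms] by (simp_all add: vec_eq_iff field_simps)

lemma cnj_P: "vcnj (P w) = P w" and cnj_N: "vcnj (N w) = N w"
  and cnj_X: "w \<in> \<Omega> \<Longrightarrow> vcnj (X w) = X w"
  and cnj_Pz: "w \<in> \<Omega> \<Longrightarrow> vcnj (Pz w) = Pb w" and cnj_Pb: "w \<in> \<Omega> \<Longrightarrow> vcnj (Pb w) = Pz w"
  by (simp_all add: P_def N_def X_eq(2) Pz_eq Pb_eq vcnj_simps)

lemma frechet_\<psi>: "w \<in> \<Omega> \<Longrightarrow> frechet_derivative \<psi> (at w) v = Re v *\<^sub>R d_x \<psi> w + Im v *\<^sub>R d_y \<psi> w"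
proof -
  assume "w \<in> \<Omega>"
  then have "linear (frechet_derivative \<psi> (at w))"
    using smooth_on_differentiable[OF smooth_\<psi>] linear_frechet_derivative by blast
  then have "frechet_derivative \<psi> (at w) (Re v *\<^sub>R 1 + Im v *\<^sub>R \<i>) = Re v *\<^sub>R d_x \<psi> w + Im v *\<^sub>R d_y \<psi> w"
    by (simp only: linear_add linear_scale d_x_def d_y_def)
  moreover have "Re v *\<^sub>R 1 + Im v *\<^sub>R \<i> = v" by (simp add: complex_eq_iff)
  ultimately show ?thesis by simp
qed

lemma real_gram:
  assumes "w \<in> \<Omega>"
  shows "lorentz (d_x \<psi> w) (d_x \<psi> w) = 1" "lorentz (d_y \<psi> w) (d_y \<psi> w) = 1"
    "lorentz (d_x \<psi> w) (d_y \<psi> w) = 0"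
proof -
  show 1: "lorentz (d_x \<psi> w) (d_x \<psi> w) = 1" "lorentz (d_y \<psi> w) (d_y \<psi> w) = 1"
    using isometric[OF assms, of 1] isometric[OF assms, of \<i>] by (simp_all add: d_x_def d_y_def)
  have "(norm (1 + \<i>))\<^sup>2 = 2" by (simp add: cmod_def)
  then have "lorentz (d_x \<psi> w + d_y \<psi> w) (d_x \<psi> w + d_y \<psi> w) = 2"
    using isometric[OF assms, of "1 + \<i>"] by (simp add: frechet_\<psi>[OF assms])
  then show "lorentz (d_x \<psi> w) (d_y \<psi> w) = 0"
    by (simp add: lorentz_linear 1 lorentz_commute[of "d_y \<psi> w" "d_x \<psi> w"])
qed

text \<open>Differentiating a constant pairing; each relation of the Gram matrix arises in this way from
  one of lower order.\<close>

lemma deriv_lorentz: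
  assumes "w \<in> \<Omega>" "smooth_on \<Omega> F" "smooth_on \<Omega> G" "\<And>v. v \<in> \<Omega> \<Longrightarrow> lorentz (F v) (G v) = C"
  shows "lorentz (d_z F w) (G w) + lorentz (F w) (d_z G w) = 0"
    "lorentz (d_zb F w) (G w) + lorentz (F w) (d_zb G w) = 0"
  using wirtinger_lorentz[OF smooth_on_differentiable[OF assms(2,1)] smooth_on_differentiable[OF assms(3,1)]]
    wirtinger_cong(1,2)[OF open_\<Omega> assms(1) smooth_on_const[where c = C], of "\<lambda>w. lorentz (F w) (G w)"] assms(4)
  by (simp_all add: wirtinger_const)

lemma gram_first_order:
  assumes "w \<in> \<Omega>"
  shows "lorentz (P w) (P w) = 0" "lorentz (Pz w) (Pz w) = 0" "lorentz (Pb w) (Pb w) = 0"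
    "lorentz (Pz w) (Pb w) = 1/2" "lorentz (P w) (Pz w) = 0" "lorentz (P w) (Pb w) = 0"
proof -
  have PP: "lorentz (P w) (P w) = 0" if "w \<in> \<Omega>" for w
    using null[OF that] by (simp add: P_def lorentz_complexify)
  show "lorentz (P w) (P w) = 0" using PP[OF assms] .
  show "lorentz (Pz w) (Pz w) = 0" "lorentz (Pb w) (Pb w) = 0" "lorentz (Pz w) (Pb w) = 1/2"
    using assms real_gram[OF assms]
    by (simp_all add: Pz_eq Pb_eq lorentz_linear lorentz_complexify lorentz_commute[of "d_y \<psi> w" "d_x \<psi> w"])
  show "lorentz (P w) (Pz w) = 0" "lorentz (P w) (Pb w) = 0"
    using deriv_lorentz[OF assms smooth_P smooth_P PP]
    by (simp_all add: Pz_def[symmetric] Pb_def[symmetric] lorentz_commute[of "Pz w" "P w"] lorentz_commute[of "Pb w" "P w"])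
qed

lemma gram_second_order:
  assumes "w \<in> \<Omega>"
  shows "lorentz (P w) (X w) = - 1/2" "lorentz (Pz w) (X w) = 0" "lorentz (Pb w) (X w) = 0"
    "lorentz (P w) (Pzz w) = 0" "lorentz (Pz w) (Pzz w) = 0" "lorentz (Pb w) (Pzz w) = 0"
proof -
  note z = deriv_lorentz(1)[OF assms] and b = deriv_lorentz(2)[OF assms]
  note fold = X_eq(1)[OF assms, symmetric] X_def[symmetric] Pzz_def[symmetric] Pz_def[symmetric] Pb_def[symmetric]
  show "lorentz (P w) (X w) = - 1/2"
    using b[OF smooth_P smooth_Pz gram_first_order(5)] gram_first_order(4)[OF assms]
    by (simp add: fold lorentz_commute[of "Pb w" "Pz w"] eq_neg_iff_add_eq_0 add.commute)
  show PzX: "lorentz (Pz w) (X w) = 0"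
    using b[OF smooth_Pz smooth_Pz gram_first_order(2)] by (simp add: fold lorentz_commute[of "X w" "Pz w"])
  show "lorentz (Pb w) (X w) = 0"
    using z[OF smooth_Pb smooth_Pb gram_first_order(3)] by (simp add: fold lorentz_commute[of "X w" "Pb w"])
  show "lorentz (P w) (Pzz w) = 0"
    using z[OF smooth_P smooth_Pz gram_first_order(5)] gram_first_order(2)[OF assms] by (simp add: fold)
  show "lorentz (Pz w) (Pzz w) = 0"
    using z[OF smooth_Pz smooth_Pz gram_first_order(2)] by (simp add: fold lorentz_commute[of "Pzz w" "Pz w"])
  show "lorentz (Pb w) (Pzz w) = 0"
    using z[OF smooth_Pz smooth_Pb gram_first_order(4)] PzX by (simp add: fold lorentz_commute[of "Pzz w" "Pb w"])
qed

abbreviation "\<xi> \<equiv> d_zzbar \<psi>"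

lemma frame:
  assumes "w \<in> \<Omega>"
  shows "adapted_frame (\<xi> w) (\<psi> w) (d_x \<psi> w) (d_y \<psi> w)"
proof -
  have "complex_of_real (lorentz (\<psi> w) (d_x \<psi> w)) = 0" "complex_of_real (lorentz (\<psi> w) (d_y \<psi> w)) = 0"
    "complex_of_real (lorentz (\<psi> w) (\<xi> w)) = complex_of_real (-1/2)"
    "complex_of_real (lorentz (d_x \<psi> w) (\<xi> w)) = 0" "complex_of_real (lorentz (d_y \<psi> w) (\<xi> w)) = 0"
    unfolding lorentz_complexify[symmetric] dx_eq[OF assms] P_def[symmetric] X_eq(2)[OF assms, symmetric]
    by (simp_all add: lorentz_linear gram_first_order[OF assms] gram_second_order[OF assms])
  then show ?thesis
    unfolding of_real_eq_iff of_real_eq_0_iff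
    by unfold_locales (simp_all add: real_gram[OF assms] null[OF assms])
qed

lemma V_perp_iff:
  assumes "w \<in> \<Omega>"
  shows "n \<in> V_perp \<psi> w \<longleftrightarrow> adapted_frame.is_normal (\<xi> w) (\<psi> w) (d_x \<psi> w) (d_y \<psi> w) n"
proof -
  let ?B = "{\<psi> w} \<union> range (frechet_derivative \<psi> (at w)) \<union> {\<xi> w}"
  have "n \<in> V_perp \<psi> w \<longleftrightarrow> (\<forall>v\<in>?B. lorentz n v = 0)"
  proof
    assume "\<forall>v\<in>?B. lorentz n v = 0"
    then have "span ?B \<subseteq> {v. lorentz n v = 0}"
      by (intro span_minimal) (auto simp: subspace_def lorentz_linear)
    then show "n \<in> V_perp \<psi> w" by (auto simp: V_perp_def V_fibre_def)
  qed (auto simp: V_perp_def V_fibre_def intro: span_base)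
  also have "\<dots> \<longleftrightarrow> lorentz n (\<psi> w) = 0 \<and> (\<forall>v. lorentz n (frechet_derivative \<psi> (at w) v) = 0) \<and> lorentz n (\<xi> w) = 0"
    by auto
  also have "(\<forall>v. lorentz n (frechet_derivative \<psi> (at w) v) = 0) \<longleftrightarrow>
      lorentz n (d_x \<psi> w) = 0 \<and> lorentz n (d_y \<psi> w) = 0"
  proof
    assume *: "\<forall>v. lorentz n (frechet_derivative \<psi> (at w) v) = 0"
    show "lorentz n (d_x \<psi> w) = 0 \<and> lorentz n (d_y \<psi> w) = 0"
      using *[rule_format, of 1] *[rule_format, of \<i>] by (simp add: d_x_def d_y_def)
  qed (simp add: frechet_\<psi>[OF assms] lorentz_linear)
  finally show ?thesis
    unfolding adapted_frame.is_normal_def[OF frame[OF assms]] by blast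
qed

lemma is_unit_normal_iff:
  assumes "w \<in> \<Omega>"
  shows "is_unit_normal \<psi> w n \<longleftrightarrow>
    adapted_frame.is_normal (\<xi> w) (\<psi> w) (d_x \<psi> w) (d_y \<psi> w) n \<and> lorentz n n = 1 \<and>
    det (frame_matrix (\<xi> w) (\<psi> w) (d_x \<psi> w) (d_y \<psi> w) n) > 0"
  unfolding is_unit_normal_def V_perp_iff[OF assms] frame_matrix_def ..

definition "cross_normal w = adapted_frame.cross (\<xi> w) (\<psi> w) (d_x \<psi> w) (d_y \<psi> w)"

lemma is_unit_normal_unique:
  assumes "w \<in> \<Omega>" "is_unit_normal \<psi> w n"
  shows "n = (lorentz (cross_normal w) (cross_normal w) powr (- (1/2))) *\<^sub>R cross_normal w"
    "lorentz (cross_normal w) (cross_normal w) > 0"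
  unfolding cross_normal_def
  using adapted_frame.unit_normal_eq_cross[OF frame[OF assms(1)]] assms(2)
  unfolding is_unit_normal_iff[OF assms(1)] by blast+

lemma unit_normal_ex1: assumes "w \<in> \<Omega>" shows "\<exists>!n. is_unit_normal \<psi> w n"
  using adapted_frame.unit_normal_exists[OF frame[OF assms]] is_unit_normal_iff[OF assms]
    is_unit_normal_unique(1)[OF assms] by metis

lemma unit_normal: "w \<in> \<Omega> \<Longrightarrow> is_unit_normal \<psi> w (unit_normal \<psi> w)"
  unfolding unit_normal_def by (rule theI'[OF unit_normal_ex1])

lemma smooth_d_zzbar: "smooth_on \<Omega> \<xi>"
proof -
  have "\<xi> = (\<lambda>w. (1/4) *\<^sub>R (d_x (d_x \<psi>) w + d_y (d_y \<psi>) w))"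
    by (auto simp: d_zzbar_def)
  then show ?thesis
    by (simp only:) (intro smooth_on_bounded_linear[OF open_\<Omega> bounded_linear_scaleR_right]
        smooth_on_add[OF open_\<Omega>] smooth_on_d_x smooth_on_d_y smooth_\<psi>)
qed

text \<open>The unit normal is the normalized cross product.\<close>

lemma smooth_normal: "smooth_on \<Omega> (unit_normal \<psi>)"
proof -
  have F: "smooth_on \<Omega> (\<lambda>w. frame_matrix (\<xi> w) (\<psi> w) (d_x \<psi> w) (d_y \<psi> w) e $ i)" for e i
  proof -
    have "\<forall>i. smooth_on \<Omega> (\<lambda>w. frame_matrix (\<xi> w) (\<psi> w) (d_x \<psi> w) (d_y \<psi> w) e $ i)"
      unfolding forall_option_4 frame_matrix_nth
      by (intro conjI smooth_d_zzbar smooth_\<psi> smooth_on_d_x smooth_on_d_y smooth_on_const)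
    then show ?thesis by blast
  qed
  have tr: "bounded_linear time_reflection"
    unfolding linear_conv_bounded_linear[symmetric]
    by (auto intro!: linearI simp: time_reflection_def vec_eq_iff split_option_all)
  have sc: "smooth_on \<Omega> (\<lambda>w. time_reflection
     (vec_lambda (\<lambda>i. det (frame_matrix (\<xi> w) (\<psi> w) (d_x \<psi> w) (d_y \<psi> w) (axis i 1)))))"
    by (intro smooth_on_bounded_linear[OF open_\<Omega> tr] smooth_on_vec_lambda[OF open_\<Omega>]
       smooth_on_det[OF open_\<Omega>] F)
  have cross: "smooth_on \<Omega> cross_normal"
    by (rule smooth_on_cong[OF open_\<Omega> sc])
       (simp add: cross_normal_def adapted_frame.cross_def[OF frame])
  have "smooth_on \<Omega> (\<lambda>w. (lorentz (cross_normal w) (cross_normal w) powr (- (1/2))) *\<^sub>R cross_normal w)"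
    by (intro smooth_on_bilinear[OF open_\<Omega> bounded_bilinear_scaleR] cross smooth_on_powr[OF open_\<Omega>]
        smooth_on_bilinear[OF open_\<Omega> bounded_bilinear_lorentz] is_unit_normal_unique(2)[OF _ unit_normal])
  then show ?thesis
    by (rule smooth_on_cong[OF open_\<Omega>]) (rule is_unit_normal_unique(1)[OF _ unit_normal])
qed

lemma smooth_N: "smooth_on \<Omega> N"
  unfolding N_def[abs_def] by (rule smooth_on_bounded_linear[OF open_\<Omega> bounded_linear_complexify smooth_normal])

lemma smooth_\<kappa>: "smooth_on \<Omega> \<kappa>" and smooth_c: "smooth_on \<Omega> c"
  unfolding \<kappa>_def[abs_def] c_def[abs_def]
  by (intro smooth_on_bounded_linear[OF open_\<Omega> bounded_linear_mult_right]
      smooth_on_bilinear[OF open_\<Omega> bounded_bilinear_lorentz] smooth_Pzz smooth_N smooth_X)+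

lemma det_frame: "w \<in> \<Omega> \<Longrightarrow>
    det (frame_matrix (\<xi> w) (\<psi> w) (d_x \<psi> w) (d_y \<psi> w) (unit_normal \<psi> w)) > 0"
  using unit_normal is_unit_normal_iff by blast

lemma gram_normal:
  assumes "w \<in> \<Omega>"
  shows "lorentz (N w) (N w) = 1" "lorentz (N w) (P w) = 0" "lorentz (N w) (Pz w) = 0"
    "lorentz (N w) (Pb w) = 0" "lorentz (N w) (X w) = 0"
  using unit_normal[OF assms] unfolding is_unit_normal_iff[OF assms] adapted_frame.is_normal_def[OF frame[OF assms]]
  by (simp_all add: N_def P_def X_eq(2) Pz_eq Pb_eq assms lorentz_linear lorentz_complexify)

text \<open>A complex vector is treated by its real and imaginary parts, since the frame is spanned over
  the complex numbers by a real basis.\<close>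

lemma nondegenerate:
  assumes "w \<in> \<Omega>" and "lorentz v (P w) = 0" "lorentz v (Pz w) = 0" "lorentz v (Pb w) = 0"
    "lorentz v (X w) = 0" "lorentz v (N w) = 0"
  shows "v = 0"
proof -
  define u where "u = vec_lambda (\<lambda>i. Re (v $ i))"
  define u' where "u' = vec_lambda (\<lambda>i. Im (v $ i))"
  have v: "lorentz v (complexify y) = complex_of_real (lorentz u y) + \<i> * complex_of_real (lorentz u' y)" for y
    by (simp add: complex_eq_iff u_def u'_def lorentz_def complexify_def)
  have "lorentz v (complexify y) = 0 \<Longrightarrow> lorentz u y = 0 \<and> lorentz u' y = 0" for y
    unfolding v by (simp add: complex_eq_iff)
  then have "lorentz u y = 0 \<and> lorentz u' y = 0"
    if "y \<in> {\<xi> w, \<psi> w, d_x \<psi> w, d_y \<psi> w, unit_normal \<psi> w}" for y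
    using that assms dx_eq[OF assms(1)] X_eq(2)[OF assms(1)] by (auto simp: P_def N_def lorentz_linear)
  then have "u = 0" "u' = 0"
    by (auto intro!: frame_nondegenerate[OF less_imp_neq[OF det_frame[OF assms(1)], symmetric]])
  then show ?thesis by (simp add: vec_eq_iff u_def u'_def complex_eq_iff)
qed

text \<open>The structure equations below are all proved by comparing the pairings of both sides with the
  complex frame.\<close>

lemma eq_by_pairing:
  assumes "w \<in> \<Omega>" and "lorentz u (P w) = lorentz v (P w)" "lorentz u (Pz w) = lorentz v (Pz w)"
    "lorentz u (Pb w) = lorentz v (Pb w)" "lorentz u (X w) = lorentz v (X w)" "lorentz u (N w) = lorentz v (N w)"
  shows "u = v"
  using nondegenerate[of w "u - v"] assms by (simp add: lorentz_linear)

lemma gram_sym: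
  assumes "w \<in> \<Omega>"
  shows "lorentz (Pb w) (Pz w) = 1/2" "lorentz (Pz w) (P w) = 0" "lorentz (Pb w) (P w) = 0"
   "lorentz (X w) (P w) = - 1/2" "lorentz (X w) (Pz w) = 0" "lorentz (X w) (Pb w) = 0"
    "lorentz (Pzz w) (P w) = 0" "lorentz (Pzz w) (Pz w) = 0" "lorentz (Pzz w) (Pb w) = 0"
   "lorentz (P w) (N w) = 0" "lorentz (Pz w) (N w) = 0"
    "lorentz (Pb w) (N w) = 0" "lorentz (X w) (N w) = 0"
  using gram_first_order[OF assms] gram_second_order[OF assms] gram_normal[OF assms]
  by (simp_all add: lorentz_commute[of "Pb w" "Pz w"] 
     lorentz_commute[of "X w" "P w"] lorentz_commute[of "X w" "Pz w"] lorentz_commute[of "X w" "Pb w"]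
     lorentz_commute[of "Pz w" "P w"] lorentz_commute[of "Pb w" "P w"] lorentz_commute[of "Pzz w" "P w"]
     lorentz_commute[of "Pzz w" "Pz w"] lorentz_commute[of "Pzz w" "Pb w"]
     lorentz_commute[of "P w" "N w"] lorentz_commute[of "Pz w" "N w"] lorentz_commute[of "Pb w" "N w"]
     lorentz_commute[of "X w" "N w"])

text \<open>The vector \<open>\<psi>_{zz}\<close> is orthogonal to \<open>\<psi>\<close>, \<open>\<psi>_z\<close> and \<open>\<psi>_{zbar}\<close>, so it has only components
  along \<open>\<psi>\<close> and the normal.\<close>

lemma Pzz_structure:
  assumes "w \<in> \<Omega>"
  shows "Pzz w = (- c w / 2) *s P w + \<kappa> w *s N w"
  by (rule eq_by_pairing[OF assms])
     (simp_all add: lorentz_linear gram_first_order[OF assms] gram_second_order[OF assms] gram_normal[OF assms] gram_sym[OF assms] c_def \<kappa>_def)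

text \<open>The unique existence on which the definite descriptions of the invariants rest.\<close>

lemma schwarzian_hopf_eq_iff:
  assumes "w \<in> \<Omega>"
  shows "schwarzian_hopf_eq \<psi> w c' \<kappa>' \<longleftrightarrow> c' = c w \<and> \<kappa>' = \<kappa> w"
proof -
  have "schwarzian_hopf_eq \<psi> w c' \<kappa>' \<longleftrightarrow> Pzz w + (c' / 2) *s P w = \<kappa>' *s N w"
    unfolding schwarzian_hopf_eq_def Pzz_def Pz_def P_def[abs_def] N_def o_def ..
  also have "\<dots> \<longleftrightarrow> c' = c w \<and> \<kappa>' = \<kappa> w"
  proof
    assume eq: "Pzz w + (c' / 2) *s P w = \<kappa>' *s N w"
    have "\<kappa>' = \<kappa> w"
      using arg_cong[OF eq, of "\<lambda>v. lorentz v (N w)"]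
      by (simp add: lorentz_linear gram_sym[OF assms] gram_normal[OF assms] \<kappa>_def)
    moreover have "c' = c w"
      using arg_cong[OF eq, of "\<lambda>v. lorentz v (X w)"]
      by (simp add: lorentz_linear gram_second_order[OF assms] gram_normal[OF assms] c_def mult.commute[of _ 4])
    ultimately show "c' = c w \<and> \<kappa>' = \<kappa> w" by simp
  next
    assume "c' = c w \<and> \<kappa>' = \<kappa> w"
    then show "Pzz w + (c' / 2) *s P w = \<kappa>' *s N w"
      by (simp add: Pzz_structure[OF assms] vec_eq_iff)
  qed
  finally show ?thesis .
qed

definition "Pbb = d_zb Pb"

lemma Pbb_eq: assumes "w \<in> \<Omega>" shows "Pbb w = vcnj (Pzz w)"
proof -
  have s: "smooth_on \<Omega> (\<lambda>w. vcnj (Pz w))"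
    by (rule smooth_on_bounded_linear[OF open_\<Omega> bounded_linear_vcnj smooth_Pz])
  have "d_zb Pb w = d_zb (\<lambda>w. vcnj (Pz w)) w"
    by (rule wirtinger_cong(4)[OF open_\<Omega> assms s]) (simp add: cnj_Pz)
  then show ?thesis
    by (simp add: Pbb_def Pzz_def wirtinger_vcnj[OF smooth_on_differentiable[OF smooth_Pz assms]])
qed

lemma Pbb_structure:
  "w \<in> \<Omega> \<Longrightarrow> Pbb w = (- cnj (c w) / 2) *s P w + cnj (\<kappa> w) *s N w"
  by (simp add: Pbb_eq Pzz_structure vcnj_simps cnj_P cnj_N)

lemma pair_Pzz_N: "w \<in> \<Omega> \<Longrightarrow> lorentz (N w) (Pzz w) = \<kappa> w"
  by (simp add: \<kappa>_def lorentz_commute)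

lemma X_z: assumes "w \<in> \<Omega>" shows "d_z X w = d_zb Pzz w"
proof -
  have "d_z X w = d_z (d_zb Pz) w"
    by (rule wirtinger_cong(3)[OF open_\<Omega> assms])
       (auto intro: smooth_on_wirtinger open_\<Omega> smooth_Pz simp: X_eq)
  then show ?thesis
    using wirtinger_commute(1)[OF open_\<Omega> smooth_Pz assms] by (simp add: Pzz_def)
qed

lemma wirtinger_linear_combination:
  assumes "w \<in> \<Omega>" "smooth_on \<Omega> f" "smooth_on \<Omega> g" "smooth_on \<Omega> F" "smooth_on \<Omega> G"
    "\<And>v. v \<in> \<Omega> \<Longrightarrow> H v = f v *s F v + g v *s G v"
  shows "d_z H w = dz f w *s F w + f w *s d_z F w + (dz g w *s G w + g w *s d_z G w)"
    "d_zb H w = dzb f w *s F w + f w *s d_zb F w + (dzb g w *s G w + g w *s d_zb G w)"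
proof -
  note sm = smooth_on_bilinear[OF open_\<Omega> bounded_bilinear_vector_scalar_mult]
  have s: "smooth_on \<Omega> (\<lambda>v. f v *s F v + g v *s G v)"
    by (intro smooth_on_add[OF open_\<Omega>] sm assms)
  note d = smooth_on_differentiable[OF _ assms(1)]
  note ad = wirtinger_add[OF d[OF sm[OF assms(2,4)]] d[OF sm[OF assms(3,5)]]]
  note sc = wirtinger_scale[OF d[OF assms(2)] d[OF assms(4)]] wirtinger_scale[OF d[OF assms(3)] d[OF assms(5)]]
  show "d_z H w = dz f w *s F w + f w *s d_z F w + (dz g w *s G w + g w *s d_z G w)"
    using wirtinger_cong(3)[OF open_\<Omega> assms(1) s, of H] assms(6) by (simp add: ad sc)
  show "d_zb H w = dzb f w *s F w + f w *s d_zb F w + (dzb g w *s G w + g w *s d_zb G w)"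
    using wirtinger_cong(4)[OF open_\<Omega> assms(1) s, of H] assms(6) by (simp add: ad sc)
qed

lemma smooth_half_c: "smooth_on \<Omega> (\<lambda>w. - c w / 2)"
  using smooth_on_bounded_linear[OF open_\<Omega> bounded_linear_mult_right smooth_c, of "-1/2"] by simp

lemma dzb_half_c: "w \<in> \<Omega> \<Longrightarrow> dzb (\<lambda>w. - c w / 2) w = - dzb c w / 2"
  using wirtinger_mult(2)[of "\<lambda>w. - 1/2" w c] smooth_on_differentiable[OF smooth_c]
  by (simp add: wirtinger_const)

lemma X_z_raw:
  assumes "w \<in> \<Omega>"
  shows "d_z X w = (- dzb c w / 2) *s P w + (- c w / 2) *s Pb w + (dzb \<kappa> w *s N w + \<kappa> w *s d_zb N w)"
  using wirtinger_linear_combination(2)[OF assms smooth_half_c smooth_\<kappa> smooth_P smooth_N Pzz_structure]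
  unfolding X_z[OF assms] dzb_half_c[OF assms] Pb_def by simp

text \<open>The pairings of \<open>N_z\<close> with the frame follow from the orthogonality of \<open>N\<close>; only the one with
  \<open>X\<close> involves a third derivative of the lift, which is obtained by differentiating
  \<open>\<psi>_{zz} = -c/2 \<psi> + \<kappa> N\<close> with respect to \<open>zbar\<close>.\<close>

lemma N_z:
  assumes "w \<in> \<Omega>"
  shows "d_z N w = (2 * dzb \<kappa> w) *s P w + (- 2 * \<kappa> w) *s Pb w"
proof -
  note z = deriv_lorentz(1)[OF assms smooth_N] and zb = deriv_lorentz(2)[OF assms smooth_N]
  note fold = X_eq(1)[OF assms, symmetric] X_def[symmetric] Pzz_def[symmetric] Pz_def[symmetric] Pb_def[symmetric]
  note g = gram_first_order[OF assms] gram_second_order[OF assms] gram_normal[OF assms] gram_sym[OF assms]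
  have NbN: "lorentz (N w) (d_zb N w) = 0"
    using zb[OF smooth_N gram_normal(1)] by (simp add: lorentz_commute[of "d_zb N w" "N w"])
  have 1: "lorentz (d_z N w) (P w) = 0"
    using z[OF smooth_P gram_normal(2)] by (simp add: fold g)
  have 2: "lorentz (d_z N w) (Pz w) = - \<kappa> w"
    using z[OF smooth_Pz gram_normal(3)] by (simp add: fold g pair_Pzz_N[OF assms] eq_neg_iff_add_eq_0)
  have 3: "lorentz (d_z N w) (Pb w) = 0"
    using z[OF smooth_Pb gram_normal(4)] by (simp add: fold g)
  have 4: "lorentz (d_z N w) (X w) = - dzb \<kappa> w"
    using z[OF smooth_X gram_normal(5)]
    by (simp add: fold g X_z_raw[OF assms] lorentz_linear NbN eq_neg_iff_add_eq_0)
  have 5: "lorentz (d_z N w) (N w) = 0"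
    using z[OF smooth_N gram_normal(1)] by (simp add: lorentz_commute[of "N w" "d_z N w"])
  show ?thesis
    by (rule eq_by_pairing[OF assms]) (simp_all add: lorentz_linear g 1 2 3 4 5)
qed

lemma N_b:
  assumes "w \<in> \<Omega>"
  shows "d_zb N w = (2 * cnj (dzb \<kappa> w)) *s P w + (- 2 * cnj (\<kappa> w)) *s Pz w"
proof -
  have "d_zb N w = d_zb (\<lambda>w. vcnj (N w)) w" by (simp add: cnj_N)
  then show ?thesis
    by (simp add: wirtinger_vcnj[OF smooth_on_differentiable[OF smooth_N assms]] N_z[OF assms]
       vcnj_simps cnj_P cnj_Pb[OF assms])
qed

lemma X_z_structure:
  assumes "w \<in> \<Omega>"
  shows "d_z X w = (2 * \<kappa> w * cnj (dzb \<kappa> w) - dzb c w / 2) *s P w + (- 2 * \<kappa> w * cnj (\<kappa> w)) *s Pz w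
     + (- c w / 2) *s Pb w + dzb \<kappa> w *s N w"
  unfolding X_z_raw[OF assms] N_b[OF assms] by (simp add: vec_eq_iff algebra_simps)

lemma XX: assumes "w \<in> \<Omega>" shows "lorentz (X w) (X w) = \<kappa> w * cnj (\<kappa> w)"
proof -
  have "lorentz (X w) (X w) = - lorentz (d_z X w) (Pb w)"
    using deriv_lorentz(1)[OF assms smooth_X smooth_Pb gram_sym(6)]
    by (simp add: X_def[symmetric] eq_neg_iff_add_eq_0 add.commute)
  then show ?thesis
    using assms by (simp add: X_z_structure lorentz_linear gram_first_order gram_normal gram_sym)
qed

text \<open>The equation of Gauss compares two expressions for the derivative of
  \<open>lorentz X X = \<bar>\<kappa>\<bar>\<^sup>2\<close>. The Schwarzian enters only through its \<open>zbar\<close>-derivative, which is therefore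
  determined by \<open>\<kappa>\<close>.\<close>

lemma gauss:
  assumes "w \<in> \<Omega>"
  shows "dzb c w = 2 * (dz \<kappa> w * cnj (\<kappa> w) + \<kappa> w * cnj (dzb \<kappa> w)) + 4 * \<kappa> w * cnj (dzb \<kappa> w)"
proof -
  note g = gram_first_order[OF assms] gram_second_order[OF assms] gram_normal[OF assms] gram_sym[OF assms]
  note d = smooth_on_differentiable[OF _ assms]
  have sk: "smooth_on \<Omega> (\<lambda>w. cnj (\<kappa> w))"
    by (rule smooth_on_bounded_linear[OF open_\<Omega> bounded_linear_cnj smooth_\<kappa>])
  have "dz (\<lambda>w. lorentz (X w) (X w)) w = dz (\<lambda>w. \<kappa> w * cnj (\<kappa> w)) w"
    by (rule wirtinger_cong(1)[OF open_\<Omega> assms])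
       (intro smooth_on_bilinear[OF open_\<Omega> bounded_bilinear_mult] smooth_\<kappa> sk, simp add: XX)
  also have "\<dots> = dz \<kappa> w * cnj (\<kappa> w) + \<kappa> w * cnj (dzb \<kappa> w)"
    by (simp add: wirtinger_mult[OF d[OF smooth_\<kappa>] d[OF sk]] wirtinger_cnj[OF d[OF smooth_\<kappa>]])
  finally have "2 * lorentz (d_z X w) (X w) = dz \<kappa> w * cnj (\<kappa> w) + \<kappa> w * cnj (dzb \<kappa> w)"
    unfolding wirtinger_lorentz[OF d[OF smooth_X] d[OF smooth_X]] by (simp add: lorentz_commute[of "X w" "d_z X w"])
  then have "dz \<kappa> w * cnj (\<kappa> w) + \<kappa> w * cnj (dzb \<kappa> w) = dzb c w / 2 - 2 * \<kappa> w * cnj (dzb \<kappa> w)"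
    by (simp add: X_z_structure[OF assms] lorentz_linear g algebra_simps)
  then show ?thesis by (simp add: algebra_simps)
qed

text \<open>The equation of Codazzi says that \<open>N_{z zbar}\<close> is real; the coefficient of \<open>\<psi>\<close> in it carries
  the condition.\<close>

lemma codazzi:
  assumes "w \<in> \<Omega>"
  shows "Im (2 * dzb (dzb \<kappa>) w + \<kappa> w * cnj (c w)) = 0"
proof -
  note g = gram_first_order[OF assms] gram_second_order[OF assms] gram_normal[OF assms] gram_sym[OF assms]
  have s1: "smooth_on \<Omega> (\<lambda>w. 2 * dzb \<kappa> w)" "smooth_on \<Omega> (\<lambda>w. - 2 * \<kappa> w)"
    by (intro smooth_on_bounded_linear[OF open_\<Omega> bounded_linear_mult_right] smooth_on_wirtinger open_\<Omega> smooth_\<kappa>)+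
  note d = smooth_on_differentiable[OF _ assms]
  have 2: "dzb (\<lambda>w. 2 * dzb \<kappa> w) w = 2 * dzb (dzb \<kappa>) w" "dzb (\<lambda>w. - 2 * \<kappa> w) w = - 2 * dzb \<kappa> w"
    using wirtinger_mult(2)[of "\<lambda>w. 2" w "dzb \<kappa>"] wirtinger_mult(2)[of "\<lambda>w. -2" w \<kappa>]
      d[OF smooth_\<kappa>] d[OF smooth_on_wirtinger(4)[OF open_\<Omega> smooth_\<kappa>]]
    by (simp_all add: wirtinger_const)
  have 3: "d_zb (d_z N) w = (2 * dzb (dzb \<kappa>) w + \<kappa> w * cnj (c w)) *s P w + (- 2 * \<kappa> w * cnj (\<kappa> w)) *s N w"
    using wirtinger_linear_combination(2)[OF assms s1 smooth_P smooth_Pb N_z]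
    unfolding 2 Pb_def[symmetric] Pbb_def[symmetric] Pbb_structure[OF assms]
    by (simp add: vec_eq_iff algebra_simps)
  have sN: "smooth_on \<Omega> (\<lambda>w. vcnj (d_z N w))"
    by (intro smooth_on_bounded_linear[OF open_\<Omega> bounded_linear_vcnj] smooth_on_wirtinger open_\<Omega> smooth_N)
  have "d_zb N v = vcnj (d_z N v)" if "v \<in> \<Omega>" for v
    using that by (simp add: N_z N_b vcnj_simps cnj_P cnj_Pb)
  then have "d_z (d_zb N) w = d_z (\<lambda>w. vcnj (d_z N w)) w"
    by (intro wirtinger_cong(3)[OF open_\<Omega> assms sN])
  also have "\<dots> = vcnj (d_zb (d_z N) w)"
    by (intro wirtinger_vcnj d smooth_on_wirtinger open_\<Omega> smooth_N)
  finally have "d_zb (d_z N) w = vcnj (d_zb (d_z N) w)"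
    using wirtinger_commute(1)[OF open_\<Omega> smooth_N assms] by simp
  then have "lorentz (d_zb (d_z N) w) (X w) = lorentz (vcnj (d_zb (d_z N) w)) (vcnj (X w))"
    by (simp add: cnj_X[OF assms])
  then have "Im (lorentz (d_zb (d_z N) w) (X w)) = 0"
    unfolding lorentz_vcnj by (metis cnj.simps(2) neg_equal_zero)
  then show ?thesis unfolding 3 by (simp add: lorentz_linear g)
qed

end

context null_lift
begin

text \<open>The null vector in the plane of \<open>\<psi>\<close> and \<open>X\<close> that pairs with \<open>\<psi>\<close> to -1/2. With \<open>Y\<close> in place
  of \<open>X\<close> the Gram matrix of the frame is constant.\<close>

definition "Y w = X w + (\<kappa> w * cnj (\<kappa> w)) *s P w"

lemma smooth_cnj_\<kappa>: "smooth_on \<Omega> (\<lambda>w. cnj (\<kappa> w))"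
  by (rule smooth_on_bounded_linear[OF open_\<Omega> bounded_linear_cnj smooth_\<kappa>])

lemma smooth_\<kappa>\<kappa>: "smooth_on \<Omega> (\<lambda>w. \<kappa> w * cnj (\<kappa> w))"
  by (rule smooth_on_bilinear[OF open_\<Omega> bounded_bilinear_mult smooth_\<kappa> smooth_cnj_\<kappa>])

lemma smooth_Y: "smooth_on \<Omega> Y"
  unfolding Y_def[abs_def]
  by (intro smooth_on_add[OF open_\<Omega>] smooth_X smooth_P smooth_\<kappa>\<kappa>
      smooth_on_bilinear[OF open_\<Omega> bounded_bilinear_vector_scalar_mult])

lemma cnj_Y: "w \<in> \<Omega> \<Longrightarrow> vcnj (Y w) = Y w"
  by (simp add: Y_def vcnj_simps cnj_X cnj_P mult.commute)

lemma gram_Y: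
  assumes "w \<in> \<Omega>"
  shows "lorentz (Y w) (Y w) = 0" "lorentz (P w) (Y w) = - 1/2" "lorentz (Pz w) (Y w) = 0"
    "lorentz (Pb w) (Y w) = 0" "lorentz (N w) (Y w) = 0" "lorentz (Y w) (P w) = - 1/2"
    "lorentz (Y w) (Pz w) = 0" "lorentz (Y w) (Pb w) = 0" "lorentz (Y w) (N w) = 0"
  by (simp_all add: Y_def lorentz_linear gram_first_order[OF assms] gram_second_order[OF assms] gram_normal[OF assms]
      gram_sym[OF assms] XX[OF assms])

lemma X_eq_Y: "X w = Y w - (\<kappa> w * cnj (\<kappa> w)) *s P w"
  by (simp add: Y_def)

text \<open>The coefficient of \<open>\<psi>\<close> vanishes by the equation of Gauss. No derivative of \<open>c\<close> occurs in the
  structure equations of this frame.\<close>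

lemma Y_z:
  assumes "w \<in> \<Omega>"
  shows "d_z Y w = (- \<kappa> w * cnj (\<kappa> w)) *s Pz w + (- c w / 2) *s Pb w + dzb \<kappa> w *s N w"
proof -
  note d = smooth_on_differentiable[OF _ assms]
  have 1: "dz (\<lambda>w. \<kappa> w * cnj (\<kappa> w)) w = dz \<kappa> w * cnj (\<kappa> w) + \<kappa> w * cnj (dzb \<kappa> w)"
    by (simp add: wirtinger_mult[OF d[OF smooth_\<kappa>] d[OF smooth_cnj_\<kappa>]] wirtinger_cnj[OF d[OF smooth_\<kappa>]])
  have 2: "d_z Y w = dz (\<lambda>w. 1) w *s X w + 1 *s d_z X w +
     (dz (\<lambda>w. \<kappa> w * cnj (\<kappa> w)) w *s P w + (\<kappa> w * cnj (\<kappa> w)) *s d_z P w)"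
    by (rule wirtinger_linear_combination(1)[OF assms smooth_on_const smooth_\<kappa>\<kappa> smooth_X smooth_P])
       (simp add: Y_def)
  show ?thesis
    unfolding 2 1 Pz_def[symmetric] X_z_structure[OF assms] gauss[OF assms]
    by (simp add: wirtinger_const vec_eq_iff algebra_simps add_divide_distrib)
qed

text \<open>The coefficients come from the inverse of the constant Gram matrix.\<close>

lemma frame_expansion:
  assumes "w \<in> \<Omega>"
  shows "v = lorentz v (N w) *s N w + (-2 * lorentz v (Y w)) *s P w + (-2 * lorentz v (P w)) *s Y w +
    (2 * lorentz v (Pb w)) *s Pz w + (2 * lorentz v (Pz w)) *s Pb w"
  by (rule eq_by_pairing[OF assms])
     (simp_all add: lorentz_linear gram_first_order[OF assms] gram_second_order[OF assms] gram_normal[OF assms]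
      gram_sym[OF assms] gram_Y[OF assms] X_eq_Y[of w])

lemma restrict: "open S \<Longrightarrow> S \<subseteq> \<Omega> \<Longrightarrow> null_lift S \<psi>"
  using smooth_on_subset[OF smooth_\<psi>] null isometric unfolding null_lift_def by blast

end

section \<open>Two surfaces with the same Hopf differential\<close>

locale hopf_pair = A: null_lift \<Omega> \<psi> + B: null_lift \<Omega> \<psi>'
  for \<Omega> :: "complex set" and \<psi> \<psi>' :: "complex \<Rightarrow> real ^ 4 option" +
  assumes same_hopf: "w \<in> \<Omega> \<Longrightarrow> A.\<kappa> w = B.\<kappa> w"
begin

definition "D w = A.c w - B.c w"

lemma smooth_D: "smooth_on \<Omega> D"
proof -
  have "smooth_on \<Omega> (\<lambda>w. A.c w + (- 1) * B.c w)"
    by (intro smooth_on_add[OF A.open_\<Omega>] A.smooth_c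
        smooth_on_bounded_linear[OF A.open_\<Omega> bounded_linear_mult_right B.smooth_c])
  then show ?thesis by (simp add: D_def[abs_def])
qed

lemma dzb_\<kappa>_eq:
  assumes "w \<in> \<Omega>"
  shows "dzb A.\<kappa> w = dzb B.\<kappa> w" "dz A.\<kappa> w = dz B.\<kappa> w" "dzb (dzb A.\<kappa>) w = dzb (dzb B.\<kappa>) w"
proof -
  have 1: "dzb A.\<kappa> w = dzb B.\<kappa> w" "dz A.\<kappa> w = dz B.\<kappa> w" if "w \<in> \<Omega>" for w
    by (rule wirtinger_cong(1,2)[OF A.open_\<Omega> that B.smooth_\<kappa>], simp add: same_hopf)+
  show "dzb A.\<kappa> w = dzb B.\<kappa> w" "dz A.\<kappa> w = dz B.\<kappa> w"
    using 1[OF assms] by simp_all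
  show "dzb (dzb A.\<kappa>) w = dzb (dzb B.\<kappa>) w"
    by (rule wirtinger_cong(2)[OF A.open_\<Omega> assms smooth_on_wirtinger(4)[OF A.open_\<Omega> B.smooth_\<kappa>]])
       (rule 1)
qed

text \<open>By the equation of Gauss both Schwarzians have the same \<open>zbar\<close>-derivative.\<close>

lemma holomorphic_D: "D holomorphic_on \<Omega>"
proof (rule dzb_zero_imp_holomorphic[OF A.open_\<Omega> smooth_D])
  fix w assume w: "w \<in> \<Omega>"
  note d = smooth_on_differentiable[OF _ w]
  have D: "D = (\<lambda>w. A.c w + (- 1) * B.c w)" by (auto simp: D_def)
  have "(\<lambda>w. (- 1) * B.c w) differentiable (at w)"
    by (intro d smooth_on_bounded_linear[OF A.open_\<Omega> bounded_linear_mult_right B.smooth_c])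
  then have "dzb D w = dzb A.c w + dzb (\<lambda>w. (- 1) * B.c w) w"
    unfolding D using d[OF A.smooth_c] by (intro wirtinger_scalar_add)
  also have "dzb (\<lambda>w. (- 1) * B.c w) w = - dzb B.c w"
    using wirtinger_mult(2)[OF differentiable_const d[OF B.smooth_c], of "-1"]
    by (simp add: wirtinger_const)
  also have "dzb A.c w + - dzb B.c w = 0"
    unfolding A.gauss[OF w] B.gauss[OF w] same_hopf[OF w] dzb_\<kappa>_eq[OF w] by simp
  finally show "dzb D w = 0" .
qed

text \<open>The difference of the two equations of Codazzi: the terms with derivatives of \<open>\<kappa>\<close> cancel.\<close>

lemma hopf_D_real: "w \<in> \<Omega> \<Longrightarrow> Im (A.\<kappa> w * cnj (D w)) = 0"
  using A.codazzi[of w] B.codazzi[of w] dzb_\<kappa>_eq[of w] same_hopf[of w]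
  by (simp add: D_def algebra_simps)

text \<open>The linear map that carries the frame of the first surface at \<open>w\<close> to that of the second,
  written by means of the dual basis. Its derivative can be computed without inverting matrices.\<close>

definition frame_transport :: "complex \<Rightarrow> complex ^ 4 option \<Rightarrow> complex ^ 4 option" where
  "frame_transport w v = lorentz v (A.N w) *s B.N w + (lorentz v (A.Y w) *s ((-2) *s B.P w)
    + (lorentz v (A.P w) *s ((-2) *s B.Y w) + (lorentz v (A.Pb w) *s (2 *s B.Pz w)
    + lorentz v (A.Pz w) *s (2 *s B.Pb w))))"

lemma smooth_transport_term:
  fixes E F :: "complex \<Rightarrow> complex ^ 4 option"
  shows "smooth_on \<Omega> E \<Longrightarrow> smooth_on \<Omega> F \<Longrightarrow> smooth_on \<Omega> (\<lambda>w. lorentz v (E w) *s F w)"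
  by (intro smooth_on_bilinear[OF A.open_\<Omega> bounded_bilinear_vector_scalar_mult]
      smooth_on_bilinear[OF A.open_\<Omega> bounded_bilinear_lorentz] smooth_on_const)

lemma transport_term_z:
  fixes E F :: "complex \<Rightarrow> complex ^ 4 option"
  assumes "w \<in> \<Omega>" "smooth_on \<Omega> E" "smooth_on \<Omega> F"
  shows "d_z (\<lambda>w. lorentz v (E w) *s F w) w = lorentz v (d_z E w) *s F w + lorentz v (E w) *s d_z F w"
proof -
  note d = smooth_on_differentiable[OF _ assms(1)]
  have l: "(\<lambda>w. lorentz v (E w)) differentiable (at w)"
    by (intro d smooth_on_bilinear[OF A.open_\<Omega> bounded_bilinear_lorentz] smooth_on_const assms)
  have "d_z (\<lambda>w. v) w = 0" by (simp add: d_z_def d_xy_const)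
  then show ?thesis
    by (simp add: wirtinger_scale(1)[OF l d[OF assms(3)]]
        wirtinger_lorentz(1)[OF smooth_on_differentiable[OF smooth_on_const assms(1)] d[OF assms(2)]]
        lorentz_zero)
qed

lemma d_z_const_scale:
  assumes "w \<in> \<Omega>" "smooth_on \<Omega> F"
  shows "d_z (\<lambda>w. a *s F w) w = a *s d_z F w"
  using wirtinger_scale(1)[OF differentiable_const smooth_on_differentiable[OF assms(2,1)]]
  by (simp add: wirtinger_const)

lemma smooth_const_scale: "smooth_on \<Omega> F \<Longrightarrow> smooth_on \<Omega> (\<lambda>w. a *s F w)"
  for F :: "complex \<Rightarrow> complex ^ 'n"
  by (rule smooth_on_bounded_linear[OF A.open_\<Omega> bounded_linear_vector_scalar_mult_right])

lemmas smooth_terms = 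
  smooth_transport_term[OF A.smooth_N B.smooth_N]
  smooth_transport_term[OF A.smooth_Y smooth_const_scale[OF B.smooth_P]]
  smooth_transport_term[OF A.smooth_P smooth_const_scale[OF B.smooth_Y]]
  smooth_transport_term[OF A.smooth_Pb smooth_const_scale[OF B.smooth_Pz]]
  smooth_transport_term[OF A.smooth_Pz smooth_const_scale[OF B.smooth_Pb]]

lemma smooth_transport: "smooth_on \<Omega> (\<lambda>w. frame_transport w v)"
  unfolding frame_transport_def by (intro smooth_on_add[OF A.open_\<Omega>] smooth_terms)

text \<open>If also the Schwarzians agree, both frames satisfy the same linear structure equations, which
  are skew with respect to the common Gram matrix; the contributions of the two frames cancel.\<close>

lemma transport_z:
  assumes "w \<in> \<Omega>" "D w = 0"
  shows "d_z (\<lambda>w. frame_transport w v) w = 0"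
proof -
  note w = assms(1)
  note d = smooth_on_differentiable[OF _ w]
  note sa = smooth_on_add[OF A.open_\<Omega>]
  note t = smooth_terms[where v = v]
  have "d_z (\<lambda>w. frame_transport w v) w =
     d_z (\<lambda>w. lorentz v (A.N w) *s B.N w) w + (d_z (\<lambda>w. lorentz v (A.Y w) *s ((-2) *s B.P w)) w
    + (d_z (\<lambda>w. lorentz v (A.P w) *s ((-2) *s B.Y w)) w + (d_z (\<lambda>w. lorentz v (A.Pb w) *s (2 *s B.Pz w)) w
    + d_z (\<lambda>w. lorentz v (A.Pz w) *s (2 *s B.Pb w)) w)))"
    unfolding frame_transport_def
    by (subst wirtinger_add(1)[OF d d], (intro sa t)+)+ (rule refl)
  also have "\<dots> = 0"
    unfolding transport_term_z[OF w A.smooth_N B.smooth_N]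
      transport_term_z[OF w A.smooth_Y smooth_const_scale[OF B.smooth_P]]
      transport_term_z[OF w A.smooth_P smooth_const_scale[OF B.smooth_Y]]
      transport_term_z[OF w A.smooth_Pb smooth_const_scale[OF B.smooth_Pz]]
      transport_term_z[OF w A.smooth_Pz smooth_const_scale[OF B.smooth_Pb]]
      d_z_const_scale[OF w B.smooth_P] d_z_const_scale[OF w B.smooth_Y]
      d_z_const_scale[OF w B.smooth_Pz] d_z_const_scale[OF w B.smooth_Pb]
      A.N_z[OF w] B.N_z[OF w] A.Y_z[OF w] B.Y_z[OF w]
      A.Pz_def[symmetric] B.Pz_def[symmetric] A.X_def[symmetric] B.X_def[symmetric]
      A.Pzz_def[symmetric] B.Pzz_def[symmetric] A.Pzz_structure[OF w] B.Pzz_structure[OF w]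
      A.X_eq_Y B.X_eq_Y
    using assms(2) by (simp add: D_def same_hopf[OF w] dzb_\<kappa>_eq[OF w] lorentz_linear vec_eq_iff algebra_simps)
  finally show ?thesis .
qed

lemma transport_real:
  assumes "w \<in> \<Omega>" "vcnj v = v"
  shows "vcnj (frame_transport w v) = frame_transport w v"
proof -
  have c: "cnj (lorentz v u) = lorentz v (vcnj u)" for u
    using lorentz_vcnj[of v u] assms(2) by simp
  show ?thesis
    by (simp add: frame_transport_def vcnj_simps c A.cnj_N B.cnj_N A.cnj_P B.cnj_P A.cnj_Y[OF assms(1)]
       B.cnj_Y[OF assms(1)] A.cnj_Pz[OF assms(1)] A.cnj_Pb[OF assms(1)]
       B.cnj_Pz[OF assms(1)] B.cnj_Pb[OF assms(1)] add_ac)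
qed

lemma transport_constant:
  assumes "convex \<Omega>" "\<And>w. w \<in> \<Omega> \<Longrightarrow> D w = 0" "vcnj v = v" "w \<in> \<Omega>" "w' \<in> \<Omega>"
  shows "frame_transport w v = frame_transport w' v"
proof -
  let ?T = "\<lambda>w. frame_transport w v"
  have "(?T has_derivative (\<lambda>h. 0)) (at u)" if u: "u \<in> \<Omega>" for u
  proof -
    have z: "d_z ?T u = 0" by (rule transport_z[OF u assms(2)[OF u]])
    \<comment> \<open>The transport of a real vector is real, so its second Wirtinger derivative is the conjugate of the first.\<close>
    have "d_zb ?T u = d_zb (\<lambda>w. vcnj (?T w)) u"
      by (rule wirtinger_cong(4)[OF A.open_\<Omega> u])
         (auto simp: transport_real assms(3) intro!: smooth_transport
           smooth_on_bounded_linear[OF A.open_\<Omega> bounded_linear_vcnj])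
    also have "\<dots> = vcnj (d_z ?T u)"
      by (rule wirtinger_vcnj(2)[OF smooth_on_differentiable[OF smooth_transport u]])
    finally have zb: "d_zb ?T u = 0" by (simp add: z vcnj_def vec_eq_iff)
    have x: "d_x ?T u = d_z ?T u + d_zb ?T u" "d_y ?T u = \<i> *s (d_z ?T u - d_zb ?T u)"
      unfolding d_z_def d_zb_def by (simp_all add: vec_eq_iff field_simps)
    have lin: "linear (frechet_derivative ?T (at u))"
      using smooth_on_differentiable[OF smooth_transport u] linear_frechet_derivative by blast
    have "frechet_derivative ?T (at u) h = 0" for h
    proof -
      have "frechet_derivative ?T (at u) (Re h *\<^sub>R 1 + Im h *\<^sub>R \<i>) = Re h *\<^sub>R d_x ?T u + Im h *\<^sub>R d_y ?T u"
        using lin by (simp only: linear_add linear_scale d_x_def d_y_def)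
      moreover have "Re h *\<^sub>R 1 + Im h *\<^sub>R \<i> = h" by (simp add: complex_eq_iff)
      ultimately show ?thesis by (simp add: x z zb)
    qed
    then have "frechet_derivative ?T (at u) = (\<lambda>h. 0)" by auto
    then show ?thesis
      using smooth_on_has_derivative[OF smooth_transport u, of v] by simp
  qed
  then have "\<exists>C. \<forall>u\<in>\<Omega>. ?T u = C"
    using has_derivative_zero_constant[OF assms(1), of ?T] has_derivative_at_withinI by blast
  then show ?thesis using assms(4,5) by auto
qed

text \<open>Both frames have the same Gram matrix.\<close>

lemma lorentz_transport:
  assumes "w \<in> \<Omega>"
  shows "lorentz (frame_transport w u) (frame_transport w v) = lorentz u v"
proof -
  note gB = B.gram_first_order[OF assms] B.gram_second_order[OF assms] B.gram_normal[OF assms] B.gram_sym[OF assms] B.gram_Y[OF assms]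
  have "lorentz v u = lorentz u (A.N w) * lorentz v (A.N w) + (-2 * lorentz u (A.Y w)) * lorentz v (A.P w)
     + (-2 * lorentz u (A.P w)) * lorentz v (A.Y w) +
    (2 * lorentz u (A.Pb w)) * lorentz v (A.Pz w) + (2 * lorentz u (A.Pz w)) * lorentz v (A.Pb w)"
    by (subst A.frame_expansion[OF assms, of u]) (simp add: lorentz_linear)
  also have "\<dots> = lorentz (frame_transport w u) (frame_transport w v)"
    unfolding frame_transport_def lorentz_linear gB by (simp only: mult_zero_left mult_zero_right add_0_left add_0_right mult_1_right) simp
  finally show ?thesis by (simp only: lorentz_commute[of u v])
qed

lemma transport_frame:
  assumes "w \<in> \<Omega>"
  shows "frame_transport w (A.P w) = B.P w" "frame_transport w (A.Pz w) = B.Pz w"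
    "frame_transport w (A.Pb w) = B.Pb w" "frame_transport w (A.N w) = B.N w"
    "frame_transport w (A.X w) = B.X w"
  by (simp_all add: frame_transport_def A.gram_first_order[OF assms] A.gram_second_order[OF assms] A.gram_normal[OF assms]
      A.gram_sym[OF assms] A.gram_Y[OF assms] vec_eq_iff A.X_eq_Y B.X_eq_Y same_hopf[OF assms] lorentz_linear)

lemma transport_linear:
  "frame_transport w (u + v) = frame_transport w u + frame_transport w v"
  "frame_transport w (u - v) = frame_transport w u - frame_transport w v"
  "frame_transport w (a *s v) = a *s frame_transport w v"
  by (simp_all add: frame_transport_def lorentz_linear vec_eq_iff algebra_simps)

end

text \<open>For a totally umbilic surface the hyperplane \<open>V\<close> is constant, and the reflection in it fixes
  the surface. The sign of the determinant excludes this reflection and makes the congruence unique.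
  Time reversing maps are admitted.\<close>

definition proper_lorentz :: "(real ^ 4 option \<Rightarrow> real ^ 4 option) \<Rightarrow> bool" where
  "proper_lorentz L \<longleftrightarrow> lorentz_transformation L \<and> det (matrix L) > 0"

lemma det_frame_image:
  assumes "linear L"
  shows "det (frame_matrix (L x) (L p) (L a) (L b) (L n)) = det (matrix L) * det (frame_matrix x p a b n)"
proof -
  have row: "(F ** transpose (matrix L)) $ i = L (F $ i)" for F :: "real ^ 4 option ^ 4 option" and i
    unfolding matrix_vector_mul(2)[OF assms, THEN fun_cong, of "F $ i", symmetric]
    by (simp add: vec_eq_iff matrix_matrix_mult_def matrix_vector_mult_def transpose_def mult.commute)
  have "\<forall>i. frame_matrix (L x) (L p) (L a) (L b) (L n) $ i = (frame_matrix x p a b n ** transpose (matrix L)) $ i"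
    unfolding row forall_option_4 frame_matrix_nth by simp
  then have "frame_matrix (L x) (L p) (L a) (L b) (L n) = frame_matrix x p a b n ** transpose (matrix L)"
    unfolding vec_eq_iff[of "frame_matrix (L x) (L p) (L a) (L b) (L n)"] .
  then show ?thesis by (simp add: det_mul det_transpose)
qed

context hopf_pair
begin

text \<open>The transport is constant; both frames are positively oriented, so it has positive
  determinant.\<close>

lemma local_congruence:
  assumes "convex \<Omega>" "\<Omega> \<noteq> {}" "\<And>w. w \<in> \<Omega> \<Longrightarrow> D w = 0"
  shows "\<exists>L. proper_lorentz L \<and> (\<forall>w\<in>\<Omega>. L (\<psi> w) = \<psi>' w)"
proof -
  obtain w0 where w0: "w0 \<in> \<Omega>" using assms(2) by blast
  define L where "L u = vec_lambda (\<lambda>i. Re (frame_transport w0 (complexify u) $ i))" for u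
  have L: "complexify (L u) = frame_transport w0 (complexify u)" for u
  proof -
    have "vcnj (frame_transport w0 (complexify u)) = frame_transport w0 (complexify u)"
      by (rule transport_real[OF w0]) (simp add: vcnj_simps)
    then have "Im (frame_transport w0 (complexify u) $ i) = 0" for i
      by (metis Reals_cnj_iff complex_is_Real_iff vcnj_def vec_lambda_beta)
    then show ?thesis by (simp add: L_def complexify_def vec_eq_iff complex_eq_iff)
  qed
  have inj: "complexify u = complexify v \<longleftrightarrow> u = v" for u v :: "real ^ 4 option"
    by (simp add: complexify_def vec_eq_iff)
  have lin: "linear L"
    by (rule linearI) (simp_all only: inj[symmetric] L complexify_linear transport_linear)
  have lor: "lorentz (L u) (L v) = lorentz u v" for u v
  proof -
    have "complex_of_real (lorentz (L u) (L v)) = complex_of_real (lorentz u v)"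
      unfolding lorentz_complexify[symmetric] L lorentz_transport[OF w0] ..
    then show ?thesis by simp
  qed
  have frame: "L (\<psi> w0) = \<psi>' w0" "L (d_x \<psi> w0) = d_x \<psi>' w0" "L (d_y \<psi> w0) = d_y \<psi>' w0"
     "L (d_zzbar \<psi> w0) = d_zzbar \<psi>' w0" "L (unit_normal \<psi> w0) = unit_normal \<psi>' w0"
    unfolding inj[symmetric] L A.dx_eq[OF w0] B.dx_eq[OF w0] A.X_eq(2)[OF w0, symmetric]
      B.X_eq(2)[OF w0, symmetric] A.P_def[symmetric] B.P_def[symmetric] A.N_def[symmetric] B.N_def[symmetric]
      transport_linear transport_frame[OF w0]
    by (rule refl)+
  have "det (matrix L) > 0"
    using B.det_frame[OF w0] A.det_frame[OF w0]
    unfolding frame[symmetric] det_frame_image[OF lin] by (simp add: zero_less_mult_iff)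
  moreover have "L (\<psi> w) = \<psi>' w" if w: "w \<in> \<Omega>" for w
  proof -
    have "complexify (L (\<psi> w)) = frame_transport w (A.P w)"
      unfolding L A.P_def
      by (rule transport_constant[OF assms(1,3) _ w0 w]) (simp_all add: vcnj_simps)
    then show ?thesis by (simp add: transport_frame[OF w] B.P_def inj)
  qed
  ultimately show ?thesis
    using lin lor unfolding proper_lorentz_def lorentz_transformation_def by blast
qed

end

section \<open>Rigidity\<close>

lemma lorentz_transformation_linear: "lorentz_transformation L \<Longrightarrow> linear L"
  and lorentz_transformation_lorentz: "lorentz_transformation L \<Longrightarrow> lorentz (L u) (L v) = lorentz u v"
  by (simp_all add: lorentz_transformation_def)

context null_lift
begin

text \<open>The notions derived from a normalized lift are natural under Lorentz transformations.\<close>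

lemma lorentz_image:
  assumes "lorentz_transformation L"
  shows "null_lift \<Omega> (\<lambda>w. L (\<psi> w))"
    and "w \<in> \<Omega> \<Longrightarrow> d_x (\<lambda>w. L (\<psi> w)) w = L (d_x \<psi> w)"
    and "w \<in> \<Omega> \<Longrightarrow> d_y (\<lambda>w. L (\<psi> w)) w = L (d_y \<psi> w)"
    and "w \<in> \<Omega> \<Longrightarrow> d_zzbar (\<lambda>w. L (\<psi> w)) w = L (d_zzbar \<psi> w)"
proof -
  have lin: "linear L" and bl: "bounded_linear L"
    using lorentz_transformation_linear[OF assms] linear_conv_bounded_linear by blast+
  note d\<psi> = smooth_on_differentiable[OF smooth_\<psi>]
  show "null_lift \<Omega> (\<lambda>w. L (\<psi> w))"
  proof
    show "smooth_on \<Omega> (\<lambda>w. L (\<psi> w))"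
      by (rule smooth_on_bounded_linear[OF open_\<Omega> bl smooth_\<psi>])
  qed (simp_all add: open_\<Omega> null isometric lorentz_transformation_lorentz[OF assms]
       frechet_derivative_bounded_linear[OF d\<psi> bl])
  show 1: "d_x (\<lambda>w. L (\<psi> w)) w = L (d_x \<psi> w)" "d_y (\<lambda>w. L (\<psi> w)) w = L (d_y \<psi> w)"
    if "w \<in> \<Omega>" for w
    by (rule d_xy_bounded_linear[OF bl d\<psi>[OF that]])+
  show "d_zzbar (\<lambda>w. L (\<psi> w)) w = L (d_zzbar \<psi> w)" if w: "w \<in> \<Omega>"
  proof -
    note sm = smooth_on_d_x[OF smooth_\<psi>] smooth_on_d_y[OF smooth_\<psi>]
    have "d_x (d_x (\<lambda>w. L (\<psi> w))) w = L (d_x (d_x \<psi>) w)"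
      using d_xy_cong(1)[OF open_\<Omega> w smooth_on_bounded_linear[OF open_\<Omega> bl sm(1)], of "d_x (\<lambda>w. L (\<psi> w))"]
        1 d_xy_bounded_linear(1)[OF bl smooth_on_differentiable[OF sm(1) w]] by simp
    moreover have "d_y (d_y (\<lambda>w. L (\<psi> w))) w = L (d_y (d_y \<psi>) w)"
      using d_xy_cong(2)[OF open_\<Omega> w smooth_on_bounded_linear[OF open_\<Omega> bl sm(2)], of "d_y (\<lambda>w. L (\<psi> w))"]
        1 d_xy_bounded_linear(2)[OF bl smooth_on_differentiable[OF sm(2) w]] by simp
    ultimately show ?thesis
      unfolding d_zzbar_def using lin by (simp add: linear_add linear_scale)
  qed
qed

lemma unit_normal_image:
  assumes "proper_lorentz L" "w \<in> \<Omega>"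
  shows "unit_normal (\<lambda>w. L (\<psi> w)) w = L (unit_normal \<psi> w)"
proof -
  have L: "lorentz_transformation L" "det (matrix L) > 0"
    using assms(1) by (simp_all add: proper_lorentz_def)
  interpret I: null_lift \<Omega> "\<lambda>w. L (\<psi> w)" by (rule lorentz_image(1)[OF L(1)])
  note nn = unit_normal[OF assms(2), unfolded is_unit_normal_iff[OF assms(2)]
      adapted_frame.is_normal_def[OF frame[OF assms(2)]]]
  have "is_unit_normal (\<lambda>w. L (\<psi> w)) w (L (unit_normal \<psi> w))"
    unfolding I.is_unit_normal_iff[OF assms(2)] lorentz_image(2-)[OF L(1) assms(2)]
      adapted_frame.is_normal_def[OF I.frame[OF assms(2), unfolded lorentz_image(2-)[OF L(1) assms(2)]]]
      lorentz_transformation_lorentz[OF L(1)]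
      det_frame_image[OF lorentz_transformation_linear[OF L(1)]]
    using nn L(2) by simp
  then show ?thesis
    using I.unit_normal_ex1[OF assms(2)] I.unit_normal[OF assms(2)] by blast
qed

text \<open>The factor is 1 because both images are normalized lifts. Hence the two maps agree on the lift,
  on all its derivatives and, having positive determinant, on the unit normal; these vectors form a
  basis.\<close>

lemma rigidity:
  assumes L: "proper_lorentz L" and M: "proper_lorentz M" and "\<Omega> \<noteq> {}"
    and "\<And>w. w \<in> \<Omega> \<Longrightarrow> \<exists>r>0. L (\<psi> w) = r *\<^sub>R M (\<psi> w)"
  shows "L = M"
proof -
  have L': "lorentz_transformation L" "linear L" and M': "lorentz_transformation M" "linear M"
    using L M by (simp_all add: proper_lorentz_def lorentz_transformation_def)
  interpret l: null_lift \<Omega> "\<lambda>w. L (\<psi> w)" by (rule lorentz_image(1)[OF L'(1)])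
  interpret m: null_lift \<Omega> "\<lambda>w. M (\<psi> w)" by (rule lorentz_image(1)[OF M'(1)])
  have eq: "L (\<psi> w) = M (\<psi> w)" if w: "w \<in> \<Omega>" for w
  proof -
    have pos0: "M (\<psi> u) $ None \<noteq> 0" if "u \<in> \<Omega>" for u
    proof
      assume 0: "M (\<psi> u) $ None = 0"
      then have "(\<Sum>k\<in>UNIV. M (\<psi> u) $ Some k * M (\<psi> u) $ Some k) = 0"
        using m.null[OF that] by (simp add: lorentz_def)
      then have "M (\<psi> u) = 0"
        using 0 by (simp add: sum_nonneg_eq_0_iff vec_eq_iff split_option_all)
      then show False
        using adapted_frame.px[OF m.frame[OF that]] by (simp add: lorentz_zero)
    qed
    define r where "r u = L (\<psi> u) $ None / M (\<psi> u) $ None" for u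
    have r: "r u > 0" "L (\<psi> u) = r u *\<^sub>R M (\<psi> u)" if u: "u \<in> \<Omega>" for u
    proof -
      obtain s where "s > 0" "L (\<psi> u) = s *\<^sub>R M (\<psi> u)" using assms(4)[OF u] by blast
      moreover from this have "r u = s" using pos0[OF u] by (simp add: r_def)
      ultimately show "r u > 0" "L (\<psi> u) = r u *\<^sub>R M (\<psi> u)" by simp_all
    qed
    have "(\<lambda>u. L (\<psi> u) $ None) differentiable (at w)" "(\<lambda>u. M (\<psi> u) $ None) differentiable (at w)"
      by (intro smooth_on_differentiable[OF _ w] smooth_on_vec_nth open_\<Omega> l.smooth_\<psi> m.smooth_\<psi>)+
    then have dr: "r differentiable (at w)"
      unfolding r_def[abs_def] using pos0[OF w] by (intro differentiable_divide)
    have dm: "(\<lambda>w. M (\<psi> w)) differentiable (at w)"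
      by (rule smooth_on_differentiable[OF m.smooth_\<psi> w])
    have "d_x (\<lambda>w. L (\<psi> w)) w = d_x (\<lambda>u. r u *\<^sub>R M (\<psi> u)) w"
      by (rule d_xy_cong(1)[OF open_\<Omega> w l.smooth_\<psi>, symmetric]) (simp add: r)
    also have "\<dots> = d_x r w *\<^sub>R M (\<psi> w) + r w *\<^sub>R d_x (\<lambda>u. M (\<psi> u)) w"
      by (rule d_xy_bilinear(1)[OF bounded_bilinear_scaleR dr dm])
    finally have "1 = lorentz (d_x r w *\<^sub>R M (\<psi> w) + r w *\<^sub>R d_x (\<lambda>u. M (\<psi> u)) w)
       (d_x r w *\<^sub>R M (\<psi> w) + r w *\<^sub>R d_x (\<lambda>u. M (\<psi> u)) w)"
      using l.real_gram(1)[OF w] by simp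
    then have "(r w)\<^sup>2 = 1"
      by (simp add: lorentz_linear adapted_frame.gram_simps[OF m.frame[OF w]] power2_eq_square)
    then have "r w = 1" using r(1)[OF w] by (simp add: power2_eq_1_iff)
    then show ?thesis using r(2)[OF w] by simp
  qed
  obtain w where w: "w \<in> \<Omega>" using assms(3) by blast
  have c: "d_x (\<lambda>w. L (\<psi> w)) w = d_x (\<lambda>w. M (\<psi> w)) w" "d_y (\<lambda>w. L (\<psi> w)) w = d_y (\<lambda>w. M (\<psi> w)) w"
    if "w \<in> \<Omega>" for w
    by (rule d_xy_cong[OF open_\<Omega> that m.smooth_\<psi>], simp add: eq)+
  have c2: "d_x (d_x (\<lambda>w. L (\<psi> w))) w = d_x (d_x (\<lambda>w. M (\<psi> w))) w"
     "d_y (d_y (\<lambda>w. L (\<psi> w))) w = d_y (d_y (\<lambda>w. M (\<psi> w))) w"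
    by (rule d_xy_cong[OF open_\<Omega> w], simp_all add: c smooth_on_d_x smooth_on_d_y m.smooth_\<psi>)+
  have c3: "d_zzbar (\<lambda>w. L (\<psi> w)) w = d_zzbar (\<lambda>w. M (\<psi> w)) w"
    unfolding d_zzbar_def c2 ..
  have "is_unit_normal (\<lambda>w. L (\<psi> w)) w n \<longleftrightarrow> is_unit_normal (\<lambda>w. M (\<psi> w)) w n" for n
    unfolding l.is_unit_normal_iff[OF w] m.is_unit_normal_iff[OF w] c[OF w] c3 eq[OF w] ..
  then have c4: "unit_normal (\<lambda>w. L (\<psi> w)) w = unit_normal (\<lambda>w. M (\<psi> w)) w"
    by (simp add: unit_normal_def)
  have agree: "L (\<psi> w) = M (\<psi> w)" "L (d_x \<psi> w) = M (d_x \<psi> w)" "L (d_y \<psi> w) = M (d_y \<psi> w)"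
    "L (d_zzbar \<psi> w) = M (d_zzbar \<psi> w)" "L (unit_normal \<psi> w) = M (unit_normal \<psi> w)"
    using eq[OF w] c[OF w] c3 c4 unfolding lorentz_image(2-)[OF L'(1) w] lorentz_image(2-)[OF M'(1) w]
      unit_normal_image[OF L w] unit_normal_image[OF M w] by simp_all
  show "L = M"
  proof
    fix v
    have pair: "lorentz (L v - M v) (L u) = 0" if "L u = M u" for u
      using lorentz_transformation_lorentz[OF L'(1), of v u] lorentz_transformation_lorentz[OF M'(1), of v u] that
      by (simp add: lorentz_linear)
    have "det (frame_matrix (L (d_zzbar \<psi> w)) (L (\<psi> w)) (L (d_x \<psi> w)) (L (d_y \<psi> w)) (L (unit_normal \<psi> w))) > 0"
      unfolding det_frame_image[OF L'(2)] using L det_frame[OF w] by (simp add: proper_lorentz_def)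
    then have "L v - M v = 0"
      by (rule frame_nondegenerate[OF less_imp_neq[THEN not_sym] pair pair pair pair pair])
         (rule agree)+
    then show "L v = M v" by simp
  qed
qed

end

section \<open>Normalized lifts\<close>

text \<open>The linear part of the affine map \<open>light_vector\<close>.\<close>

definition space_embedding :: "real ^ 4 \<Rightarrow> real ^ 4 option" where
  "space_embedding x = (\<chi> i. case i of None \<Rightarrow> 0 | Some k \<Rightarrow> x $ k)"

lemma bounded_linear_space_embedding: "bounded_linear space_embedding"
  unfolding linear_conv_bounded_linear[symmetric]
  by (auto intro!: linearI simp: space_embedding_def vec_eq_iff split_option_all)

lemma light_vector_eq: "light_vector x = space_embedding x + light_vector 0"
  by (simp add: light_vector_def space_embedding_def vec_eq_iff split_option_all)

lemma light_vector_None: "light_vector x $ None = 1"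
  by (simp add: light_vector_def)

lemma lorentz_light_vector:
  "lorentz (light_vector x) (light_vector y) = x \<bullet> y - 1"
  "lorentz (light_vector x) (space_embedding y) = x \<bullet> y"
  "lorentz (space_embedding x) (space_embedding y) = x \<bullet> y"
  by (simp_all add: lorentz_def light_vector_def space_embedding_def inner_vec_def)

locale surface_patch =
  fixes \<Omega> :: "complex set" and g :: "complex \<Rightarrow> real ^ 4"
  assumes open_\<Omega>: "open \<Omega>" and smooth_g: "smooth_on \<Omega> g"
    and sphere: "w \<in> \<Omega> \<Longrightarrow> g w \<in> S3"
    and conformal: "w \<in> \<Omega> \<Longrightarrow> \<exists>\<rho>>0. \<forall>u v.
      frechet_derivative g (at w) u \<bullet> frechet_derivative g (at w) v = \<rho> * (u \<bullet> v)"
begin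

lemma inner_self: "w \<in> \<Omega> \<Longrightarrow> g w \<bullet> g w = 1"
  using sphere[of w] by (simp add: norm_eq_1)

lemma conformal_factor:
  assumes "w \<in> \<Omega>"
  shows "frechet_derivative g (at w) u \<bullet> frechet_derivative g (at w) v = (norm (d_x g w))\<^sup>2 * (u \<bullet> v)"
    "norm (d_x g w) > 0"
proof -
  obtain \<rho> where \<rho>: "\<rho> > 0" "\<And>u v. frechet_derivative g (at w) u \<bullet> frechet_derivative g (at w) v = \<rho> * (u \<bullet> v)"
    using conformal[OF assms] by blast
  have "(norm (d_x g w))\<^sup>2 = \<rho>"
    using \<rho>(2)[of 1 1] by (simp add: d_x_def power2_norm_eq_inner)
  then show "frechet_derivative g (at w) u \<bullet> frechet_derivative g (at w) v = (norm (d_x g w))\<^sup>2 * (u \<bullet> v)"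
    "norm (d_x g w) > 0"
    using \<rho> by auto
qed

lemma g_orthogonal: assumes "w \<in> \<Omega>" shows "g w \<bullet> frechet_derivative g (at w) v = 0"
proof -
  note dg = smooth_on_has_derivative[OF smooth_g assms]
  have "((\<lambda>u. g u \<bullet> g u) has_derivative (\<lambda>v. g w \<bullet> frechet_derivative g (at w) v + frechet_derivative g (at w) v \<bullet> g w)) (at w)"
    by (rule has_derivative_inner[OF dg dg])
  moreover have "((\<lambda>u. g u \<bullet> g u) has_derivative (\<lambda>v. 0)) (at w)"
    by (rule has_derivative_transform_within_open[OF has_derivative_const[of 1] open_\<Omega> assms])
       (simp add: inner_self)
  ultimately have "(\<lambda>v. g w \<bullet> frechet_derivative g (at w) v + frechet_derivative g (at w) v \<bullet> g w) = (\<lambda>v. 0)"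
    by (rule has_derivative_unique)
  from fun_cong[OF this, of v] show ?thesis by (simp add: inner_commute)
qed

lemma frechet_scaled_light:
  assumes "w \<in> \<Omega>" "smooth_on \<Omega> r"
  shows "frechet_derivative (\<lambda>u. r u *\<^sub>R light_vector (g u)) (at w) v =
    r w *\<^sub>R space_embedding (frechet_derivative g (at w) v) + frechet_derivative r (at w) v *\<^sub>R light_vector (g w)"
proof -
  have "((\<lambda>u. space_embedding (g u) + light_vector 0) has_derivative
      (\<lambda>v. space_embedding (frechet_derivative g (at w) v))) (at w)"
    using has_derivative_add[OF bounded_linear.has_derivative[OF bounded_linear_space_embedding
       smooth_on_has_derivative[OF smooth_g assms(1)]] has_derivative_const] by simp
  then have "((\<lambda>u. light_vector (g u)) has_derivative
      (\<lambda>v. space_embedding (frechet_derivative g (at w) v))) (at w)"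
    unfolding light_vector_eq[of "g _"] .
  from has_derivative_scaleR[OF smooth_on_has_derivative[OF assms(2,1)] this]
  show ?thesis by (rule frechet_derivative_at[symmetric, THEN fun_cong])
qed

text \<open>A null lift scales the metric: the derivative of the factor multiplies a null vector that is
  orthogonal to the derivative of the lift.\<close>

lemma lorentz_scaled_light:
  assumes "w \<in> \<Omega>" "smooth_on \<Omega> r"
  shows "lorentz (frechet_derivative (\<lambda>u. r u *\<^sub>R light_vector (g u)) (at w) v)
      (frechet_derivative (\<lambda>u. r u *\<^sub>R light_vector (g u)) (at w) v) = (r w * norm (d_x g w) * norm v)\<^sup>2"
  unfolding frechet_scaled_light[OF assms]
  by (simp add: lorentz_linear lorentz_light_vector inner_self[OF assms(1)] g_orthogonal[OF assms(1)]
      conformal_factor(1)[OF assms(1)] lorentz_commute[of "space_embedding _" "light_vector _"]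
      power_mult_distrib power2_norm_eq_inner[of v] power2_eq_square[of "r w"])

lemma smooth_light: "smooth_on \<Omega> r \<Longrightarrow> smooth_on \<Omega> (\<lambda>u. r u *\<^sub>R light_vector (g u))"
  unfolding light_vector_eq[of "g _"]
  by (intro smooth_on_bilinear[OF open_\<Omega> bounded_bilinear_scaleR] smooth_on_add[OF open_\<Omega>]
     smooth_on_const smooth_on_bounded_linear[OF open_\<Omega> bounded_linear_space_embedding] smooth_g)

lemma inverse_speed:
  assumes "w \<in> \<Omega>"
  shows "(d_x g w \<bullet> d_x g w) powr (- (1/2)) = 1 / norm (d_x g w)"
  using conformal_factor(2)[OF assms]
  by (simp add: powr_minus_divide powr_half_sqrt norm_eq_sqrt_inner)

lemma is_normalized_lift_exists:
  "is_normalized_lift \<Omega> g (\<lambda>u. ((d_x g u \<bullet> d_x g u) powr (- (1/2))) *\<^sub>R light_vector (g u))"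
proof -
  have "smooth_on \<Omega> (\<lambda>u. (d_x g u \<bullet> d_x g u) powr (- (1/2)))"
    by (intro smooth_on_powr[OF open_\<Omega>] smooth_on_bilinear[OF open_\<Omega> bounded_bilinear_inner]
       smooth_on_d_x smooth_g) (use conformal_factor(2) in auto)
  note s = smooth_light[OF this] lorentz_scaled_light[OF _ this]
  have span: "span {r *\<^sub>R x} = span {x}" if "r \<noteq> 0" for r :: real and x :: "real ^ 4 option"
    using span_image_scale[of "{x}" "\<lambda>_. r"] that by simp
  show ?thesis
    unfolding is_normalized_lift_def
    by (auto simp: s inverse_speed conformal_factor(2)[THEN less_imp_neq[THEN not_sym]] forward_light_cone_def
        lorentz_linear lorentz_light_vector inner_self light_vector_None conformal_factor(2) intro!: span
        simp del: zero_less_norm_iff norm_eq_zero)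
qed

text \<open>The time component of a lift is its factor with respect to \<open>(1, g)\<close>, so it is smooth, and the
  normalization determines it.\<close>

lemma is_normalized_lift_eq:
  assumes "is_normalized_lift \<Omega> g \<psi>" "w \<in> \<Omega>"
  shows "\<psi> w = (1 / norm (d_x g w)) *\<^sub>R light_vector (g w)"
proof -
  have sm: "smooth_on \<Omega> (\<lambda>u. \<psi> u $ None)"
    using assms(1) by (intro smooth_on_vec_nth open_\<Omega>) (simp add: is_normalized_lift_def)
  have eq: "\<psi> u = (\<psi> u $ None) *\<^sub>R light_vector (g u)" if "u \<in> \<Omega>" for u
  proof -
    have "\<psi> u \<in> span {light_vector (g u)}"
      using assms(1) that span_base[of "\<psi> u" "{\<psi> u}"] unfolding is_normalized_lift_def by blast
    then obtain r where "\<psi> u = r *\<^sub>R light_vector (g u)"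
      by (auto simp: span_singleton)
    moreover from this have "\<psi> u $ None = r" by (simp add: light_vector_None)
    ultimately show ?thesis by simp
  qed
  have pos: "\<psi> w $ None > 0"
    using assms unfolding is_normalized_lift_def forward_light_cone_def by blast
  have "smooth_on \<Omega> \<psi>" using assms(1) by (simp add: is_normalized_lift_def)
  then have "d_x (\<lambda>u. (\<psi> u $ None) *\<^sub>R light_vector (g u)) w = d_x \<psi> w"
    by (intro d_xy_cong(1)[OF open_\<Omega> assms(2)]) (simp_all add: eq[symmetric])
  then have "lorentz (d_x \<psi> w) (d_x \<psi> w) = (\<psi> w $ None * norm (d_x g w))\<^sup>2"
    using lorentz_scaled_light[OF assms(2) sm, of 1] by (simp add: d_x_def)
  moreover have "lorentz (d_x \<psi> w) (d_x \<psi> w) = 1"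
    using assms unfolding is_normalized_lift_def d_x_def by (metis norm_one one_power2)
  ultimately have "\<psi> w $ None * norm (d_x g w) = 1"
    using pos conformal_factor(2)[OF assms(2)] by (simp add: power2_eq_1_iff) (smt (verit) mult_nonneg_nonneg norm_ge_zero)
  then have "\<psi> w $ None = 1 / norm (d_x g w)"
    using conformal_factor(2)[OF assms(2)] by (simp add: field_simps)
  then show ?thesis using eq[OF assms(2)] by simp
qed

lemma is_normalized_lift: "is_normalized_lift \<Omega> g (normalized_lift \<Omega> g)"
  unfolding normalized_lift_def by (rule someI[of "is_normalized_lift \<Omega> g"], rule is_normalized_lift_exists)

lemmas normalized_lift_eq = is_normalized_lift_eq[OF is_normalized_lift]

lemma null_lift: "null_lift \<Omega> (normalized_lift \<Omega> g)"
  using is_normalized_lift open_\<Omega>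
  by unfold_locales (simp_all add: is_normalized_lift_def forward_light_cone_def)

end

section \<open>Change of coordinate\<close>

text \<open>Both lifts are multiples of the same light vector, and the speeds differ by \<open>\<bar>h'\<bar>\<close>.\<close>

lemma lift_coordinate_change:
  assumes "surface_patch \<Omega> g" "surface_patch \<Omega>' g'" "h holomorphic_on S" "open S" "S \<subseteq> \<Omega>" "h ` S \<subseteq> \<Omega>'"
    and "\<And>w. w \<in> S \<Longrightarrow> g w = g' (h w)" and w: "w \<in> S"
  shows "deriv h w \<noteq> 0"
    "normalized_lift \<Omega> g w = (1 / cmod (deriv h w)) *\<^sub>R normalized_lift \<Omega>' g' (h w)"
proof -
  interpret a: surface_patch \<Omega> g by fact
  interpret b: surface_patch \<Omega>' g' by fact
  have w': "w \<in> \<Omega>" "h w \<in> \<Omega>'" using assms by auto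
  have "(h has_derivative (*) (deriv h w)) (at w)"
    using holomorphic_derivI[OF assms(3,4) w, of UNIV] by (simp add: has_field_derivative_def)
  from diff_chain_at[OF this smooth_on_has_derivative[OF b.smooth_g w'(2)]]
  have "((\<lambda>w. g' (h w)) has_derivative (\<lambda>v. frechet_derivative g' (at (h w)) (deriv h w * v))) (at w)"
    by (simp add: o_def)
  then have "(g has_derivative (\<lambda>v. frechet_derivative g' (at (h w)) (deriv h w * v))) (at w)"
    by (rule has_derivative_transform_within_open[OF _ assms(4) w])
       (simp add: assms(7))
  from frechet_derivative_at[OF this, symmetric]
  have "d_x g w = frechet_derivative g' (at (h w)) (deriv h w)" by (simp add: d_x_def)
  then have "(norm (d_x g w))\<^sup>2 = (norm (d_x g' (h w)) * cmod (deriv h w))\<^sup>2"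
    using b.conformal_factor(1)[OF w'(2), of "deriv h w" "deriv h w"]
    by (simp add: power_mult_distrib dot_square_norm)
  then have eq: "norm (d_x g w) = norm (d_x g' (h w)) * cmod (deriv h w)"
    by (simp add: power2_eq_iff_nonneg)
  then show h: "deriv h w \<noteq> 0"
    using a.conformal_factor(2)[OF w'(1)] by auto
  show "normalized_lift \<Omega> g w = (1 / cmod (deriv h w)) *\<^sub>R normalized_lift \<Omega>' g' (h w)"
    unfolding a.normalized_lift_eq[OF w'(1)] b.normalized_lift_eq[OF w'(2)]
    by (simp add: eq assms(7)[OF w])
qed

text \<open>The second summand depends on the factor \<open>m\<close> and on \<open>h\<close>, but not on the surface. For
  \<open>m = 1 / \<bar>h'\<bar>\<close> it is the classical Schwarzian derivative of \<open>h\<close>. The formula follows from \<open>c = 4 lorentz \<psi>_{zz} X\<close>, because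
  \<open>\<psi>_{zz}\<close> has no component along \<open>X\<close> and most of the pairings of the frame vanish.\<close>

lemma schwarzian_coordinate_change:
  assumes "null_lift S \<psi>" "null_lift \<Omega> \<phi>" "h holomorphic_on S" "h ` S \<subseteq> \<Omega>"
    and sm: "smooth_on S m"
    and \<psi>: "\<And>w. w \<in> S \<Longrightarrow> complexify (\<psi> w) = m w *s complexify (\<phi> (h w))" and w: "w \<in> S"
  shows "null_lift.c \<psi> w = (m w)\<^sup>2 * deriv h w * cnj (deriv h w) * (deriv h w)\<^sup>2 * null_lift.c \<phi> (h w)
    + 2 * ((dz m w * deriv h w + dz (\<lambda>w. m w * deriv h w) w) * dz m w * cnj (deriv h w)
       - dz (dz m) w * m w * deriv h w * cnj (deriv h w))"
proof -
  interpret a: null_lift S \<psi> by fact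
  interpret b: null_lift \<Omega> \<phi> by fact
  have hw: "h w \<in> \<Omega>" using assms(4) w by blast
  have dh: "deriv h holomorphic_on S" by (rule holomorphic_deriv[OF assms(3) a.open_\<Omega>])
  have sh: "smooth_on S h" "smooth_on S (deriv h)"
    by (rule smooth_on_holomorphic[OF a.open_\<Omega>], fact)+
  have comp: "smooth_on S (\<lambda>w. F (h w))" if "smooth_on \<Omega> F" for F :: "complex \<Rightarrow> complex ^ 4 option"
    by (rule smooth_on_compose[OF a.open_\<Omega> assms(4) sh(1) that])
  have chain: "d_z (\<lambda>w. F (h w)) w = deriv h w *s d_z F (h w)"
     "d_zb (\<lambda>w. F (h w)) w = cnj (deriv h w) *s d_zb F (h w)"
    if "smooth_on \<Omega> F" "w \<in> S" for F :: "complex \<Rightarrow> complex ^ 4 option" and w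
    by (rule wirtinger_holomorphic_compose; use that assms(4) holomorphic_derivI[OF assms(3) a.open_\<Omega> that(2), of UNIV]
       smooth_on_differentiable[OF that(1)] in auto)+
  have smh: "smooth_on S (\<lambda>w. m w * deriv h w)"
    by (rule smooth_on_bilinear[OF a.open_\<Omega> bounded_bilinear_mult sm sh(2)])
  have smP: "smooth_on S (\<lambda>w. m w *s b.P (h w))"
    by (rule smooth_on_bilinear[OF a.open_\<Omega> bounded_bilinear_vector_scalar_mult sm comp[OF b.smooth_P]])
  have Pz: "a.Pz v = dz m v *s b.P (h v) + (m v * deriv h v) *s b.Pz (h v)" if v: "v \<in> S" for v
  proof -
    have "a.Pz v = d_z (\<lambda>w. m w *s b.P (h w)) v"
      unfolding a.Pz_def by (rule wirtinger_cong(3)[OF a.open_\<Omega> v smP]) (simp add: a.P_def b.P_def \<psi>)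
    also have "\<dots> = dz m v *s b.P (h v) + m v *s d_z (\<lambda>w. b.P (h w)) v"
      by (rule wirtinger_scale(1)[OF smooth_on_differentiable[OF sm v] smooth_on_differentiable[OF comp[OF b.smooth_P] v]])
    finally show ?thesis
      by (simp add: chain(1)[OF b.smooth_P v] b.Pz_def vec_eq_iff mult.assoc)
  qed
  note s = a.wirtinger_linear_combination[OF w smooth_on_wirtinger(3)[OF a.open_\<Omega> sm] smh comp[OF b.smooth_P] comp[OF b.smooth_Pz] Pz]
  have Pzz: "a.Pzz w = dz (dz m) w *s b.P (h w) + (dz m w * deriv h w + dz (\<lambda>w. m w * deriv h w) w) *s b.Pz (h w)
     + (m w * deriv h w * deriv h w) *s b.Pzz (h w)"
    unfolding a.Pzz_def
    using s(1) unfolding chain(1)[OF b.smooth_P w] chain(1)[OF b.smooth_Pz w] b.Pz_def[symmetric] b.Pzz_def[symmetric]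
    by (simp add: vec_eq_iff algebra_simps)
  have X: "a.X w = dzb (dz m) w *s b.P (h w) + (dz m w * cnj (deriv h w)) *s b.Pb (h w)
     + dzb (\<lambda>w. m w * deriv h w) w *s b.Pz (h w) + (m w * deriv h w * cnj (deriv h w)) *s b.X (h w)"
    unfolding a.X_eq(1)[OF w] b.X_eq(1)[OF hw]
    using s(2) unfolding chain(2)[OF b.smooth_P w] chain(2)[OF b.smooth_Pz w] b.Pb_def[symmetric]
    by (simp add: vec_eq_iff algebra_simps)
  note g = b.gram_first_order[OF hw] b.gram_second_order[OF hw] b.gram_sym[OF hw]
  have c: "lorentz (b.Pzz (h w)) (b.X (h w)) = b.c (h w) / 4" by (simp add: b.c_def)
  show ?thesis
    unfolding a.c_def[of w] Pzz X
    by (simp add: lorentz_linear g c power2_eq_square algebra_simps)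
qed

text \<open>The difference of the Schwarzians of two surfaces is a quadratic differential.\<close>

lemma schwarzian_difference_coordinate_change:
  assumes "surface_patch \<Omega> g\<^sub>1" "surface_patch \<Omega>' g\<^sub>1'" "surface_patch \<Omega> g\<^sub>2" "surface_patch \<Omega>' g\<^sub>2'"
    and "h holomorphic_on S" "open S" "S \<subseteq> \<Omega>" "h ` S \<subseteq> \<Omega>'"
    and "\<And>w. w \<in> S \<Longrightarrow> g\<^sub>1 w = g\<^sub>1' (h w)" "\<And>w. w \<in> S \<Longrightarrow> g\<^sub>2 w = g\<^sub>2' (h w)" and w: "w \<in> S"
  shows "null_lift.c (normalized_lift \<Omega> g\<^sub>1) w - null_lift.c (normalized_lift \<Omega> g\<^sub>2) w =
    (deriv h w)\<^sup>2 * (null_lift.c (normalized_lift \<Omega>' g\<^sub>1') (h w) - null_lift.c (normalized_lift \<Omega>' g\<^sub>2') (h w))"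
proof -
  \<comment> \<open>The ratio of the two lifts, the same for both surfaces.\<close>
  define m where "m w = complex_of_real (1 / cmod (deriv h w))" for w
  have dh: "deriv h holomorphic_on S" by (rule holomorphic_deriv[OF assms(5,6)])
  have nz: "deriv h w \<noteq> 0" if "w \<in> S" for w
    using lift_coordinate_change(1)[OF assms(1,2,5,6,7,8,9) that] .
  have "smooth_on S (\<lambda>w. (deriv h w \<bullet> deriv h w) powr (- (1/2)))"
    by (intro smooth_on_powr smooth_on_bilinear[OF _ bounded_bilinear_inner] smooth_on_holomorphic dh assms)
       (simp add: nz)
  then have "smooth_on S (\<lambda>w. complex_of_real ((deriv h w \<bullet> deriv h w) powr (- (1/2))))"
    by (rule smooth_on_bounded_linear[OF assms(6) bounded_linear_of_real])
  then have sm: "smooth_on S m"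
    by (rule smooth_on_cong[OF assms(6)])
       (simp add: m_def powr_minus_divide powr_half_sqrt norm_eq_sqrt_inner)
  have nl: "null_lift S (normalized_lift \<Omega> g\<^sub>1)" "null_lift S (normalized_lift \<Omega> g\<^sub>2)"
    "null_lift \<Omega>' (normalized_lift \<Omega>' g\<^sub>1')" "null_lift \<Omega>' (normalized_lift \<Omega>' g\<^sub>2')"
    using assms by (auto intro: surface_patch.null_lift null_lift.restrict)
  have cl: "complexify (normalized_lift \<Omega> g\<^sub>1 w) = m w *s complexify (normalized_lift \<Omega>' g\<^sub>1' (h w))"
    "complexify (normalized_lift \<Omega> g\<^sub>2 w) = m w *s complexify (normalized_lift \<Omega>' g\<^sub>2' (h w))" if "w \<in> S" for w
    unfolding m_def complexify_linear(2)[symmetric]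
    using lift_coordinate_change(2)[OF assms(1,2,5,6,7,8,9) that]
      lift_coordinate_change(2)[OF assms(3,4,5,6,7,8,10) that] by simp_all
  have "deriv h w * cnj (deriv h w) = complex_of_real ((cmod (deriv h w))\<^sup>2)"
    by (rule complex_norm_square[symmetric])
  then have 1: "(m w)\<^sup>2 * deriv h w * cnj (deriv h w) = 1"
    using nz[OF w] by (simp add: m_def power_divide mult.assoc)
  \<comment> \<open>The inhomogeneous term, which cancels in the difference.\<close>
  define Q where "Q = 2 * ((dz m w * deriv h w + dz (\<lambda>w. m w * deriv h w) w) * dz m w * cnj (deriv h w)
       - dz (dz m) w * m w * deriv h w * cnj (deriv h w))"
  have "null_lift.c (normalized_lift \<Omega> g\<^sub>1) w = (m w)\<^sup>2 * deriv h w * cnj (deriv h w) *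
      (deriv h w)\<^sup>2 * null_lift.c (normalized_lift \<Omega>' g\<^sub>1') (h w) + Q"
    unfolding Q_def by (rule schwarzian_coordinate_change[OF nl(1,3) assms(5,8) sm cl(1) w])
  moreover have "null_lift.c (normalized_lift \<Omega> g\<^sub>2) w = (m w)\<^sup>2 * deriv h w * cnj (deriv h w) *
      (deriv h w)\<^sup>2 * null_lift.c (normalized_lift \<Omega>' g\<^sub>2') (h w) + Q"
    unfolding Q_def by (rule schwarzian_coordinate_change[OF nl(2,4) assms(5,8) sm cl(2) w])
  ultimately show ?thesis
    unfolding 1 by (simp add: algebra_simps)
qed

section \<open>Holomorphic coordinates\<close>

lemma chart_facts:
  assumes "is_chart (U, z)"
  shows "open U" "open (z ` U)" "inj_on z U" "continuous_on U z" "continuous_on (z ` U) (inv_into U z)"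
proof -
  have h: "homeomorphism U (z ` U) z (inv_into U z)" using assms by (simp add: is_chart_def)
  show "open U" "open (z ` U)" using assms by (simp_all add: is_chart_def)
  show "inj_on z U" using h by (auto simp: homeomorphism_def inj_on_def) metis
  show "continuous_on U z" "continuous_on (z ` U) (inv_into U z)" using h by (simp_all add: homeomorphism_def)
qed

lemma chart_image_open:
  assumes "is_chart (U, z)" "open W" "W \<subseteq> U"
  shows "open (z ` W)"
proof -
  have "homeomorphism U (z ` U) z (inv_into U z)" using assms by (simp add: is_chart_def)
  moreover have "openin (top_of_set U) W"
    using assms(2,3) by (simp add: open_subset)
  ultimately have "openin (top_of_set (z ` U)) (z ` W)"
    by (rule homeomorphism_imp_open_map)
  then show ?thesis using chart_facts(2)[OF assms(1)] openin_open_trans by blast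
qed

lemma chart_preimage_open:
  assumes "is_chart (U, z)" "open B"
  shows "open {p \<in> U. z p \<in> B}"
proof -
  have "open (z -` B \<inter> U)"
    using chart_facts(1,4)[OF assms(1)] assms(2) continuous_on_open_vimage by blast
  then show ?thesis by (simp add: vimage_def Int_def conj_commute)
qed

lemma atlas_chart:
  assumes "riemann_surface \<A>"
  obtains C where "C \<in> \<A>" "holomorphic_coordinate \<A> C" "p \<in> fst C"
proof -
  have "p \<in> \<Union> (fst ` \<A>)" using assms by (simp add: riemann_surface_def)
  then obtain C where C: "C \<in> \<A>" "p \<in> fst C" by blast
  then have "holomorphic_coordinate \<A> C"
    using assms by (auto simp: riemann_surface_def holomorphic_coordinate_def)
  then show ?thesis using C that by blast
qed

text \<open>Charts of the maximal atlas are related to each other through a chart of the given atlas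
  around each point.\<close>

lemma holomorphic_transition_coordinates:
  assumes "riemann_surface \<A>" "holomorphic_coordinate \<A> (U, z)" "holomorphic_coordinate \<A> (U', z')"
  shows "(z' \<circ> inv_into U z) holomorphic_on z ` (U \<inter> U')"
proof -
  have ch: "is_chart (U, z)" "is_chart (U', z')"
    using assms by (simp_all add: holomorphic_coordinate_def)
  have op: "open (z ` (U \<inter> U'))"
    using ch by (intro chart_image_open) (auto dest: chart_facts)
  have "(z' \<circ> inv_into U z) field_differentiable (at w)" if w: "w \<in> z ` (U \<inter> U')" for w
  proof -
    obtain p where p: "p \<in> U" "p \<in> U'" "w = z p" using w by blast
    obtain C0 where C0: "C0 \<in> \<A>" "holomorphic_coordinate \<A> C0" "p \<in> fst C0"
      by (rule atlas_chart[OF assms(1)])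
    obtain U0 z0 where C0': "C0 = (U0, z0)" by (cases C0)
    have ch0: "is_chart (U0, z0)" using C0 by (simp add: holomorphic_coordinate_def C0')
    let ?N = "z ` (U \<inter> U' \<inter> U0)"
    have opN: "open ?N"
      using ch ch0 by (intro chart_image_open) (auto dest: chart_facts)
    have 1: "(z0 \<circ> inv_into U z) holomorphic_on ?N"
      using assms(2) C0 unfolding C0' holomorphic_coordinate_def holomorphic_transition_def
      by (auto elim!: holomorphic_on_subset)
    have 2: "(z' \<circ> inv_into U0 z0) holomorphic_on z0 ` (U0 \<inter> U')"
      using assms(3) C0 unfolding C0' holomorphic_coordinate_def holomorphic_transition_def
      by auto
    have im: "(z0 \<circ> inv_into U z) ` ?N \<subseteq> z0 ` (U0 \<inter> U')"
      using chart_facts(3)[OF ch(1)] by auto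
    have "((z' \<circ> inv_into U0 z0) \<circ> (z0 \<circ> inv_into U z)) holomorphic_on ?N"
      by (rule holomorphic_on_compose_gen[OF 1 2 im])
    then have "(z' \<circ> inv_into U z) holomorphic_on ?N"
      by (rule holomorphic_transform) (use chart_facts(3)[OF ch(1)] chart_facts(3)[OF ch0] in auto)
    moreover have "w \<in> ?N" using p C0 by (auto simp: C0')
    ultimately show ?thesis using opN holomorphic_on_imp_differentiable_at by blast
  qed
  then show ?thesis
    using op by (simp add: holomorphic_on_def field_differentiable_at_within)
qed

text \<open>An injective holomorphic function of a coordinate is a coordinate, since its inverse is
  holomorphic.\<close>

lemma holomorphic_coordinate_compose:
  assumes rs: "riemann_surface \<A>" and hc: "holomorphic_coordinate \<A> (U, z)"
    and B: "open B" "B \<subseteq> z ` U" and k: "k holomorphic_on B" "inj_on k B"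
  shows "holomorphic_coordinate \<A> ({p \<in> U. z p \<in> B}, k \<circ> z)"
proof -
  let ?U = "{p \<in> U. z p \<in> B}"
  have ch: "is_chart (U, z)" using hc by (simp add: holomorphic_coordinate_def)
  note inj = chart_facts(3)[OF ch]
  obtain k' where k': "k' holomorphic_on k ` B" "\<And>b. b \<in> B \<Longrightarrow> k' (k b) = b"
    using holomorphic_has_inverse[OF k(1) B(1) k(2)] by metis
  have im: "z ` ?U = B" using B(2) by auto
  have imk: "(k \<circ> z) ` ?U = k ` B" by (simp only: image_comp[symmetric] im)
  have opk: "open (k ` B)" by (rule open_mapping_thm3[OF k(1) B(1) k(2)])
  have injk: "inj_on (k \<circ> z) ?U"
    by (intro comp_inj_on) (use inj k(2) im in \<open>auto intro: inj_on_subset\<close>)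
  have inv: "inv_into ?U (k \<circ> z) (k (z p)) = p" if "p \<in> ?U" for p
    using inv_into_f_f[OF injk that] by simp
  have invz: "inv_into U z (z p) = p" if "p \<in> U" for p
    by (rule inv_into_f_f[OF inj that])
  have inv_eq: "inv_into ?U (k \<circ> z) y = inv_into U z (k' y)" if y: "y \<in> k ` B" for y
  proof -
    obtain b where b: "b \<in> B" "y = k b" using y by blast
    then have "b \<in> z ` ?U" by (simp only: im)
    then obtain p where p: "p \<in> ?U" "y = k (z p)" using b(2) by blast
    then show ?thesis using inv[OF p(1)] invz k'(2) by simp
  qed
  have opU: "open ?U" by (rule chart_preimage_open[OF ch B(1)])
  have left: "\<forall>p\<in>?U. inv_into ?U (k \<circ> z) ((k \<circ> z) p) = p"
    using inv_into_f_f[OF injk] by blast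
  have right: "\<forall>y\<in>k ` B. (k \<circ> z) (inv_into ?U (k \<circ> z) y) = y"
    using f_inv_into_f[of _ "k \<circ> z" ?U] imk by blast
  have onto: "inv_into ?U (k \<circ> z) ` (k ` B) = ?U"
    using inv_into_image_cancel[OF injk order_refl] imk by simp
  have "continuous_on (k ` B) (\<lambda>y. inv_into U z (k' y))"
    by (rule continuous_on_compose2[OF chart_facts(5)[OF ch] holomorphic_on_imp_continuous_on[OF k'(1)]])
       (use k'(2) B(2) in auto)
  then have "continuous_on (k ` B) (inv_into ?U (k \<circ> z))"
    by (rule continuous_on_eq) (simp add: inv_eq)
  moreover have "continuous_on ?U (k \<circ> z)"
    unfolding o_def
    by (rule continuous_on_compose2[OF holomorphic_on_imp_continuous_on[OF k(1)]
          continuous_on_subset[OF chart_facts(4)[OF ch]]]) auto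
  ultimately have chart: "is_chart (?U, k \<circ> z)"
    using opU opk left right onto imk unfolding is_chart_def prod.case homeomorphism_def by auto
  have trans: "holomorphic_transition (?U, k \<circ> z) C0 \<and> holomorphic_transition C0 (?U, k \<circ> z)"
    if C0: "C0 \<in> \<A>" for C0
  proof -
    obtain U0 z0 where C0': "C0 = (U0, z0)" by (cases C0)
    have ch0: "is_chart (U0, z0)" using C0 rs by (auto simp: riemann_surface_def C0')
    note inj0 = chart_facts(3)[OF ch0]
    have t: "(z0 \<circ> inv_into U z) holomorphic_on z ` (U \<inter> U0)"
      "(z \<circ> inv_into U0 z0) holomorphic_on z0 ` (U0 \<inter> U)"
      using hc C0 unfolding C0' holomorphic_coordinate_def holomorphic_transition_def by auto
    have "((z0 \<circ> inv_into U z) \<circ> k') holomorphic_on (k \<circ> z) ` (?U \<inter> U0)"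
      by (rule holomorphic_on_compose_gen[OF holomorphic_on_subset[OF k'(1)] t(1)]) (auto simp: k'(2))
    then have "(z0 \<circ> inv_into ?U (k \<circ> z)) holomorphic_on (k \<circ> z) ` (?U \<inter> U0)"
      by (rule holomorphic_transform) (use inv_eq in auto)
    moreover have "(k \<circ> (z \<circ> inv_into U0 z0)) holomorphic_on z0 ` (U0 \<inter> ?U)"
      by (rule holomorphic_on_compose_gen[OF holomorphic_on_subset[OF t(2)] k(1)])
         (auto simp: inv_into_f_f[OF inj0])
    ultimately show ?thesis
      unfolding C0' holomorphic_transition_def by (simp add: o_assoc)
  qed
  show ?thesis
    unfolding holomorphic_coordinate_def using chart trans by blast
qed

section \<open>Invariants in a chart\<close>

lemma conformal_immersion_patch:
  assumes "conformal_immersion \<A> f" "holomorphic_coordinate \<A> C"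
  shows "surface_patch (coordinate_range C) (in_coordinate C f)"
proof -
  obtain U z where C: "C = (U, z)" by (cases C)
  have "open (z ` U)" using assms(2) by (simp add: C holomorphic_coordinate_def is_chart_def)
  moreover have "(f \<circ> inv_into U z) w \<in> S3" for w
    using assms(1) unfolding conformal_immersion_def by (simp add: image_subset_iff)
  moreover have "smooth_on (z ` U) (f \<circ> inv_into U z) \<and> (\<forall>w\<in>z ` U. \<exists>\<rho>>0. \<forall>u v.
      frechet_derivative (f \<circ> inv_into U z) (at w) u \<bullet>
      frechet_derivative (f \<circ> inv_into U z) (at w) v = \<rho> * (u \<bullet> v))"
    using assms unfolding conformal_immersion_def C coordinate_range_def in_coordinate_def by fastforce
  ultimately show ?thesis
    unfolding surface_patch_def C coordinate_range_def in_coordinate_def prod.case by blast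
qed

abbreviation chart_lift :: "('m \<Rightarrow> real ^ 4) \<Rightarrow> 'm chart \<Rightarrow> complex \<Rightarrow> real ^ 4 option" where
  "chart_lift f C \<equiv> normalized_lift (coordinate_range C) (in_coordinate C f)"

lemma hopf_schwarzian_eq:
  assumes "conformal_immersion \<A> f" "holomorphic_coordinate \<A> C" "p \<in> fst C"
  shows "hopf f C p = null_lift.\<kappa> (chart_lift f C) (snd C p)"
    "schwarzian f C p = null_lift.c (chart_lift f C) (snd C p)"
proof -
  interpret surface_patch "coordinate_range C" "in_coordinate C f"
    by (rule conformal_immersion_patch[OF assms(1,2)])
  interpret l: null_lift "coordinate_range C" "chart_lift f C" by (rule null_lift)
  have "snd C p \<in> coordinate_range C"
    using assms(3) by (auto simp: coordinate_range_def split: prod.splits)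
  note eq = l.schwarzian_hopf_eq_iff[OF this]
  have ex: "Ex (schwarzian_hopf_eq (chart_lift f C) (snd C p) c) \<longleftrightarrow> c = l.c (snd C p)" for c
    using eq by blast
  show "hopf f C p = l.\<kappa> (snd C p)" "schwarzian f C p = l.c (snd C p)"
    using eq ex by (simp_all add: hopf_def schwarzian_def Let_def)
qed

locale equal_hopf =
  fixes \<A> :: "'m::t2_space chart set" and f\<^sub>1 f\<^sub>2 :: "'m \<Rightarrow> real ^ 4"
  assumes riemann: "riemann_surface \<A>" and connected: "connected (UNIV :: 'm set)"
    and immersion\<^sub>1: "conformal_immersion \<A> f\<^sub>1" and immersion\<^sub>2: "conformal_immersion \<A> f\<^sub>2"
    and hopf_eq: "\<And>C p. holomorphic_coordinate \<A> C \<Longrightarrow> p \<in> fst C \<Longrightarrow> hopf f\<^sub>1 C p = hopf f\<^sub>2 C p"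
begin

abbreviation "coord \<equiv> holomorphic_coordinate \<A>"

definition "schwarzian_diff C w = null_lift.c (chart_lift f\<^sub>1 C) w - null_lift.c (chart_lift f\<^sub>2 C) w"

lemma coord_facts:
  fixes f :: "'m \<Rightarrow> 'b"
  assumes "coord C" "p \<in> fst C"
  shows "is_chart (fst C, snd C)" "open (fst C)" "open (coordinate_range C)" "inj_on (snd C) (fst C)"
    "snd C p \<in> coordinate_range C" "coordinate_range C = snd C ` fst C"
    "in_coordinate C f (snd C p) = f p"
proof -
  obtain U z where C: "C = (U, z)" by (cases C)
  then have ch: "is_chart (U, z)" using assms(1) by (simp add: holomorphic_coordinate_def)
  show "is_chart (fst C, snd C)" "open (fst C)" "open (coordinate_range C)" "inj_on (snd C) (fst C)"
    "snd C p \<in> coordinate_range C" "coordinate_range C = snd C ` fst C"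
    "in_coordinate C f (snd C p) = f p"
    using ch chart_facts(1-3)[OF ch] assms(2) by (simp_all add: C coordinate_range_def in_coordinate_def)
qed

lemma pair: "coord C \<Longrightarrow> hopf_pair (coordinate_range C) (chart_lift f\<^sub>1 C) (chart_lift f\<^sub>2 C)"
proof -
  assume C: "coord C"
  note p1 = surface_patch.null_lift[OF conformal_immersion_patch[OF immersion\<^sub>1 C]]
  note p2 = surface_patch.null_lift[OF conformal_immersion_patch[OF immersion\<^sub>2 C]]
  have "null_lift.\<kappa> (chart_lift f\<^sub>1 C) w = null_lift.\<kappa> (chart_lift f\<^sub>2 C) w"
    if "w \<in> coordinate_range C" for w
  proof -
    obtain p where "p \<in> fst C" "w = snd C p"
      using \<open>w \<in> coordinate_range C\<close> by (auto simp: coordinate_range_def split: prod.splits)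
    then show ?thesis
      using hopf_eq[OF C] hopf_schwarzian_eq(1)[OF immersion\<^sub>1 C] hopf_schwarzian_eq(1)[OF immersion\<^sub>2 C] by metis
  qed
  then show ?thesis
    using p1 p2 by (simp add: hopf_pair_def hopf_pair_axioms_def)
qed

lemma schwarzian_diff_eq: assumes "coord C" "w \<in> coordinate_range C"
  shows "schwarzian_diff C w = hopf_pair.D (chart_lift f\<^sub>1 C) (chart_lift f\<^sub>2 C) w"
  by (simp add: schwarzian_diff_def hopf_pair.D_def[OF pair[OF assms(1)]])

lemma holomorphic_schwarzian_diff: "coord C \<Longrightarrow> schwarzian_diff C holomorphic_on coordinate_range C"
  using hopf_pair.holomorphic_D[OF pair] by (rule holomorphic_transform) (simp_all add: schwarzian_diff_eq)

lemma hopf_schwarzian_diff_real: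
  assumes "coord C" "p \<in> fst C" shows "Im (hopf f\<^sub>1 C p * cnj (schwarzian_diff C (snd C p))) = 0"
  using hopf_pair.hopf_D_real[OF pair[OF assms(1)]] schwarzian_diff_eq[OF assms(1)] coord_facts(5)[OF assms]
    hopf_schwarzian_eq(1)[OF immersion\<^sub>1 assms] by simp

lemma schwarzian_diff_coordinate_change:
  assumes C: "coord C" and C': "coord C'" and p: "p \<in> fst C" "p \<in> fst C'"
  shows "schwarzian_diff C (snd C p) = (deriv (snd C' \<circ> inv_into (fst C) (snd C)) (snd C p))\<^sup>2 * schwarzian_diff C' (snd C' p)"
proof -
  obtain U z where [simp]: "C = (U, z)" by (cases C)
  obtain U' z' where [simp]: "C' = (U', z')" by (cases C')
  have ch: "is_chart (U, z)" "is_chart (U', z')" using C C' by (simp_all add: holomorphic_coordinate_def)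
  note inj = chart_facts(3)[OF ch(1)] chart_facts(3)[OF ch(2)]
  let ?h = "z' \<circ> inv_into U z" and ?S = "z ` (U \<inter> U')"
  have eq: "in_coordinate C f w = in_coordinate C' f (?h w)" if "w \<in> ?S" for f :: "'m \<Rightarrow> real ^ 4" and w
    using that inj by (auto simp: in_coordinate_def)
  have "schwarzian_diff C (z p) = (deriv ?h (z p))\<^sup>2 * schwarzian_diff C' (?h (z p))"
    unfolding schwarzian_diff_def
  proof (rule schwarzian_difference_coordinate_change)
    show "?h holomorphic_on ?S"
      using holomorphic_transition_coordinates[OF riemann] C C' by simp
    show "open ?S" using ch by (intro chart_image_open) (auto dest: chart_facts)
  qed (use p inj eq conformal_immersion_patch[OF immersion\<^sub>1] conformal_immersion_patch[OF immersion\<^sub>2] C C'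
       in \<open>auto simp: coordinate_range_def\<close>)
  then show ?thesis using p inj by simp
qed

end

section \<open>Congruence from a Lorentz transformation\<close>

lemma lorentz_light_vector_nonzero_time:
  assumes "lorentz_transformation L" "x \<in> S3"
  shows "L (light_vector x) $ None \<noteq> 0" "lorentz (L (light_vector x)) (L (light_vector x)) = 0"
proof -
  have xx: "x \<bullet> x = 1" using assms(2) by (simp add: norm_eq_1)
  show null: "lorentz (L (light_vector x)) (L (light_vector x)) = 0"
    by (simp add: lorentz_transformation_lorentz[OF assms(1)] lorentz_light_vector xx)
  show "L (light_vector x) $ None \<noteq> 0"
  proof
    assume 0: "L (light_vector x) $ None = 0"
    then have "(\<Sum>k\<in>UNIV. L (light_vector x) $ Some k * L (light_vector x) $ Some k) = 0"
      using null by (simp add: lorentz_def)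
    then have "L (light_vector x) = 0"
      using 0 by (simp add: sum_nonneg_eq_0_iff vec_eq_iff split_option_all)
    then have "lorentz (light_vector x) (light_vector (- x)) = 0"
      using lorentz_transformation_lorentz[OF assms(1), of "light_vector x" "light_vector (- x)"]
      by (simp add: lorentz_zero)
    then show False by (simp add: lorentz_light_vector xx)
  qed
qed

text \<open>A Lorentz transformation acts on the null lines, and a nonzero null vector has nonzero time
  component, so every such line meets the affine sphere \<open>{(1, x)}\<close>.\<close>

lemma moebius_congruentI:
  assumes L: "lorentz_transformation L" and "range f\<^sub>1 \<subseteq> S3"
    and eq: "\<And>q. \<exists>r>0. L (light_vector (f\<^sub>1 q)) = r *\<^sub>R light_vector (f\<^sub>2 q)"
  shows "moebius_congruent f\<^sub>1 f\<^sub>2"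
proof -
  define T where "T x = vec_lambda (\<lambda>k. L (light_vector x) $ Some k / L (light_vector x) $ None)" for x
  have "T x \<in> S3 \<and> span {L (light_vector x)} = span {light_vector (T x)}" if x: "x \<in> S3" for x
  proof -
    let ?v = "L (light_vector x)"
    note nz = lorentz_light_vector_nonzero_time(1)[OF L x]
    have "(\<Sum>k\<in>UNIV. ?v $ Some k * ?v $ Some k) = ?v $ None * ?v $ None"
      using lorentz_light_vector_nonzero_time(2)[OF L x] by (simp add: lorentz_def)
    moreover have "T x \<bullet> T x = (\<Sum>k\<in>UNIV. ?v $ Some k * ?v $ Some k) / (?v $ None * ?v $ None)"
      by (simp add: inner_vec_def T_def sum_divide_distrib)
    ultimately have "T x \<bullet> T x = 1" using nz by simp
    moreover have v: "?v = (?v $ None) *\<^sub>R light_vector (T x)"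
      using nz by (simp add: vec_eq_iff split_option_all light_vector_def T_def)
    moreover have "span {(?v $ None) *\<^sub>R light_vector (T x)} = span {light_vector (T x)}"
      using span_image_scale[of "{light_vector (T x)}" "\<lambda>_. ?v $ None"] nz by simp
    ultimately show ?thesis by (simp add: norm_eq_1)
  qed
  then have "moebius_transformation T"
    unfolding moebius_transformation_def using L by blast
  moreover have "f\<^sub>2 = T \<circ> f\<^sub>1"
  proof
    fix q
    obtain r where "r > 0" "L (light_vector (f\<^sub>1 q)) = r *\<^sub>R light_vector (f\<^sub>2 q)" using eq by blast
    then show "f\<^sub>2 q = (T \<circ> f\<^sub>1) q"
      by (simp add: T_def vec_eq_iff light_vector_def)
  qed
  ultimately show ?thesis unfolding moebius_congruent_def by blast
qed

text \<open>Near a zero of order \<open>n\<close> the phase of \<open>f\<close> along the ray \<open>w + t e\<close> tends to that of \<open>e^n g(w)\<close>, where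
  \<open>g(w)\<close> is the leading coefficient. The phase of \<open>k\<close> has a limit at \<open>w\<close>, and it is the same as that of
  \<open>f\<close> up to sign. The directions with \<open>e^n = 1\<close> and \<open>e^n = \<i>\<close> contradict each other.\<close>

lemma nonzero_if_real_against_nonvanishing:
  assumes hol: "f holomorphic_on ball w r" and "r > 0" and cont: "continuous_on (ball w r) k"
    and "k w \<noteq> 0" and real: "\<And>v. v \<in> ball w r \<Longrightarrow> Im (k v * cnj (f v)) = 0"
    and nonzero: "\<exists>v\<in>ball w r. f v \<noteq> 0"
  shows "f w \<noteq> 0"
proof
  assume fw: "f w = 0"
  have w: "w \<in> ball w r" using assms by simp
  have "\<not> f constant_on ball w r"
    using fw nonzero w unfolding constant_on_def by metis
  then obtain g s n where g: "0 < (n::nat)" "0 < s" "ball w s \<subseteq> ball w r" "g holomorphic_on ball w s"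
      "\<And>v. v \<in> ball w s \<Longrightarrow> f v = (v - w) ^ n * g v" "\<And>v. v \<in> ball w s \<Longrightarrow> g v \<noteq> 0"
    using holomorphic_factor_zero_nonconstant[OF hol open_ball connected_ball w fw] by metis
  have lim: "Im (k w * cnj (e ^ n * g w)) = 0" if e: "cmod e = 1" for e
  proof -
    have "((\<lambda>t. w + of_real t * e) \<longlongrightarrow> w + of_real 0 * e) (at_right 0)"
      by (intro tendsto_intros)
    then have tw: "((\<lambda>t. w + of_real t * e) \<longlongrightarrow> w) (at_right 0)" by simp
    have ck: "isCont k w" "isCont g w"
      using continuous_on_interior[OF cont] continuous_on_interior[OF holomorphic_on_imp_continuous_on[OF g(4)]]
        w g(2) by auto
    have "((\<lambda>t. Im (k (w + of_real t * e) * cnj (e ^ n * g (w + of_real t * e)))) \<longlongrightarrow>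
       Im (k w * cnj (e ^ n * g w))) (at_right 0)"
      by (intro tendsto_intros isCont_tendsto_compose[OF ck(1) tw] isCont_tendsto_compose[OF ck(2) tw])
    moreover have "\<forall>\<^sub>F t in at_right 0. Im (k (w + of_real t * e) * cnj (e ^ n * g (w + of_real t * e))) = 0"
      unfolding eventually_at_right_field
    proof (intro exI[of _ s] conjI allI impI)
      show "0 < s" by (rule g(2))
      fix t :: real assume t: "0 < t" "t < s"
      let ?v = "w + of_real t * e"
      have v: "?v \<in> ball w s" using t e by (simp add: dist_norm norm_mult)
      have "Im (k ?v * cnj (f ?v)) = 0" using real v g(3) by blast
      moreover have "k ?v * cnj (f ?v) = of_real (t ^ n) * (k ?v * cnj (e ^ n * g ?v))"
        by (simp add: g(5)[OF v] power_mult_distrib)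
      moreover have "Im (of_real a * z) = a * Im z" for a z by simp
      ultimately have "t ^ n * Im (k ?v * cnj (e ^ n * g ?v)) = 0" by metis
      then show "Im (k ?v * cnj (e ^ n * g ?v)) = 0" using t by simp
    qed
    ultimately have "((\<lambda>t::real. 0) \<longlongrightarrow> Im (k w * cnj (e ^ n * g w))) (at_right 0)"
      by (rule Lim_transform_eventually)
    then show ?thesis
      using tendsto_unique[OF _ tendsto_const] trivial_limit_at_right_real by metis
  qed
  have "real n * (pi / (2 * n)) = pi / 2" using g(1) by simp
  then have "(cis (pi / (2 * n))) ^ n = cis (pi / 2)" unfolding Complex.DeMoivre by (rule arg_cong)
  then have "(cis (pi / (2 * n))) ^ n = \<i>" by simp
  then have "Im (k w * cnj (\<i> * g w)) = 0" "Im (k w * cnj (g w)) = 0"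
    using lim[of "cis (pi / (2 * n))"] lim[of 1] by simp_all
  then have "k w * cnj (g w) = 0" by (simp add: complex_eq_iff algebra_simps)
  then show False using \<open>k w \<noteq> 0\<close> g(6)[of w] g(2) by simp
qed

context equal_hopf
begin

lemma range_f: "range f\<^sub>1 \<subseteq> S3" "range f\<^sub>2 \<subseteq> S3"
  using immersion\<^sub>1 immersion\<^sub>2 by (simp_all add: conformal_immersion_def)

text \<open>Flat points are the interior points of the zero set of the quadratic differential
  \<open>(c\<^sub>1 - c\<^sub>2) dz\<^sup>2\<close>.\<close>

definition flat :: "'m \<Rightarrow> bool" where
  "flat p \<longleftrightarrow> (\<exists>C W. coord C \<and> open W \<and> p \<in> W \<and> W \<subseteq> fst C \<and> (\<forall>q\<in>W. schwarzian_diff C (snd C q) = 0))"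

lemma flat_in_chart:
  assumes "flat p" "coord C" "p \<in> fst C"
  obtains W where "open W" "p \<in> W" "W \<subseteq> fst C" "\<And>q. q \<in> W \<Longrightarrow> schwarzian_diff C (snd C q) = 0"
proof -
  obtain C' W where W: "coord C'" "open W" "p \<in> W" "W \<subseteq> fst C'" "\<And>q. q \<in> W \<Longrightarrow> schwarzian_diff C' (snd C' q) = 0"
    using assms(1) unfolding flat_def by blast
  show ?thesis
  proof (rule that[of "W \<inter> fst C"])
    show "open (W \<inter> fst C)" using W(2) coord_facts(2)[OF assms(2,3)] by blast
    show "schwarzian_diff C (snd C q) = 0" if "q \<in> W \<inter> fst C" for q
      using schwarzian_diff_coordinate_change[OF assms(2) W(1), of q] W(4,5) that by auto
  qed (use W assms in auto)
qed

lemma open_flat: "open {p. flat p}"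
proof (subst open_subopen, safe)
  fix p assume "flat p"
  then obtain C W where "coord C" "open W" "p \<in> W" "W \<subseteq> fst C" "\<forall>q\<in>W. schwarzian_diff C (snd C q) = 0"
    unfolding flat_def by blast
  then show "\<exists>T. open T \<and> p \<in> T \<and> T \<subseteq> {p. flat p}"
    unfolding flat_def by blast
qed

lemma chart_ball:
  assumes "coord C" "p \<in> fst C"
  obtains r where "r > 0" "ball (snd C p) r \<subseteq> coordinate_range C"
    "open {q \<in> fst C. snd C q \<in> ball (snd C p) r}"
  using openE[OF coord_facts(3,5)[OF assms]] chart_preimage_open[OF coord_facts(1)[OF assms] open_ball] by metis

text \<open>The identity theorem in a disc; it makes the set of flat points closed.\<close>

lemma flat_ball:
  assumes C: "coord C" "p \<in> fst C" "ball (snd C p) r \<subseteq> coordinate_range C"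
    and q: "q \<in> fst C" "snd C q \<in> ball (snd C p) r" "flat q" and "w \<in> ball (snd C p) r"
  shows "schwarzian_diff C w = 0"
proof -
  let ?B = "ball (snd C p) r"
  obtain W where W: "open W" "q \<in> W" "W \<subseteq> fst C" "\<And>q. q \<in> W \<Longrightarrow> schwarzian_diff C (snd C q) = 0"
    using flat_in_chart[OF q(3) C(1) q(1)] by blast
  have "open (snd C ` W)"
    by (rule chart_image_open[OF coord_facts(1)[OF C(1,2)] W(1,3)])
  then have op: "open (snd C ` W \<inter> ?B)" by blast
  have hd: "schwarzian_diff C holomorphic_on ?B"
    using holomorphic_schwarzian_diff[OF C(1)] C(3) by (rule holomorphic_on_subset)
  show ?thesis
    by (rule analytic_continuation_open[OF op open_ball _ connected_ball _ hd, of "\<lambda>_. 0"])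
       (use W q assms(7) in auto)
qed

lemma open_not_flat: "open {p. \<not> flat p}"
proof (subst open_subopen, safe)
  fix p assume p: "\<not> flat p"
  obtain C where C: "coord C" "p \<in> fst C" using atlas_chart[OF riemann] by metis
  obtain r where r: "r > 0" "ball (snd C p) r \<subseteq> coordinate_range C"
    "open {q \<in> fst C. snd C q \<in> ball (snd C p) r}" (is "open ?N")
    by (rule chart_ball[OF C])
  have "\<not> flat q" if "q \<in> ?N" for q
  proof
    assume "flat q"
    then have "schwarzian_diff C w = 0" if "w \<in> ball (snd C p) r" for w
      using flat_ball[OF C r(2)] \<open>q \<in> ?N\<close> that by blast
    then have "flat p"
      unfolding flat_def using C r by (intro exI[of _ C] exI[of _ ?N]) auto
    then show False using p by blast
  qed
  then show "\<exists>T. open T \<and> p \<in> T \<and> T \<subseteq> {p. \<not> flat p}"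
    using r C by (intro exI[of _ ?N]) auto
qed

lemma clopen_property_everywhere:
  assumes "open {p::'m. Q p}" "open {p::'m. \<not> Q p}" "Q p"
  shows "Q q"
proof (rule ccontr)
  assume "\<not> Q q"
  then show False
    using connectedD[OF connected assms(1,2)] assms(3) by blast
qed

text \<open>Formulated with the maps to the sphere instead of their lifts, so that no coordinate is
  involved.\<close>

definition carries_near :: "(real ^ 4 option \<Rightarrow> real ^ 4 option) \<Rightarrow> 'm \<Rightarrow> bool" where
  "carries_near L p \<longleftrightarrow> proper_lorentz L \<and> (\<exists>W. open W \<and> p \<in> W \<and>
     (\<forall>q\<in>W. \<exists>r>0. L (light_vector (f\<^sub>1 q)) = r *\<^sub>R light_vector (f\<^sub>2 q)))"

lemma chart_lift_eq:
  assumes "conformal_immersion \<A> f" "coord C" "q \<in> fst C"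
  obtains s where "s > 0" "chart_lift f C (snd C q) = s *\<^sub>R light_vector (f q)"
proof -
  interpret surface_patch "coordinate_range C" "in_coordinate C f"
    by (rule conformal_immersion_patch[OF assms(1,2)])
  have "snd C q \<in> coordinate_range C" by (rule coord_facts(5)[OF assms(2,3)])
  from normalized_lift_eq[OF this] conformal_factor(2)[OF this] show ?thesis
    by (intro that[of "1 / norm (d_x (in_coordinate C f) (snd C q))"])
       (simp_all add: coord_facts(7)[OF assms(2,3)])
qed

lemma carries_near_exists:
  assumes "flat p"
  shows "\<exists>L. carries_near L p"
proof -
  obtain C where C: "coord C" "p \<in> fst C" using atlas_chart[OF riemann] by metis
  obtain r where r: "r > 0" "ball (snd C p) r \<subseteq> coordinate_range C"
    "open {q \<in> fst C. snd C q \<in> ball (snd C p) r}" (is "open ?N")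
    by (rule chart_ball[OF C])
  let ?B = "ball (snd C p) r"
  interpret H: hopf_pair "coordinate_range C" "chart_lift f\<^sub>1 C" "chart_lift f\<^sub>2 C" by (rule pair[OF C(1)])
  interpret h: hopf_pair ?B "chart_lift f\<^sub>1 C" "chart_lift f\<^sub>2 C"
    using H.A.restrict[OF open_ball r(2)] H.B.restrict[OF open_ball r(2)] H.same_hopf r(2)
    by (simp add: hopf_pair_def hopf_pair_axioms_def subset_iff)
  have "h.D w = 0" if w: "w \<in> ?B" for w
    using flat_ball[OF C r(2) C(2) _ assms w] r(1) schwarzian_diff_eq[OF C(1)] r(2) w by auto
  then obtain L where L: "proper_lorentz L" "\<And>w. w \<in> ?B \<Longrightarrow> L (chart_lift f\<^sub>1 C w) = chart_lift f\<^sub>2 C w"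
    using h.local_congruence[OF convex_ball] r(1) by auto
  have "\<exists>t>0. L (light_vector (f\<^sub>1 q)) = t *\<^sub>R light_vector (f\<^sub>2 q)" if q: "q \<in> ?N" for q
  proof -
    obtain s\<^sub>1 where s1: "s\<^sub>1 > 0" "chart_lift f\<^sub>1 C (snd C q) = s\<^sub>1 *\<^sub>R light_vector (f\<^sub>1 q)"
      using chart_lift_eq[OF immersion\<^sub>1 C(1)] q by blast
    obtain s\<^sub>2 where s2: "s\<^sub>2 > 0" "chart_lift f\<^sub>2 C (snd C q) = s\<^sub>2 *\<^sub>R light_vector (f\<^sub>2 q)"
      using chart_lift_eq[OF immersion\<^sub>2 C(1)] q by blast
    have "linear L" using L(1) by (simp add: proper_lorentz_def lorentz_transformation_def)
    then have "s\<^sub>1 *\<^sub>R L (light_vector (f\<^sub>1 q)) = s\<^sub>2 *\<^sub>R light_vector (f\<^sub>2 q)"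
      using L(2)[of "snd C q"] q unfolding s1 s2 by (simp add: linear_scale)
    then have "L (light_vector (f\<^sub>1 q)) = (s\<^sub>2 / s\<^sub>1) *\<^sub>R light_vector (f\<^sub>2 q)"
      using s1(1) by (metis divideR_right divide_inverse_commute less_irrefl scaleR_scaleR)
    then show ?thesis using s1(1) s2(1) by (intro exI[of _ "s\<^sub>2 / s\<^sub>1"]) simp
  qed
  then show ?thesis
    unfolding carries_near_def using L(1) r C(2) by (intro exI[of _ L] conjI exI[of _ ?N]) auto
qed

lemma carries_near_unique:
  assumes "carries_near L p" "carries_near M p"
  shows "L = M"
proof -
  obtain V where V: "open V" "p \<in> V" "\<And>q. q \<in> V \<Longrightarrow> \<exists>r>0. L (light_vector (f\<^sub>1 q)) = r *\<^sub>R light_vector (f\<^sub>2 q)"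
    using assms(1) unfolding carries_near_def by blast
  obtain W where W: "open W" "p \<in> W" "\<And>q. q \<in> W \<Longrightarrow> \<exists>r>0. M (light_vector (f\<^sub>1 q)) = r *\<^sub>R light_vector (f\<^sub>2 q)"
    using assms(2) unfolding carries_near_def by blast
  have LM: "proper_lorentz L" "proper_lorentz M" using assms by (simp_all add: carries_near_def)
  then have lin: "linear L" "linear M" by (simp_all add: proper_lorentz_def lorentz_transformation_def)
  obtain C where C: "coord C" "p \<in> fst C" using atlas_chart[OF riemann] by metis
  let ?N = "V \<inter> W \<inter> fst C"
  have op: "open (snd C ` ?N)"
    using V W coord_facts(1,2)[OF C] by (intro chart_image_open) auto
  have sub: "snd C ` ?N \<subseteq> coordinate_range C" using coord_facts(6)[OF C] by auto
  interpret l: null_lift "snd C ` ?N" "chart_lift f\<^sub>1 C"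
    by (rule null_lift.restrict[OF surface_patch.null_lift[OF conformal_immersion_patch[OF immersion\<^sub>1 C(1)]] op sub])
  show ?thesis
  proof (rule l.rigidity[OF LM])
    show "snd C ` ?N \<noteq> {}" using V W C by blast
    fix w assume "w \<in> snd C ` ?N"
    then obtain q where q: "q \<in> ?N" "w = snd C q" by blast
    obtain s where s: "s > 0" "chart_lift f\<^sub>1 C (snd C q) = s *\<^sub>R light_vector (f\<^sub>1 q)"
      using chart_lift_eq[OF immersion\<^sub>1 C(1)] q by blast
    obtain a where a: "a > 0" "L (light_vector (f\<^sub>1 q)) = a *\<^sub>R light_vector (f\<^sub>2 q)" using V(3) q by blast
    obtain b where b: "b > 0" "M (light_vector (f\<^sub>1 q)) = b *\<^sub>R light_vector (f\<^sub>2 q)" using W(3) q by blast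
    show "\<exists>r>0. L (chart_lift f\<^sub>1 C w) = r *\<^sub>R M (chart_lift f\<^sub>1 C w)"
      unfolding q(2) s(2)
      using a b by (intro exI[of _ "a / b"]) (simp add: linear_scale[OF lin(1)] linear_scale[OF lin(2)])
  qed
qed

text \<open>If one point is flat, all are. The locally defined congruences are unique, so the set of
  points near which a given one works is open, and so is its complement.\<close>

lemma flat_imp_congruent:
  assumes "flat p"
  shows "moebius_congruent f\<^sub>1 f\<^sub>2"
proof -
  have all: "flat q" for q
    by (rule clopen_property_everywhere[OF open_flat open_not_flat assms])
  obtain L where L: "carries_near L p" using carries_near_exists[OF assms] by blast
  have near: "\<exists>T. open T \<and> q \<in> T \<and> (\<forall>q'\<in>T. carries_near M q')" if "carries_near M q" for M q
    using that unfolding carries_near_def by blast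
  have "carries_near L q" for q
  proof (rule clopen_property_everywhere[where Q = "carries_near L", OF _ _ L])
    show "open {q. carries_near L q}"
    proof (subst open_subopen, safe)
      fix q assume "carries_near L q"
      from near[OF this] show "\<exists>T. open T \<and> q \<in> T \<and> T \<subseteq> {q. carries_near L q}"
        by (elim exE conjE) (intro exI conjI subsetI CollectI, assumption+, blast)
    qed
    show "open {q. \<not> carries_near L q}"
    proof (subst open_subopen, safe)
      fix q assume q: "\<not> carries_near L q"
      obtain M where M: "carries_near M q" using carries_near_exists[OF all] by blast
      obtain T where "open T \<and> q \<in> T \<and> (\<forall>q'\<in>T. carries_near M q')" using near[OF M] by (rule exE)
      then have T: "open T" "q \<in> T" "\<And>q'. q' \<in> T \<Longrightarrow> carries_near M q'" by simp_all
      have "\<not> carries_near L q'" if "q' \<in> T" for q'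
        using carries_near_unique[OF _ T(3)[OF that]] M q by blast
      then show "\<exists>T. open T \<and> q \<in> T \<and> T \<subseteq> {q. \<not> carries_near L q}" using T by blast
    qed
  qed
  then have "\<exists>r>0. L (light_vector (f\<^sub>1 q)) = r *\<^sub>R light_vector (f\<^sub>2 q)" for q
    unfolding carries_near_def by blast
  then show ?thesis
    using L range_f(1) by (intro moebius_congruentI[of L]) (auto simp: carries_near_def proper_lorentz_def)
qed

text \<open>The new coordinate is the integral of a square root of the quadratic differential, which
  exists where the latter has no zero.\<close>

lemma normalizing_coordinate:
  assumes C: "coord C" "p \<in> fst C" and nf: "\<not> flat p" and \<kappa>: "hopf f\<^sub>1 C p \<noteq> 0"
  obtains C' where "coord C'" "p \<in> fst C'" "\<And>q. q \<in> fst C' \<Longrightarrow> schwarzian_diff C' (snd C' q) = 1"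
proof -
  let ?w = "snd C p"
  obtain r where r: "r > 0" "ball ?w r \<subseteq> coordinate_range C"
    "open {q \<in> fst C. snd C q \<in> ball ?w r}" (is "open ?N")
    by (rule chart_ball[OF C])
  interpret H: hopf_pair "coordinate_range C" "chart_lift f\<^sub>1 C" "chart_lift f\<^sub>2 C" by (rule pair[OF C(1)])
  have hol: "schwarzian_diff C holomorphic_on ball ?w r"
    using holomorphic_schwarzian_diff[OF C(1)] r(2) by (rule holomorphic_on_subset)
  have "schwarzian_diff C ?w \<noteq> 0"
  proof (rule nonzero_if_real_against_nonvanishing[OF hol r(1)])
    show "continuous_on (ball ?w r) H.A.\<kappa>"
      using smooth_on_continuous[OF H.A.smooth_\<kappa>] r(2) continuous_on_subset by blast
    show "H.A.\<kappa> ?w \<noteq> 0" using \<kappa> hopf_schwarzian_eq(1)[OF immersion\<^sub>1 C] by simp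
    show "Im (H.A.\<kappa> v * cnj (schwarzian_diff C v)) = 0" if "v \<in> ball ?w r" for v
      using H.hopf_D_real[of v] schwarzian_diff_eq[OF C(1), of v] r(2) that by auto
    show "\<exists>v\<in>ball ?w r. schwarzian_diff C v \<noteq> 0"
    proof (rule ccontr)
      assume "\<not> (\<exists>v\<in>ball ?w r. schwarzian_diff C v \<noteq> 0)"
      then have "flat p"
        unfolding flat_def using C r by (intro exI[of _ C] exI[of _ ?N]) auto
      then show False using nf by blast
    qed
  qed
  moreover have "isCont (schwarzian_diff C) ?w"
    using holomorphic_on_imp_continuous_on[OF hol] r(1) by (intro continuous_on_interior) auto
  ultimately obtain d where d: "d > 0" "\<And>v. dist ?w v < d \<Longrightarrow> schwarzian_diff C v \<noteq> 0"
    using continuous_at_avoid[of ?w "schwarzian_diff C" 0] by blast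
  define B where "B = ball ?w (min r d)"
  have B: "convex B" "open B" "?w \<in> B" "B \<subseteq> ball ?w r" using r(1) d(1) by (auto simp: B_def)
  have nz: "schwarzian_diff C v \<noteq> 0" if "v \<in> B" for v using d(2)[of v] that by (simp add: B_def)
  obtain l where l: "l holomorphic_on B" "\<And>v. v \<in> B \<Longrightarrow> exp (l v) = schwarzian_diff C v"
    using holomorphic_logarithm_exists[OF B(1,2) holomorphic_on_subset[OF hol B(4)] nz B(3)] by metis
  \<comment> \<open>The square root is taken through a logarithm.\<close>
  define s where "s v = exp (l v / 2)" for v
  have s: "s holomorphic_on B" unfolding s_def by (intro holomorphic_intros l(1)) simp
  have ss: "(s v)\<^sup>2 = schwarzian_diff C v" if "v \<in> B" for v
    using l(2)[OF that] by (simp add: s_def power2_eq_square exp_add[symmetric])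
  obtain k where k': "\<And>v. v \<in> B \<Longrightarrow> (k has_field_derivative s v) (at v within B)"
    by (rule holomorphic_convex_primitive'[OF B(1,2) s]) blast
  have k: "(k has_field_derivative s v) (at v)" if "v \<in> B" for v
    using k'[OF that] unfolding at_within_open[OF that B(2)] .
  have holk: "k holomorphic_on B"
    unfolding holomorphic_on_open[OF B(2)] using k by blast
  have "deriv k ?w \<noteq> 0" using DERIV_imp_deriv[OF k[OF B(3)]] by (simp add: s_def)
  then obtain t where t: "t > 0" "ball ?w t \<subseteq> B" "inj_on k (ball ?w t)"
    using has_complex_derivative_locally_injective[OF holk B(3,2)] by metis
  let ?C' = "({q \<in> fst C. snd C q \<in> ball ?w t}, k \<circ> snd C)"
  have C': "coord ?C'"
    by (rule holomorphic_coordinate_compose[OF riemann])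
       (use C t B r(2) coord_facts(6)[OF C] holk in \<open>auto intro: holomorphic_on_subset\<close>)
  show ?thesis
  proof (rule that[OF C'])
    show "p \<in> fst ?C'" using C t by simp
    fix q assume q: "q \<in> fst ?C'"
    then have qC: "q \<in> fst C" "snd C q \<in> ball ?w t" by auto
    let ?h = "(k \<circ> snd C) \<circ> inv_into (fst C) (snd C)"
    have "deriv ?h (snd C q) = deriv k (snd C q)"
    proof (rule deriv_cong_ev)
      have "?h v = k v" if "v \<in> ball ?w t" for v
      proof -
        have "v \<in> snd C ` fst C" using that t B r(2) coord_facts(6)[OF C] by blast
        then show ?thesis by (simp add: f_inv_into_f)
      qed
      then show "\<forall>\<^sub>F v in nhds (snd C q). ?h v = k v"
        using eventually_nhds_in_open[OF open_ball qC(2)] by (auto elim: eventually_mono)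
    qed simp
    also have "\<dots> = s (snd C q)"
      using DERIV_imp_deriv[OF k] qC(2) t(2) by blast
    finally have "schwarzian_diff C (snd C q) = (s (snd C q))\<^sup>2 * schwarzian_diff ?C' (snd ?C' q)"
      using schwarzian_diff_coordinate_change[OF C(1) C' qC(1) q] by simp
    moreover have "(s (snd C q))\<^sup>2 = schwarzian_diff C (snd C q)" "schwarzian_diff C (snd C q) \<noteq> 0"
      using ss nz qC(2) t(2) by blast+
    ultimately show "schwarzian_diff ?C' (snd ?C' q) = 1" by simp
  qed
qed

lemma isothermic_coordinate:
  assumes "\<not> moebius_congruent f\<^sub>1 f\<^sub>2" "\<not> umbilic \<A> f\<^sub>1 p \<or> \<not> umbilic \<A> f\<^sub>2 p"
  obtains C where "coord C" "p \<in> fst C" "\<And>q. q \<in> fst C \<Longrightarrow> hopf f\<^sub>1 C q \<in> \<real>"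
    "\<And>q. q \<in> fst C \<Longrightarrow> schwarzian f\<^sub>1 C q - schwarzian f\<^sub>2 C q = 1"
proof -
  obtain C where C: "coord C" "p \<in> fst C" using atlas_chart[OF riemann] by metis
  have "hopf f\<^sub>1 C p \<noteq> 0"
    using assms(2) C hopf_eq[OF C] unfolding umbilic_def by metis
  moreover have "\<not> flat p" using flat_imp_congruent assms(1) by blast
  ultimately obtain C' where C': "coord C'" "p \<in> fst C'" "\<And>q. q \<in> fst C' \<Longrightarrow> schwarzian_diff C' (snd C' q) = 1"
    using normalizing_coordinate[OF C] by metis
  show ?thesis
  proof (rule that[OF C'(1,2)])
    fix q assume q: "q \<in> fst C'"
    show "hopf f\<^sub>1 C' q \<in> \<real>"
      using hopf_schwarzian_diff_real[OF C'(1) q] C'(3)[OF q] by (simp add: complex_is_Real_iff)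
    show "schwarzian f\<^sub>1 C' q - schwarzian f\<^sub>2 C' q = 1"
      using C'(3)[OF q] hopf_schwarzian_eq(2)[OF immersion\<^sub>1 C'(1) q]
        hopf_schwarzian_eq(2)[OF immersion\<^sub>2 C'(1) q] by (simp add: schwarzian_diff_def)
  qed
qed

end

theorem theorem3p3:
  fixes \<A> :: "'m::t2_space chart set"
    and f\<^sub>1 f\<^sub>2 :: "'m \<Rightarrow> real ^ 4"
  assumes "riemann_surface \<A>"
    and "connected (UNIV :: 'm set)"
    and "conformal_immersion \<A> f\<^sub>1"
    and "conformal_immersion \<A> f\<^sub>2"
    and "\<not> moebius_congruent f\<^sub>1 f\<^sub>2"
    and "\<And>C p. holomorphic_coordinate \<A> C \<Longrightarrow> p \<in> fst C \<Longrightarrow> hopf f\<^sub>1 C p = hopf f\<^sub>2 C p"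
  shows "isothermic \<A> f\<^sub>1 \<and> isothermic \<A> f\<^sub>2 \<and> same_associated_family \<A> f\<^sub>1 f\<^sub>2"
proof -
  interpret equal_hopf \<A> f\<^sub>1 f\<^sub>2
    using assms by unfold_locales
  have "isothermic \<A> f\<^sub>1"
    unfolding isothermic_def using isothermic_coordinate[OF assms(5)] by metis
  moreover have "isothermic \<A> f\<^sub>2"
    unfolding isothermic_def using isothermic_coordinate[OF assms(5)] hopf_eq by metis
  moreover have "same_associated_family \<A> f\<^sub>1 f\<^sub>2"
    unfolding same_associated_family_def
  proof (intro allI impI)
    fix p assume "\<not> umbilic \<A> f\<^sub>1 p \<or> \<not> umbilic \<A> f\<^sub>2 p"
    then obtain C where C: "coord C" "p \<in> fst C" "\<And>q. q \<in> fst C \<Longrightarrow> hopf f\<^sub>1 C q \<in> \<real>"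
      "\<And>q. q \<in> fst C \<Longrightarrow> schwarzian f\<^sub>1 C q - schwarzian f\<^sub>2 C q = 1"
      using isothermic_coordinate[OF assms(5)] by metis
    then show "\<exists>C. coord C \<and> p \<in> fst C \<and>
          (\<forall>q\<in>fst C. hopf f\<^sub>1 C q = hopf f\<^sub>2 C q \<and> hopf f\<^sub>1 C q \<in> \<real>) \<and>
          (\<exists>r::real. \<forall>q\<in>fst C. schwarzian f\<^sub>1 C q - schwarzian f\<^sub>2 C q = complex_of_real r)"
      using hopf_eq by (intro exI[of _ C] conjI exI[of _ 1]) auto
  qed
  ultimately show ?thesis by blast
qed

end
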